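(* For any $\alpha>0$ and $0<\gamma<d/2$ there exists a set $\widetilde\Omega\subset\Omega$ with $\mathbb P(\widetilde\Omega)=1$ such that for every $\omega\in\widetilde\Omega$ there is a positive finite energy $\mathcal E(\omega)=\mathcal E_{\alpha,\gamma}(\omega)$ for which $$\nu_l^\omega(E)\le e^{-\alpha/E^\gamma}$$ for all $0<E<\mathcal E(\omega)$ and for all $l$.
   Context: Let $d\ge1$, $\Lambda_l=(-l/2,l/2)^d$ for $l=1,2,3,\dots$, $V_l=l^d$. Random potential: $v^\omega(x)$, $\omega\in\Omega$, $x\in\mathbb R^d$, is a real random field on a probability space $(\Omega,\mathcal F,\mathbb P)$ (expectation $\mathbb E_\omega$) such that: (i) $v^\omega\ge0$; (ii) $p:=\mathbb P\{v^\omega(0)=0\}<1$; (iii) almost surely $\lim_{l\to\infty}E_1^{\omega,l}=0$ (notation below); (iv) there is a group of measure-preserving metrically transitive (ergodic) transformations $\{T_q\}_{q\in\mathbb R^d}$ of $\Omega$ with $v^\omega(x+q)=v^{T_q\omega}(x)$ for all $x,q$; (v) $\mathbb E_\omega\{\int_{\Lambda_1}|v^\omega(x)|^\kappa dx\}<\infty$ for some $\kappa>\max(2,d/2)$; (vi) there is a function $\phi$ with $\phi(r)\to0$ as $r\to\infty$ such that, for all disjoint bounded $D_1,D_2\subset\mathbb R^d$ and random variables $g,f$ measurable with respect to the $\sigma$-algebras generated by $\{v^\omega(x)\}_{x\in D_1}$ and $\{v^\omega(x)\}_{x\in D_2}$ respectively, with $|g|_\infty<\infty$ and $\mathbb E|f|<\infty$,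 one has $|\mathbb E\{|fg|\}-\mathbb E\{|f|\}\mathbb E\{|g|\}|\le|g|_\infty\mathbb E\{|f|\}\,\phi(d(D_1,D_2))$, where $d(D_1,D_2)$ is Euclidean distance. $h_l^\omega=-\frac12\Delta+v^\omega$ on $L^2(\Lambda_l)$ with Dirichlet boundary conditions (quadratic-form sum), with eigenvalues $E_1^{\omega,l}\le E_2^{\omega,l}\le\cdots$ (with multiplicity). Finite-volume integrated density of states: $\nu_l^\omega(E)=V_l^{-1}\#\{i:E_i^{\omega,l}\le E\}$. *)

theory Defs
  imports "HOL-Probability.Probability"
begin

section \<open>Dirichlet Schroedinger operators on bounded open sets\<close>

definition cube :: "nat \<Rightarrow> (real ^ 'd::finite) set" where
  "cube l = {x. \<forall>i. - (real l / 2) < x $ i \<and> x $ i < real l / 2}"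

text \<open>Elements of \<open>L\<^sup>2(S)\<close> are represented by functions on the whole space; only their
  values on \<open>S\<close>, up to null sets, matter.\<close>

definition L2_on :: "(real ^ 'd::finite) set \<Rightarrow> (real ^ 'd \<Rightarrow> 'b::real_normed_vector) \<Rightarrow> bool" where
  "L2_on S f \<longleftrightarrow> f \<in> borel_measurable (lebesgue_on S) \<and>
     integrable (lebesgue_on S) (\<lambda>x. (norm (f x))\<^sup>2)"

definition grad :: "(real ^ 'd::finite \<Rightarrow> complex) \<Rightarrow> real ^ 'd \<Rightarrow> complex ^ 'd" where
  "grad f x = (\<chi> i. frechet_derivative f (at x) (axis i 1))"

primrec Ck :: "nat \<Rightarrow> (real ^ 'd::finite \<Rightarrow> complex) \<Rightarrow> bool" where
  "Ck 0 f \<longleftrightarrow> continuous_on UNIV f"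
| "Ck (Suc k) f \<longleftrightarrow> (\<forall>x. f differentiable at x) \<and> (\<forall>i. Ck k (\<lambda>x. grad f x $ i))"

definition test_function :: "(real ^ 'd::finite) set \<Rightarrow> (real ^ 'd \<Rightarrow> complex) \<Rightarrow> bool" where
  "test_function S f \<longleftrightarrow> (\<forall>k. Ck k f) \<and>
     compact (closure {x. f x \<noteq> 0}) \<and> closure {x. f x \<noteq> 0} \<subseteq> S"

text \<open>\<open>H10 S u G\<close>: \<open>u\<close> belongs to \<open>H\<^sup>1\<^sub>0(S)\<close>, the closure of the test functions in the
  \<open>H\<^sup>1\<close> norm, and \<open>G\<close> is its weak gradient (determined almost everywhere by \<open>u\<close>).\<close>

definition H10 :: "(real ^ 'd::finite) set \<Rightarrow> (real ^ 'd \<Rightarrow> complex) \<Rightarrow> (real ^ 'd \<Rightarrow> complex ^ 'd) \<Rightarrow> bool" where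
  "H10 S u G \<longleftrightarrow> L2_on S u \<and> L2_on S G \<and>
     (\<exists>\<phi> :: nat \<Rightarrow> real ^ 'd \<Rightarrow> complex.
        (\<forall>n. test_function S (\<phi> n)) \<and>
        (\<lambda>n. \<integral>x. (norm (\<phi> n x - u x))\<^sup>2 \<partial>lebesgue_on S) \<longlonglongrightarrow> 0 \<and>
        (\<lambda>n. \<integral>x. (norm (grad (\<phi> n) x - G x))\<^sup>2 \<partial>lebesgue_on S) \<longlonglongrightarrow> 0)"

text \<open>Domain of the sum of the forms of the Dirichlet operator \<open>-\<Delta>/2\<close> and of the potential
  \<open>V \<ge> 0\<close>; the weak gradient is carried along.\<close>

definition form_dom ::
  "(real ^ 'd::finite) set \<Rightarrow> (real ^ 'd \<Rightarrow> real) \<Rightarrow> (real ^ 'd \<Rightarrow> complex) \<Rightarrow> (real ^ 'd \<Rightarrow> complex ^ 'd) \<Rightarrow> bool" where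
  "form_dom S V u G \<longleftrightarrow> H10 S u G \<and> integrable (lebesgue_on S) (\<lambda>x. V x * (norm (u x))\<^sup>2)"

text \<open>\<open>dirichlet_op S V u f\<close>: \<open>u\<close> lies in the domain of the self-adjoint operator \<open>h\<close> associated
  with this form, and \<open>h u = f\<close>.\<close>

definition dirichlet_op ::
  "(real ^ 'd::finite) set \<Rightarrow> (real ^ 'd \<Rightarrow> real) \<Rightarrow> (real ^ 'd \<Rightarrow> complex) \<Rightarrow> (real ^ 'd \<Rightarrow> complex) \<Rightarrow> bool" where
  "dirichlet_op S V u f \<longleftrightarrow> L2_on S f \<and>
     (\<exists>G. form_dom S V u G \<and>
       (\<forall>w H. form_dom S V w H \<longrightarrow>
          (1 / 2) * (\<integral>x. (\<Sum>i\<in>UNIV. G x $ i * cnj (H x $ i)) \<partial>lebesgue_on S)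
            + (\<integral>x. complex_of_real (V x) * u x * cnj (w x) \<partial>lebesgue_on S)
          = (\<integral>x. f x * cnj (w x) \<partial>lebesgue_on S)))"

definition eigenspace ::
  "(real ^ 'd::finite) set \<Rightarrow> (real ^ 'd \<Rightarrow> real) \<Rightarrow> real \<Rightarrow> (real ^ 'd \<Rightarrow> complex) set" where
  "eigenspace S V \<mu> = {u. dirichlet_op S V u (\<lambda>x. complex_of_real \<mu> * u x)}"

text \<open>The dimension of the eigenspace as a subspace of \<open>L\<^sup>2(S)\<close>, i.e. modulo null functions;
  it is \<open>0\<close> when \<open>\<mu>\<close> is not an eigenvalue.\<close>

definition eigen_mult :: "(real ^ 'd::finite) set \<Rightarrow> (real ^ 'd \<Rightarrow> real) \<Rightarrow> real \<Rightarrow> enat" where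
  "eigen_mult S V \<mu> = Sup {enat n | n. \<exists>u :: nat \<Rightarrow> real ^ 'd \<Rightarrow> complex.
     (\<forall>i<n. u i \<in> eigenspace S V \<mu>) \<and>
     (\<forall>c :: nat \<Rightarrow> complex. (AE x in lebesgue_on S. (\<Sum>i<n. c i * u i x) = 0) \<longrightarrow> (\<forall>i<n. c i = 0))}"

text \<open>The sum of the multiplicities of all eigenvalues \<open>\<le> E\<close>.\<close>

definition eigen_count :: "(real ^ 'd::finite) set \<Rightarrow> (real ^ 'd \<Rightarrow> real) \<Rightarrow> real \<Rightarrow> enat" where
  "eigen_count S V E = (SUP F\<in>{F. finite F \<and> F \<subseteq> {..E}}. \<Sum>\<mu>\<in>F. eigen_mult S V \<mu>)"

text \<open>The \<open>n\<close>-th eigenvalue (\<open>n \<ge> 1\<close>) in nondecreasing order, repeated according to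
  multiplicity. It is extended-real valued so that it is \<open>\<infinity>\<close>, rather than an arbitrary number,
  should there be fewer than \<open>n\<close> eigenvalues.\<close>

definition nth_eigenvalue :: "(real ^ 'd::finite) set \<Rightarrow> (real ^ 'd \<Rightarrow> real) \<Rightarrow> nat \<Rightarrow> ereal" where
  "nth_eigenvalue S V n = Inf {ereal \<mu> | \<mu>. enat n \<le> eigen_count S V \<mu>}"

text \<open>The number of indices is taken in \<open>ennreal\<close>, so an infinite set of indices would give \<open>\<infinity>\<close>
  and not the junk value of \<open>card\<close>.\<close>

definition ids :: "nat \<Rightarrow> (real ^ 'd::finite \<Rightarrow> real) \<Rightarrow> real \<Rightarrow> ennreal" where
  "ids l V E = emeasure (count_space UNIV) {i::nat. 1 \<le> i \<and> nth_eigenvalue (cube l) V i \<le> ereal E}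
                 / ennreal (real l ^ CARD('d))"

section \<open>The random potential\<close>

definition generated_sigma ::
  "'w measure \<Rightarrow> ('w \<Rightarrow> real ^ 'd::finite \<Rightarrow> real) \<Rightarrow> (real ^ 'd) set \<Rightarrow> 'w measure" where
  "generated_sigma M v D =
     sigma (space M) {(\<lambda>\<omega>. v \<omega> x) -` B \<inter> space M | x B. x \<in> D \<and> B \<in> sets borel}"

definition ergodic_group :: "'w measure \<Rightarrow> (real ^ 'd::finite \<Rightarrow> 'w \<Rightarrow> 'w) \<Rightarrow> bool" where
  "ergodic_group M T \<longleftrightarrow>
     (\<forall>q. T q \<in> measurable M M \<and> distr M M (T q) = M) \<and>
     (\<forall>\<omega>\<in>space M. T 0 \<omega> = \<omega>) \<and>
     (\<forall>p q. \<forall>\<omega>\<in>space M. T (p + q) \<omega> = T p (T q \<omega>)) \<and>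
     (\<forall>A\<in>sets M. (\<forall>q. T q -` A \<inter> space M = A) \<longrightarrow> measure M A = 0 \<or> measure M A = 1)"

definition decorrelated ::
  "'w measure \<Rightarrow> ('w \<Rightarrow> real ^ 'd::finite \<Rightarrow> real) \<Rightarrow> (real \<Rightarrow> real) \<Rightarrow> bool" where
  "decorrelated M v \<phi> \<longleftrightarrow>
     (\<forall>D1 D2 f g. bounded D1 \<and> bounded D2 \<and> D1 \<inter> D2 = {} \<and>
        g \<in> borel_measurable (generated_sigma M v D1) \<and>
        f \<in> borel_measurable (generated_sigma M v D2) \<and>
        esssup M (\<lambda>\<omega>. ereal \<bar>g \<omega>\<bar>) < \<infinity> \<and> integrable M f \<longrightarrow>
        \<bar>(\<integral>\<omega>. \<bar>f \<omega> * g \<omega>\<bar> \<partial>M) - (\<integral>\<omega>. \<bar>f \<omega>\<bar> \<partial>M) * (\<integral>\<omega>. \<bar>g \<omega>\<bar> \<partial>M)\<bar>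
          \<le> real_of_ereal (esssup M (\<lambda>\<omega>. ereal \<bar>g \<omega>\<bar>)) * (\<integral>\<omega>. \<bar>f \<omega>\<bar> \<partial>M) * \<phi> (setdist D1 D2))"

text \<open>As usual for a random field whose paths are integrated, \<open>v\<close> is jointly measurable.\<close>

locale random_potential = prob_space M
  for M :: "'w measure" +
  fixes v :: "'w \<Rightarrow> real ^ 'd::finite \<Rightarrow> real"
  assumes measurable_potential:
      "(\<lambda>(\<omega>, x). v \<omega> x) \<in> borel_measurable (M \<Otimes>\<^sub>M borel)"
    and nonneg: "\<And>\<omega> x. \<omega> \<in> space M \<Longrightarrow> 0 \<le> v \<omega> x"
    and nontrivial: "measure M {\<omega> \<in> space M. v \<omega> 0 = 0} < 1"
    and ground_state:
      "AE \<omega> in M. (\<lambda>l. nth_eigenvalue (cube l) (v \<omega>) 1) \<longlonglongrightarrow> 0"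
    and stationary: "\<exists>T. ergodic_group M T \<and>
      (\<forall>\<omega>\<in>space M. \<forall>x q. v \<omega> (x + q) = v (T q \<omega>) x)"
    and moment: "\<exists>\<kappa>::real. \<kappa> > max 2 (real CARD('d) / 2) \<and>
      (\<integral>\<^sup>+ \<omega>. (\<integral>\<^sup>+ x. ennreal (\<bar>v \<omega> x\<bar> powr \<kappa>) * indicator (cube 1) x \<partial>lborel) \<partial>M) < \<infinity>"
    and mixing: "\<exists>\<phi> :: real \<Rightarrow> real. (\<phi> \<longlongrightarrow> 0) at_top \<and> decorrelated M v \<phi>"

end

theory Submission
  imports Defs
begin

text \<open>Tile space by cubes of side \<open>R = N L\<close> and call a cube bad if the mean of \<open>min v 1\<close> over it is
  below a small constant \<open>\<eta>\<close>. By the Poincare inequality, a function with mean zero on every bad cube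
  has energy larger than \<open>E = b / N\<^sup>2\<close> per unit norm, so the number of eigenvalues below \<open>E\<close> in the
  box of side \<open>l\<close> is at most the number of bad cubes that meet the box. Mixing makes
  a cube bad with probability at most \<open>exp (- \<eta> N\<^sup>d)\<close>, and Wiener's maximal inequality controls the density
  of bad cubes for all \<open>l\<close> at once. Since \<open>2 \<gamma> < d\<close>, the probability that this density
  exceeds \<open>exp (- \<alpha> / E\<^sup>\<gamma>)\<close> is summable over \<open>N\<close>, and the Borel-Cantelli lemma applies.\<close>

section \<open>A maximal inequality for lattice actions\<close>

text \<open>The set of full measure and the threshold energy must serve every l at once, small boxes
  included. A limit theorem for growing l has the quantifiers in the wrong order; a maximal
  inequality has them right, at the price of a factor 1/t for density t. With t of order exp (-
  \<alpha> / E^\<gamma>) and N of order E^(-1/2), the price is exp (const * N^(2 \<gamma>)) against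
  the gain exp (- \<eta> N^d): this is where \<gamma> < d/2 comes from. The length L is fixed once,
  so large that the mixing error beyond L is at most half the gap between 1 and the expectation of
  exp (- min v 1); only N grows. Eigenvalues are counted by linear algebra: with more independent
  eigenfunctions than bad cubes, some nontrivial combination has mean zero on every bad cube and
  hence too much energy. Capping v at 1 gives a weight with values in [0,1], so the weighted
  Poincare inequality has constants independent of the potential.\<close>

definition lattice_box :: "('d \<Rightarrow> int) \<Rightarrow> nat \<Rightarrow> ('d \<Rightarrow> int) set" where
  "lattice_box c m = {i. \<forall>k. \<bar>i k - c k\<bar> \<le> int m}"

lemma lattice_box_eq_PiE:
  "lattice_box c m = (\<Pi>\<^sub>E k\<in>UNIV. {c k - int m..c k + int m})"
  by (auto simp: lattice_box_def PiE_iff abs_le_iff algebra_simps)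

lemma finite_lattice_box [simp]: "finite (lattice_box (c :: 'd::finite \<Rightarrow> int) m)"
  by (simp add: lattice_box_eq_PiE finite_PiE)

lemma card_lattice_box:
  "card (lattice_box (c :: 'd::finite \<Rightarrow> int) m) = (2 * m + 1) ^ CARD('d)"
proof -
  have "nat (c k + int m - (c k - int m) + 1) = 2 * m + 1" for k by simp
  then show ?thesis by (simp add: lattice_box_eq_PiE card_PiE)
qed

text \<open>Greedy selection: boxes are taken in order of decreasing radius.\<close>
lemma lattice_Vitali:
  fixes B :: "('d::finite \<Rightarrow> int) set" and r :: "('d \<Rightarrow> int) \<Rightarrow> nat"
  assumes "finite B"
  shows "\<exists>C\<subseteq>B. disjoint_family_on (\<lambda>c. lattice_box c (r c)) C \<and>
    B \<subseteq> (\<Union>c\<in>C. lattice_box c (2 * r c))"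
  using assms
proof (induction "card B" arbitrary: B rule: less_induct)
  case less
  show ?case
  proof (cases "B = {}")
    case False
    obtain c where c: "c \<in> B" "\<And>b. b \<in> B \<Longrightarrow> r b \<le> r c"
    proof -
      have "Max (r ` B) \<in> r ` B" using less.prems False by (intro Max_in) auto
      then obtain c where "c \<in> B" "r c = Max (r ` B)" by auto
      then show ?thesis using less.prems that by (metis Max_ge finite_imageI imageI)
    qed
    define B' where "B' = {b\<in>B. lattice_box b (r b) \<inter> lattice_box c (r c) = {}}"
    have c_self: "b \<in> lattice_box b m" for b :: "'d \<Rightarrow> int" and m by (simp add: lattice_box_def)
    have "c \<notin> B'" using c_self by (auto simp: B'_def)
    then have "B' \<subset> B" using c by (auto simp: B'_def)
    then have "card B' < card B" "finite B'"
      using less.prems psubset_card_mono finite_subset by (blast, meson finite_subset psubset_imp_subset)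
    from less.hyps[OF this] obtain C where C: "C \<subseteq> B'"
      "disjoint_family_on (\<lambda>c. lattice_box c (r c)) C"
      "B' \<subseteq> (\<Union>c\<in>C. lattice_box c (2 * r c))" by blast
    \<comment> \<open>Only the centre \<open>b\<close> has to be covered, not its whole box:
      \<open>r b + r c \<le> 2 * r c\<close>, since \<open>c\<close> has the largest radius.\<close>
    have "b \<in> lattice_box c (2 * r c)" if b: "b \<in> B" "b \<notin> B'" for b
    proof -
      obtain i where i: "i \<in> lattice_box b (r b)" "i \<in> lattice_box c (r c)"
        using b by (auto simp: B'_def)
      have "\<bar>b k - c k\<bar> \<le> int (2 * r c)" for k
      proof -
        have "\<bar>i k - b k\<bar> \<le> int (r b)" "\<bar>i k - c k\<bar> \<le> int (r c)" using i by (auto simp: lattice_box_def)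
        moreover have "r b \<le> r c" using c b by blast
        ultimately show ?thesis by simp
      qed
      then show ?thesis by (simp add: lattice_box_def)
    qed
    moreover have "disjoint_family_on (\<lambda>c. lattice_box c (r c)) (insert c C)"
      using C(1,2) by (auto simp: disjoint_family_on_def B'_def)
    moreover have "insert c C \<subseteq> B" using C(1) c \<open>B' \<subset> B\<close> by auto
    ultimately show ?thesis using C(3) by (intro exI[of _ "insert c C"]) blast
  qed (auto simp: disjoint_family_on_def)
qed

section \<open>Transference from the lattice to a measure-preserving action\<close>

locale lattice_action = prob_space M for M :: "'w measure" +
  fixes \<tau> :: "('d::finite \<Rightarrow> int) \<Rightarrow> 'w \<Rightarrow> 'w"
  assumes measurable_action [measurable]: "\<And>j. \<tau> j \<in> measurable M M"
    and distr_action: "\<And>j. distr M M (\<tau> j) = M"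
    and action_add: "\<And>i j \<omega>. \<omega> \<in> space M \<Longrightarrow> \<tau> (\<lambda>k. i k + j k) \<omega> = \<tau> i (\<tau> j \<omega>)"
begin

lemma prob_action_vimage:
  assumes "A \<in> sets M"
  shows "prob (\<tau> j -` A \<inter> space M) = prob A"
proof -
  have "measure (distr M M (\<tau> j)) A = prob (\<tau> j -` A \<inter> space M)"
    using assms by (intro measure_distr) auto
  then show ?thesis by (simp add: distr_action)
qed

text \<open>An unnormalised ergodic average of \<open>A\<close>, kept as a count: for fixed
  \<open>\<omega>\<close> the maximal inequality becomes a statement about finite subsets of the
  lattice.\<close>

definition visits :: "'w set \<Rightarrow> nat \<Rightarrow> 'w \<Rightarrow> nat" where
  "visits A m \<omega> = card {i\<in>lattice_box (\<lambda>_. 0) m. \<tau> i \<omega> \<in> A}"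

lemma visits_eq_sum:
  "real (visits A m \<omega>) = (\<Sum>i\<in>lattice_box (\<lambda>_. 0) m. indicator A (\<tau> i \<omega>))"
  by (simp add: visits_def indicator_def sum.If_cases Int_def)

lemma measurable_visits [measurable]:
  assumes [measurable]: "A \<in> sets M"
  shows "(\<lambda>\<omega>. real (visits A m \<omega>)) \<in> borel_measurable M"
  unfolding visits_eq_sum by measurable

lemma expectation_visits:
  assumes [measurable]: "A \<in> sets M"
  shows "expectation (\<lambda>\<omega>. real (visits A m \<omega>)) = real ((2 * m + 1) ^ CARD('d)) * prob A"
proof -
  have "expectation (\<lambda>\<omega>. indicator A (\<tau> i \<omega>)) = prob A" for i
  proof -
    have "expectation (\<lambda>\<omega>. indicator A (\<tau> i \<omega>)) = expectation (indicator (\<tau> i -` A \<inter> space M))"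
      by (intro Bochner_Integration.integral_cong) (auto simp: indicator_def)
    also have "\<dots> = prob (\<tau> i -` A \<inter> space M)" by simp
    also have "\<dots> = prob A" by (rule prob_action_vimage[OF assms])
    finally show ?thesis .
  qed
  moreover have "integrable M (\<lambda>\<omega>. indicator A (\<tau> i \<omega>) :: real)" for i
    by (rule integrable_const_bound[of _ 1]) (auto simp: indicator_def)
  ultimately show ?thesis
    unfolding visits_eq_sum by (subst Bochner_Integration.integral_sum) (auto simp: card_lattice_box)
qed

lemma visits_translate:
  assumes "\<omega> \<in> space M"
  shows "visits A m (\<tau> j \<omega>) = card {i\<in>lattice_box j m. \<tau> i \<omega> \<in> A}"
proof -
  have "bij_betw (\<lambda>i k. i k + j k) {i\<in>lattice_box (\<lambda>_. 0) m. \<tau> i (\<tau> j \<omega>) \<in> A}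
      {i\<in>lattice_box j m. \<tau> i \<omega> \<in> A}"
  proof (rule bij_betw_byWitness[where f' = "\<lambda>i k. i k - j k"], goal_cases)
    case 4
    have "\<tau> (\<lambda>k. i k - j k) (\<tau> j \<omega>) = \<tau> i \<omega>" for i
      using action_add[OF assms, of "\<lambda>k. i k - j k" j] by simp
    then show ?case by (auto simp: lattice_box_def)
  qed (auto simp: lattice_box_def action_add[OF assms])
  then show ?thesis unfolding visits_def by (rule bij_betw_same_card)
qed

text \<open>The orbit of \<open>\<omega>\<close> serves as a copy of the lattice. Each site counted
  on the left is the centre of a box with more than \<open>t\<close> times its size in visits. A
  disjoint subfamily has doubled boxes that cover these sites, and since radii are capped by
  \<open>K\<close> all its visits lie in the box of radius \<open>n + K\<close>.\<close>

lemma maximal_count: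
  assumes \<omega>: "\<omega> \<in> space M" and t: "0 < t"
  shows "t * real (card {j\<in>lattice_box (\<lambda>_. 0) n. \<exists>m\<le>K. t * real ((2 * m + 1) ^ CARD('d)) < real (visits A m (\<tau> j \<omega>))})
    \<le> 2 ^ CARD('d) * real (visits A (n + K) \<omega>)"
proof -
  define B where "B = {j\<in>lattice_box (\<lambda>_. 0) n. \<exists>m\<le>K. t * real ((2 * m + 1) ^ CARD('d)) < real (visits A m (\<tau> j \<omega>))}"
  have finB: "finite B" by (simp add: B_def)
  define r where "r j = (SOME m. m \<le> K \<and> t * real ((2 * m + 1) ^ CARD('d)) < real (visits A m (\<tau> j \<omega>)))" for j
  have r: "r j \<le> K" "t * real ((2 * r j + 1) ^ CARD('d)) < real (visits A (r j) (\<tau> j \<omega>))" if "j \<in> B" for j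
    using someI_ex[of "\<lambda>m. m \<le> K \<and> t * real ((2 * m + 1) ^ CARD('d)) < real (visits A m (\<tau> j \<omega>))"] that
    by (auto simp: B_def r_def)
  obtain C where C: "C \<subseteq> B" "disjoint_family_on (\<lambda>c. lattice_box c (r c)) C"
    "B \<subseteq> (\<Union>c\<in>C. lattice_box c (2 * r c))" using lattice_Vitali[OF finB] by blast
  have finC: "finite C" using C(1) finB finite_subset by blast
  have "card B \<le> card (\<Union>c\<in>C. lattice_box c (2 * r c))" using C(3) finC by (intro card_mono) auto
  also have "\<dots> \<le> (\<Sum>c\<in>C. card (lattice_box c (2 * r c)))" by (rule card_UN_le[OF finC])
  \<comment> \<open>\<open>4 * r c + 1 \<le> 2 * (2 * r c + 1)\<close>, so doubling the radius costs
    at most \<open>2 ^ CARD('d)\<close>.\<close>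
  also have "\<dots> \<le> (\<Sum>c\<in>C. 2 ^ CARD('d) * (2 * r c + 1) ^ CARD('d))"
    by (intro sum_mono) (auto simp: card_lattice_box simp flip: power_mult_distrib intro!: power_mono)
  finally have "real (card B) \<le> real (\<Sum>c\<in>C. 2 ^ CARD('d) * (2 * r c + 1) ^ CARD('d))"
    by (simp only: of_nat_le_iff)
  then have "t * real (card B) \<le> t * real (\<Sum>c\<in>C. 2 ^ CARD('d) * (2 * r c + 1) ^ CARD('d))"
    using t by (intro mult_left_mono) auto
  also have "\<dots> = 2 ^ CARD('d) * (\<Sum>c\<in>C. t * real ((2 * r c + 1) ^ CARD('d)))"
    by (simp add: sum_distrib_left algebra_simps)
  also have "\<dots> \<le> 2 ^ CARD('d) * (\<Sum>c\<in>C. real (card {i\<in>lattice_box c (r c). \<tau> i \<omega> \<in> A}))"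
    using r C(1) by (intro mult_left_mono sum_mono) (auto simp: visits_translate[OF \<omega>] less_imp_le subset_iff)
  also have "(\<Sum>c\<in>C. real (card {i\<in>lattice_box c (r c). \<tau> i \<omega> \<in> A}))
      = real (card (\<Union>c\<in>C. {i\<in>lattice_box c (r c). \<tau> i \<omega> \<in> A}))"
    using C(2) finC by (subst card_UN_disjoint) (auto simp: disjoint_family_on_def)
  also have "\<dots> \<le> real (visits A (n + K) \<omega>)"
  proof -
    have "(\<Union>c\<in>C. {i\<in>lattice_box c (r c). \<tau> i \<omega> \<in> A}) \<subseteq> {i\<in>lattice_box (\<lambda>_. 0) (n + K). \<tau> i \<omega> \<in> A}"
    proof safe
      fix c i assume c: "c \<in> C" and i: "i \<in> lattice_box c (r c)"
      have "\<bar>i k\<bar> \<le> int (n + K)" for k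
      proof -
        have "\<bar>i k - c k\<bar> \<le> int (r c)" "\<bar>c k\<bar> \<le> int n" "r c \<le> K"
          using i c C(1) r(1) by (auto simp: lattice_box_def B_def subset_iff)
        then show ?thesis by simp
      qed
      then show "i \<in> lattice_box (\<lambda>_. 0) (n + K)" by (simp add: lattice_box_def)
    qed
    then show ?thesis unfolding visits_def by (simp add: card_mono)
  qed
  finally show ?thesis by (simp add: B_def)
qed

text \<open>The orbitwise bound \<open>maximal_count\<close> is integrated over
  \<open>\<omega>\<close>. By invariance both sides become a number of sites times a probability,
  and as \<open>n\<close> grows the ratio of the box of radius \<open>n + K\<close> to the box of
  radius \<open>n\<close> tends to 1.\<close>

lemma maximal_inequality_bounded:
  assumes [measurable]: "A \<in> sets M" and t: "0 < t"
  shows "prob {\<omega>\<in>space M. \<exists>m\<le>K. t * real ((2 * m + 1) ^ CARD('d)) < real (visits A m \<omega>)} \<le> 2 ^ CARD('d) * prob A / t"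
    (is "prob ?D \<le> _")
proof -
  have [measurable]: "?D \<in> sets M" by measurable
  have le: "t * (real ((2 * n + 1) ^ CARD('d)) * prob ?D) \<le> 2 ^ CARD('d) * (real ((2 * (n + K) + 1) ^ CARD('d)) * prob A)" for n
  proof -
    have "t * (real ((2 * n + 1) ^ CARD('d)) * prob ?D) = expectation (\<lambda>\<omega>. t * real (visits ?D n \<omega>))"
      by (simp add: expectation_visits del: of_nat_power)
    also have "\<dots> \<le> expectation (\<lambda>\<omega>. 2 ^ CARD('d) * real (visits A (n + K) \<omega>))"
    proof (rule integral_mono)
      have int: "integrable M (\<lambda>\<omega>. real (visits A' m \<omega>))" if "A' \<in> sets M" for A' m
        by (rule integrable_const_bound[of _ "real (card (lattice_box (\<lambda>_. 0 :: int) m :: ('d \<Rightarrow> int) set))"])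
           (use that in \<open>auto simp: visits_def intro!: card_mono AE_I2 measurable_visits[unfolded visits_def]\<close>)
      show "integrable M (\<lambda>\<omega>. t * real (visits ?D n \<omega>))"
        "integrable M (\<lambda>\<omega>. 2 ^ CARD('d) * real (visits A (n + K) \<omega>))" by (auto intro!: int)
      fix \<omega> assume \<omega>: "\<omega> \<in> space M"
      \<comment> \<open>Visits of the orbit to the exceptional event are exactly the sites counted
        in \<open>maximal_count\<close>.\<close>
      have "visits ?D n \<omega> = card {j\<in>lattice_box (\<lambda>_. 0) n. \<exists>m\<le>K. t * real ((2 * m + 1) ^ CARD('d)) < real (visits A m (\<tau> j \<omega>))}"
        using measurable_space[OF measurable_action \<omega>] by (simp add: visits_def)
      then show "t * real (visits ?D n \<omega>) \<le> 2 ^ CARD('d) * real (visits A (n + K) \<omega>)"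
        using maximal_count[OF \<omega> t, of n K A] by simp
    qed
    finally show ?thesis by (simp add: expectation_visits del: of_nat_power)
  qed
  have "t * prob ?D \<le> 2 ^ CARD('d) * prob A * ((2 * (real n + real K) + 1) / (2 * real n + 1)) ^ CARD('d)" for n
  proof -
    have "0 < (2 * real n + 1) ^ CARD('d)" by simp
    then show ?thesis using le[of n] unfolding power_divide
      by (simp add: field_simps)
  qed
  moreover have "(\<lambda>n. 2 ^ CARD('d) * prob A * ((2 * (real n + real K) + 1) / (2 * real n + 1)) ^ CARD('d))
      \<longlonglongrightarrow> 2 ^ CARD('d) * prob A * 1 ^ CARD('d)"
  proof (intro tendsto_intros)
    have "(\<lambda>n. (2 * (real n + real K) + 1) * (1 / (2 * real n + 1))) = (\<lambda>n. 1 + 2 * real K * (1 / (2 * real n + 1)))"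
      by (auto simp: field_simps)
    moreover have "(\<lambda>n. 1 / (2 * real n + 1)) \<longlonglongrightarrow> 0"
      by (rule tendsto_sandwich[OF _ _ tendsto_const LIMSEQ_inverse_real_of_nat])
         (auto simp: field_simps)
    ultimately have "(\<lambda>n. (2 * (real n + real K) + 1) * (1 / (2 * real n + 1))) \<longlonglongrightarrow> 1 + 2 * real K * 0"
      by (simp only:) (intro tendsto_intros)
    then show "(\<lambda>n. (2 * (real n + real K) + 1) / (2 * real n + 1)) \<longlonglongrightarrow> 1" by simp
  qed
  ultimately have "t * prob ?D \<le> 2 ^ CARD('d) * prob A * 1 ^ CARD('d)"
    by (intro LIMSEQ_le_const) auto
  then show ?thesis using t by (simp add: field_simps)
qed

text \<open>Continuity from below in the cap \<open>K\<close>, on which the bound does not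
  depend.\<close>

lemma maximal_inequality:
  assumes [measurable]: "A \<in> sets M" and t: "0 < t"
  shows "prob {\<omega>\<in>space M. \<exists>m. t * real ((2 * m + 1) ^ CARD('d)) < real (visits A m \<omega>)} \<le> 2 ^ CARD('d) * prob A / t"
proof -
  define D where "D K = {\<omega>\<in>space M. \<exists>m\<le>K. t * real ((2 * m + 1) ^ CARD('d)) < real (visits A m \<omega>)}" for K
  have "D K \<in> sets M" for K unfolding D_def by measurable
  then have "range D \<subseteq> sets M" by auto
  moreover have "incseq D" unfolding incseq_def D_def by (auto intro: order_trans)
  ultimately have "(\<lambda>K. prob (D K)) \<longlonglongrightarrow> prob (\<Union>K. D K)" by (rule finite_Lim_measure_incseq)
  moreover have "prob (D K) \<le> 2 ^ CARD('d) * prob A / t" for K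
    unfolding D_def by (rule maximal_inequality_bounded[OF assms])
  ultimately have "prob (\<Union>K. D K) \<le> 2 ^ CARD('d) * prob A / t"
    by (intro LIMSEQ_le_const2) auto
  moreover have "(\<Union>K. D K) = {\<omega>\<in>space M. \<exists>m. t * real ((2 * m + 1) ^ CARD('d)) < real (visits A m \<omega>)}"
    by (auto simp: D_def)
  ultimately show ?thesis by simp
qed

end

section \<open>Poincare inequality on convex sets\<close>

text \<open>Nonnegativity of the variance of \<open>h\<close> on the unit interval.\<close>

lemma square_integral_le:
  fixes h :: "real \<Rightarrow> real"
  assumes "continuous_on {0..1} h"
  shows "(integral {0..1} h)\<^sup>2 \<le> integral {0..1} (\<lambda>t. (h t)\<^sup>2)"
proof -
  define m where "m = integral {0..1} h"
  have int: "h integrable_on {0..1}" "(\<lambda>t. (h t)\<^sup>2) integrable_on {0..1}"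
    using assms by (auto intro!: integrable_continuous_real continuous_intros)
  have "0 \<le> integral {0..1} (\<lambda>t. (h t - m)\<^sup>2)"
    by (rule integral_nonneg) (auto intro!: integrable_continuous_real continuous_intros assms)
  also have "(\<lambda>t. (h t - m)\<^sup>2) = (\<lambda>t. (h t)\<^sup>2 - 2 * m * h t + m\<^sup>2)"
    by (auto simp: power2_eq_square algebra_simps)
  also have "integral {0..1} \<dots> = integral {0..1} (\<lambda>t. (h t)\<^sup>2) - 2 * m * m + m\<^sup>2"
  proof (rule integral_unique)
    have "((\<lambda>t. m\<^sup>2) has_integral m\<^sup>2) {0..1::real}"
      using has_integral_const_real[of "m\<^sup>2" 0 1] by simp
    then show "((\<lambda>t. (h t)\<^sup>2 - 2 * m * h t + m\<^sup>2) has_integral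
        (integral {0..1} (\<lambda>t. (h t)\<^sup>2) - 2 * m * m + m\<^sup>2)) {0..1}"
      using int by (intro has_integral_add has_integral_diff has_integral_mult_right)
        (auto simp: m_def integrable_integral)
  qed
  finally show ?thesis by (simp add: m_def power2_eq_square)
qed

definition C1 :: "(real ^ 'd::finite \<Rightarrow> complex) \<Rightarrow> bool" where
  "C1 f \<longleftrightarrow> (\<forall>x. f differentiable at x) \<and> continuous_on UNIV (grad f)"

lemma Ck_imp_C1:
  assumes "Ck (Suc 0) f"
  shows "C1 f"
proof -
  have "continuous_on UNIV (\<lambda>x. \<chi> i. grad f x $ i)"
    using assms by (intro continuous_on_vec_lambda) auto
  then show ?thesis using assms by (simp add: C1_def)
qed

lemma C1_continuous: "C1 f \<Longrightarrow> continuous_on S f"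
  by (auto simp: C1_def intro!: continuous_at_imp_continuous_on differentiable_imp_continuous_within)

lemma C1_continuous_grad: "C1 f \<Longrightarrow> continuous_on S (grad f)"
  by (auto simp: C1_def intro: continuous_on_subset)

lemma frechet_derivative_grad:
  assumes "f differentiable at z"
  shows "frechet_derivative f (at z) w = (\<Sum>i\<in>UNIV. (w $ i) *\<^sub>R (grad f z $ i))"
proof -
  have lin: "linear (frechet_derivative f (at z))"
    using assms by (simp add: linear_frechet_derivative)
  have "frechet_derivative f (at z) w = frechet_derivative f (at z) (\<Sum>i\<in>UNIV. (w $ i) *\<^sub>R axis i 1)"
    by (simp add: basis_expansion scalar_mult_eq_scaleR[symmetric])
  then show ?thesis
    by (simp add: linear_sum[OF lin] linear_cmul[OF lin] grad_def)
qed

lemma norm_frechet_derivative_le: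
  assumes "f differentiable at z"
  shows "norm (frechet_derivative f (at z) w) \<le> norm w * norm (grad f z)"
proof -
  have "norm (frechet_derivative f (at z) w) \<le> (\<Sum>i\<in>UNIV. \<bar>w $ i\<bar> * \<bar>norm (grad f z $ i)\<bar>)"
    unfolding frechet_derivative_grad[OF assms] by (rule order_trans[OF norm_sum]) simp
  also have "\<dots> \<le> L2_set (\<lambda>i. w $ i) UNIV * L2_set (\<lambda>i. norm (grad f z $ i)) UNIV"
    by (rule L2_set_mult_ineq)
  finally show ?thesis by (simp add: norm_vec_def L2_set_def)
qed

text \<open>Fundamental theorem of calculus along the segment from \<open>y\<close> to
  \<open>x\<close>, then Cauchy-Schwarz on the unit interval to bring the square inside.\<close>

lemma norm_diff_le_integral_grad:
  assumes f: "C1 f"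
  shows "(norm (f x - f y))\<^sup>2 \<le> (norm (x - y))\<^sup>2 * integral {0..1} (\<lambda>t. (norm (grad f (y + t *\<^sub>R (x - y))))\<^sup>2)"
proof -
  define p where "p t = y + t *\<^sub>R (x - y)" for t
  define F where "F t = frechet_derivative f (at (p t)) (x - y)" for t
  define h where "h t = norm (grad f (p t))" for t
  have contp: "continuous_on S p" for S unfolding p_def by (intro continuous_intros)
  have contg: "continuous_on S (\<lambda>t. grad f (p t))" for S
    by (rule continuous_on_compose2[OF C1_continuous_grad[OF f, of UNIV] contp]) auto
  have conth: "continuous_on {0..1} h" unfolding h_def by (intro continuous_intros contg)
  have diff: "f differentiable at z" for z using f by (simp add: C1_def)
  have "F = (\<lambda>t. \<Sum>i\<in>UNIV. ((x - y) $ i) *\<^sub>R (grad f (p t) $ i))"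
    unfolding F_def using frechet_derivative_grad[OF diff] by auto
  then have contF: "continuous_on {0..1} F" by (auto intro!: continuous_intros contg)
  have "((\<lambda>t. f (p t)) has_vector_derivative F t) (at t within {0..1})" for t
  proof -
    have "(f has_derivative frechet_derivative f (at (p t))) (at (p t))"
      using diff by (simp add: frechet_derivative_works)
    moreover have "(p has_derivative (\<lambda>s. s *\<^sub>R (x - y))) (at t within {0..1})"
      unfolding p_def by (auto intro!: derivative_eq_intros)
    ultimately have "((\<lambda>t. f (p t)) has_derivative (\<lambda>s. frechet_derivative f (at (p t)) (s *\<^sub>R (x - y)))) (at t within {0..1})"
      by (rule has_derivative_compose[rotated])
    then show ?thesis
      by (simp add: has_vector_derivative_def F_def linear_cmul[OF linear_frechet_derivative[OF diff]])
  qed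
  then have "(F has_integral f (p 1) - f (p 0)) {0..1}"
    by (intro fundamental_theorem_of_calculus) auto
  then have "f x - f y = integral {0..1} F"
    by (simp add: p_def integral_unique)
  also have "norm \<dots> \<le> integral {0..1} (\<lambda>t. norm (x - y) * h t)"
    using norm_frechet_derivative_le[OF diff]
    by (intro integral_norm_bound_integral)
       (auto simp: F_def[symmetric] h_def intro!: integrable_continuous_real contF continuous_intros contg, auto simp: F_def)
  also have "\<dots> = norm (x - y) * integral {0..1} h" by simp
  finally have "(norm (f x - f y))\<^sup>2 \<le> (norm (x - y) * integral {0..1} h)\<^sup>2"
    by (intro power_mono) auto
  also have "\<dots> \<le> (norm (x - y))\<^sup>2 * integral {0..1} (\<lambda>t. (h t)\<^sup>2)"
    unfolding power_mult_distrib by (intro mult_left_mono square_integral_le conth) auto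
  finally show ?thesis by (simp add: h_def p_def)
qed

text \<open>The substitution by (1 - s) y + s x maps the convex set into itself and has Jacobian
  s^d; dividing by it costs at most 2^d because s is at least 1/2.\<close>

lemma nn_integral_affine_convex_le:
  fixes h :: "'a::euclidean_space \<Rightarrow> ennreal"
  assumes B: "convex B" "B \<in> sets borel" and y: "y \<in> B" and s: "1 / 2 \<le> s" "s \<le> 1"
    and h [measurable]: "h \<in> borel_measurable borel"
  shows "(\<integral>\<^sup>+x\<in>B. h ((1 - s) *\<^sub>R y + s *\<^sub>R x) \<partial>lborel) \<le> 2 ^ DIM('a) * (\<integral>\<^sup>+x\<in>B. h x \<partial>lborel)"
proof -
  note [measurable] = B(2)
  define c where "c = (1 - s) *\<^sub>R y"
  define X where "X = (\<integral>\<^sup>+x. h (c + s *\<^sub>R x) * indicator B (c + s *\<^sub>R x) \<partial>lborel)"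
  have "(\<integral>\<^sup>+x\<in>B. h (c + s *\<^sub>R x) \<partial>lborel) \<le> X"
    unfolding X_def
  proof (intro nn_integral_mono)
    fix x
    have "c + s *\<^sub>R x \<in> B" if "x \<in> B"
      unfolding c_def using that B y s by (intro convexD) auto
    then show "h (c + s *\<^sub>R x) * indicator B x \<le> h (c + s *\<^sub>R x) * indicator B (c + s *\<^sub>R x)"
      by (auto simp: indicator_def)
  qed
  also have "X = 1 * X" by simp
  also have "\<dots> \<le> ennreal ((2 * s) ^ DIM('a)) * X"
    using s one_le_power[of "2 * s" "DIM('a)"] by (intro mult_right_mono) simp_all
  also have "\<dots> = 2 ^ DIM('a) * (ennreal (\<bar>s\<bar> ^ DIM('a)) * X)"
    using s by (simp add: power_mult_distrib ennreal_mult mult.assoc ennreal_power[symmetric])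
  also have "ennreal (\<bar>s\<bar> ^ DIM('a)) * X = (\<integral>\<^sup>+x\<in>B. h x \<partial>lborel)"
  proof -
    have "(\<integral>\<^sup>+x\<in>B. h x \<partial>lborel) = (\<integral>\<^sup>+x\<in>B. h x \<partial>(density (distr lborel borel (\<lambda>x. c + s *\<^sub>R x)) (\<lambda>_. \<bar>s\<bar> ^ DIM('a))))"
      using s by (subst lborel_affine[of s c]) auto
    also have "\<dots> = ennreal (\<bar>s\<bar> ^ DIM('a)) * X"
      by (simp add: nn_integral_density nn_integral_distr nn_integral_cmult X_def)
    finally show ?thesis by simp
  qed
  finally show ?thesis by (simp add: c_def)
qed

text \<open>The segment bound is averaged over all pairs of points. The point at parameter t has
  weight t on x and 1 - t on y; integrating first over the variable with the larger weight keeps the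
  Jacobian of the substitution at least 2^(-d), uniformly in t. With nonnegative integrals every
  exchange of order is free.\<close>

lemma Poincare_double_integral:
  fixes f :: "real ^ 'd::finite \<Rightarrow> complex"
  assumes f: "C1 f" and B: "convex B" "B \<in> sets borel" "emeasure lborel B < \<infinity>"
    and D: "\<And>x y. x \<in> B \<Longrightarrow> y \<in> B \<Longrightarrow> norm (x - y) \<le> D"
  defines "N \<equiv> restrict_space lborel B"
  shows "(\<integral>\<^sup>+x. \<integral>\<^sup>+y. ennreal ((norm (f x - f y))\<^sup>2) \<partial>N \<partial>N)
    \<le> ennreal (D\<^sup>2 * 2 ^ CARD('d)) * emeasure lborel B * (\<integral>\<^sup>+x. ennreal ((norm (grad f x))\<^sup>2) \<partial>N)"
proof -
  define h where "h x = ennreal ((norm (grad f x))\<^sup>2)" for x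
  have [measurable]: "grad f \<in> borel_measurable borel" "f \<in> borel_measurable borel"
    using C1_continuous_grad[OF f] C1_continuous[OF f] by (auto intro: borel_measurable_continuous_onI)
  have h [measurable]: "h \<in> borel_measurable borel" unfolding h_def by measurable
  have spN: "space N = B" by (simp add: N_def space_restrict_space)
  have N: "finite_measure N" 
    unfolding N_def using B by (intro finite_measureI) (simp add: emeasure_restrict_space space_restrict_space)
  then interpret N: finite_measure N .
  define U where "U = restrict_space lborel {0..1::real}"
  have spU: "space U = {0..1}" by (simp add: U_def space_restrict_space)
  have "emeasure lborel {0..1::real} \<noteq> \<infinity>" by simp
  then have U: "finite_measure U" 
    unfolding U_def by (intro finite_measureI) (simp add: emeasure_restrict_space space_restrict_space)
  then interpret U: finite_measure U .
  interpret NN: pair_sigma_finite N N by unfold_locales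
  interpret UN: pair_sigma_finite U N by unfold_locales
  have [measurable]: "(\<lambda>x. x) \<in> measurable N borel" "(\<lambda>x. x) \<in> measurable U borel"
    by (auto simp: N_def U_def intro!: measurable_restrict_space1)
  have nnN: "(\<integral>\<^sup>+x. g x \<partial>N) = (\<integral>\<^sup>+x\<in>B. g x \<partial>lborel)" for g
    unfolding N_def using B(2) by (simp add: nn_integral_restrict_space)
  define H where "H = (\<integral>\<^sup>+x. h x \<partial>N)"
  have emN: "emeasure N (space N) = emeasure lborel B"
    unfolding N_def using B(2) by (simp add: emeasure_restrict_space)
  have D0: "0 \<le> D" if "x \<in> B" for x using D[OF that that] by simp
  have 1: "(\<integral>\<^sup>+x. h ((1 - s) *\<^sub>R y + s *\<^sub>R x) \<partial>N) \<le> 2 ^ CARD('d) * H"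
    if "y \<in> B" "1 / 2 \<le> s" "s \<le> 1" for s y
    using nn_integral_affine_convex_le[OF B(1,2) that h] by (simp add: nnN H_def)
  have 2: "(\<integral>\<^sup>+x. \<integral>\<^sup>+y. h (y + t *\<^sub>R (x - y)) \<partial>N \<partial>N) \<le> 2 ^ CARD('d) * H * emeasure lborel B" if t: "t \<in> {0..1}" for t
  proof (cases "t \<ge> 1/2")
    case True
    have "(\<integral>\<^sup>+x. \<integral>\<^sup>+y. h (y + t *\<^sub>R (x - y)) \<partial>N \<partial>N) = (\<integral>\<^sup>+y. \<integral>\<^sup>+x. h (y + t *\<^sub>R (x - y)) \<partial>N \<partial>N)"
      by (rule NN.Fubini') measurable
    also have "\<dots> = (\<integral>\<^sup>+y. \<integral>\<^sup>+x. h ((1 - t) *\<^sub>R y + t *\<^sub>R x) \<partial>N \<partial>N)"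
      by (simp add: algebra_simps)
    also have "\<dots> \<le> (\<integral>\<^sup>+y. 2 ^ CARD('d) * H \<partial>N)"
      using 1 t True by (intro nn_integral_mono) (auto simp: spN)
    finally show ?thesis by (simp add: emN)
  next
    case False
    have "(\<integral>\<^sup>+x. \<integral>\<^sup>+y. h (y + t *\<^sub>R (x - y)) \<partial>N \<partial>N) = (\<integral>\<^sup>+x. \<integral>\<^sup>+y. h ((1 - (1 - t)) *\<^sub>R x + (1 - t) *\<^sub>R y) \<partial>N \<partial>N)"
      by (simp add: algebra_simps)
    also have "\<dots> \<le> (\<integral>\<^sup>+y. 2 ^ CARD('d) * H \<partial>N)"
      using 1[of _ "1 - t"] t False by (intro nn_integral_mono) (auto simp: spN)
    finally show ?thesis by (simp add: emN)
  qed
  have seg: "ennreal ((norm (f x - f y))\<^sup>2) \<le> ennreal (D\<^sup>2) * (\<integral>\<^sup>+t. h (y + t *\<^sub>R (x - y)) \<partial>U)"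
    if "x \<in> B" "y \<in> B" for x y
  proof -
    define k where "k t = (norm (grad f (y + t *\<^sub>R (x - y))))\<^sup>2" for t
    have cont: "continuous_on {0..1} k"
      unfolding k_def
      by (intro continuous_intros continuous_on_compose2[OF C1_continuous_grad[OF f, of UNIV]]) auto
    have int: "integrable lborel (\<lambda>t. indicator {0..1} t *\<^sub>R k t)"
      by (rule borel_integrable_compact) (auto intro: cont)
    have "(\<integral>\<^sup>+t. h (y + t *\<^sub>R (x - y)) \<partial>U) = (\<integral>\<^sup>+t\<in>{0..1}. ennreal (k t) \<partial>lborel)"
      unfolding U_def by (simp add: nn_integral_restrict_space h_def k_def)
    also have "\<dots> = (\<integral>\<^sup>+t. ennreal (indicator {0..1} t *\<^sub>R k t) \<partial>lborel)"
      by (intro nn_integral_cong) (auto simp: indicator_def)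
    also have "\<dots> = ennreal (\<integral>t. indicator {0..1} t *\<^sub>R k t \<partial>lborel)"
      by (rule nn_integral_eq_integral[OF int]) (auto simp: k_def indicator_def)
    also have "(\<integral>t. indicator {0..1} t *\<^sub>R k t \<partial>lborel) = integral {0..1} k"
      using set_borel_integral_eq_integral(2)[of "{0..1}" k] int
      by (simp add: set_integrable_def set_lebesgue_integral_def)
    finally have eq: "(\<integral>\<^sup>+t. h (y + t *\<^sub>R (x - y)) \<partial>U) = ennreal (integral {0..1} k)" .
    have "0 \<le> integral {0..1} k"
      by (rule integral_nonneg) (auto simp: k_def intro!: integrable_continuous_real cont[unfolded k_def])
    moreover have "(norm (x - y))\<^sup>2 \<le> D\<^sup>2" using D[OF that] by (intro power_mono) auto
    ultimately have "(norm (f x - f y))\<^sup>2 \<le> D\<^sup>2 * integral {0..1} k"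
      using norm_diff_le_integral_grad[OF f, of x y] unfolding k_def
      by (meson mult_right_mono order_trans)
    then show ?thesis unfolding eq using \<open>0 \<le> integral {0..1} k\<close>
      by (simp add: ennreal_mult[symmetric])
  qed
  have "(\<integral>\<^sup>+x. \<integral>\<^sup>+y. ennreal ((norm (f x - f y))\<^sup>2) \<partial>N \<partial>N)
      \<le> (\<integral>\<^sup>+x. \<integral>\<^sup>+y. ennreal (D\<^sup>2) * (\<integral>\<^sup>+t. h (y + t *\<^sub>R (x - y)) \<partial>U) \<partial>N \<partial>N)"
    by (intro nn_integral_mono seg) (auto simp: spN)
  also have "\<dots> = ennreal (D\<^sup>2) * (\<integral>\<^sup>+x. \<integral>\<^sup>+y. \<integral>\<^sup>+t. h (y + t *\<^sub>R (x - y)) \<partial>U \<partial>N \<partial>N)"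
    by (simp add: nn_integral_cmult)
  also have "(\<integral>\<^sup>+x. \<integral>\<^sup>+y. \<integral>\<^sup>+t. h (y + t *\<^sub>R (x - y)) \<partial>U \<partial>N \<partial>N)
      = (\<integral>\<^sup>+x. \<integral>\<^sup>+t. \<integral>\<^sup>+y. h (y + t *\<^sub>R (x - y)) \<partial>N \<partial>U \<partial>N)"
    by (intro nn_integral_cong UN.Fubini') measurable
  also have "\<dots> = (\<integral>\<^sup>+t. \<integral>\<^sup>+x. \<integral>\<^sup>+y. h (y + t *\<^sub>R (x - y)) \<partial>N \<partial>N \<partial>U)"
    by (rule UN.Fubini') measurable
  also have "\<dots> \<le> (\<integral>\<^sup>+t. 2 ^ CARD('d) * H * emeasure lborel B \<partial>U)"
    by (intro nn_integral_mono 2) (auto simp: spU)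
  also have "\<dots> = 2 ^ CARD('d) * H * emeasure lborel B"
    by (simp add: U_def emeasure_restrict_space)
  finally have "(\<integral>\<^sup>+x. \<integral>\<^sup>+y. ennreal ((norm (f x - f y))\<^sup>2) \<partial>N \<partial>N)
      \<le> ennreal (D\<^sup>2) * (2 ^ CARD('d) * H * emeasure lborel B)"
    by (simp add: mult_left_mono)
  also have "\<dots> = ennreal (D\<^sup>2 * 2 ^ CARD('d)) * emeasure lborel B * H"
    by (simp add: ennreal_mult ennreal_power[symmetric] ac_simps)
  finally show ?thesis by (simp add: H_def h_def)
qed

section \<open>Cubic cells\<close>

lemma norm_add_square_le: "(norm (a + b :: 'a::real_normed_vector))\<^sup>2 \<le> 2 * (norm a)\<^sup>2 + 2 * (norm b)\<^sup>2"
proof -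
  have "(norm (a + b))\<^sup>2 \<le> (norm a + norm b)\<^sup>2" by (intro power_mono norm_triangle_ineq) auto
  also have "\<dots> \<le> 2 * (norm a)\<^sup>2 + 2 * (norm b)\<^sup>2"
    using zero_le_power2[of "norm a - norm b"] by (simp add: power2_eq_square algebra_simps)
  finally show ?thesis .
qed

text \<open>Half-open, so that for positive \<open>R\<close> every point lies in exactly one cell,
  whose index is the coordinatewise floor of the point divided by \<open>R\<close>.\<close>

definition cell :: "real \<Rightarrow> ('d::finite \<Rightarrow> int) \<Rightarrow> (real ^ 'd) set" where
  "cell R j = {x. \<forall>k. R * of_int (j k) \<le> x $ k \<and> x $ k < R * (of_int (j k) + 1)}"

lemma convex_cell: "convex (cell R j)"
proof -
  have "cell R j = (\<Inter>k. {x. R * of_int (j k) \<le> x $ k} \<inter> {x. x $ k < R * (of_int (j k) + 1)})"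
    by (auto simp: cell_def)
  moreover have "convex {x::real^'d. a \<le> x $ k}" "convex {x::real^'d. x $ k < a}" for a k
    using convex_halfspace_ge[of a "axis k (1::real) :: real ^ 'd"] convex_halfspace_lt[of "axis k (1::real) :: real ^ 'd" a]
    by (auto simp: inner_axis inner_commute)
  ultimately show ?thesis by (auto intro!: convex_INT convex_Int)
qed

lemma borel_cell [measurable]: "cell R j \<in> sets borel"
  unfolding cell_def by measurable

lemma cell_between:
  "box (\<chi> k. R * of_int (j k)) (\<chi> k. R * (of_int (j k) + 1)) \<subseteq> cell R j"
  "cell R j \<subseteq> cbox (\<chi> k. R * of_int (j k)) (\<chi> k. R * (of_int (j k) + 1))"
  by (auto simp: cell_def mem_box_cart less_imp_le)

lemma emeasure_cell:
  fixes j :: "'d::finite \<Rightarrow> int"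
  assumes "0 \<le> R"
  shows "emeasure lborel (cell R j) = ennreal (R ^ CARD('d))"
proof -
  define a b :: "real ^ 'd" where "a = (\<chi> k. R * of_int (j k))" and "b = (\<chi> k. R * (of_int (j k) + 1))"
  have ab: "(b - a) \<bullet> i = R" "a \<bullet> i \<le> b \<bullet> i" if "i \<in> Basis" for i
    using that assms by (auto simp: a_def b_def Basis_vec_def inner_axis algebra_simps)
  have box: "emeasure lborel (box a b) = ennreal (R ^ CARD('d))"
    and cbox: "emeasure lborel (cbox a b) = ennreal (R ^ CARD('d))"
    using ab by (auto simp: emeasure_lborel_box_eq emeasure_lborel_cbox_eq)
  show ?thesis
  proof (rule antisym)
    show "emeasure lborel (cell R j) \<le> ennreal (R ^ CARD('d))"
      unfolding cbox[symmetric] using cell_between(2)[of R j] by (intro emeasure_mono) (auto simp: a_def b_def)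
    show "ennreal (R ^ CARD('d)) \<le> emeasure lborel (cell R j)"
      unfolding box[symmetric] using cell_between(1)[of R j] by (intro emeasure_mono) (auto simp: a_def b_def)
  qed
qed

lemma mem_cell_iff:
  assumes "0 < R"
  shows "x \<in> cell R j \<longleftrightarrow> j = (\<lambda>k. \<lfloor>x $ k / R\<rfloor>)"
proof -
  have "R * of_int m \<le> y \<and> y < R * (of_int m + 1) \<longleftrightarrow> m = \<lfloor>y / R\<rfloor>" for m y
    using assms floor_eq_iff[of "y / R" m] by (auto simp: field_simps)
  then show ?thesis by (auto simp: cell_def fun_eq_iff)
qed

lemma disjoint_cells: "0 < R \<Longrightarrow> disjoint_family_on (cell R) J"
  by (auto simp: disjoint_family_on_def mem_cell_iff)

lemma norm_diff_cell:
  fixes x y :: "real ^ 'd::finite"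
  assumes "x \<in> cell R j" "y \<in> cell R j"
  shows "norm (x - y) \<le> sqrt (CARD('d)) * R"
proof -
  have le: "\<bar>x $ k - y $ k\<bar> \<le> R" for k
    using assms by (auto simp: cell_def abs_le_iff algebra_simps) (smt (verit))+
  then have R: "0 \<le> R" using abs_ge_zero order_trans by blast
  have "norm (x - y) \<le> L2_set (\<lambda>_::'d. R) UNIV"
    unfolding norm_vec_def using le by (intro L2_set_mono) auto
  also have "\<dots> = sqrt (CARD('d)) * R"
    using R by (simp add: L2_set_def real_sqrt_mult)
  finally show ?thesis .
qed

section \<open>Poincare estimates on a single cell\<close>

context
  fixes f :: "real ^ 'd::finite \<Rightarrow> complex" and R :: real and j :: "'d \<Rightarrow> int"
  assumes f: "C1 f" and R: "0 < R"
begin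

abbreviation (input) cell_measure where
  "cell_measure \<equiv> restrict_space lborel (cell R j)"

lemma finite_cell_measure: "finite_measure cell_measure"
  using R by (intro finite_measureI) (simp add: emeasure_restrict_space space_restrict_space emeasure_cell)

lemma measure_cell_measure: "measure cell_measure (cell R j) = R ^ CARD('d)"
  using R by (simp add: measure_def emeasure_restrict_space space_restrict_space emeasure_cell)

lemma integrable_cell:
  fixes g :: "real ^ 'd \<Rightarrow> 'b::{banach, second_countable_topology}"
  assumes "continuous_on UNIV g"
  shows "integrable cell_measure g"
proof -
  interpret finite_measure cell_measure by (rule finite_cell_measure)
  define K where "K = cbox (\<chi> k. R * of_int (j k)) (\<chi> k. R * (of_int (j k) + 1))"
  have "compact (g ` K)"
    using assms by (intro compact_continuous_image) (auto simp: K_def intro: continuous_on_subset)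
  then obtain b where b: "\<And>x. x \<in> K \<Longrightarrow> norm (g x) \<le> b"
    using compact_imp_bounded by (force simp: bounded_iff)
  have "g \<in> borel_measurable cell_measure"
    using assms by (intro measurable_restrict_space1) (auto intro: borel_measurable_continuous_onI)
  then show ?thesis
    using cell_between(2)[of R j] b
    by (intro integrable_const_bound[of _ b]) (auto simp: space_restrict_space K_def intro!: AE_I2)
qed

text \<open>Variance identity: the squared difference is expanded, and each free variable
  contributes the volume \<open>R ^ CARD('d)\<close>.\<close>

lemma double_integral_cell:
  "(\<integral>x. \<integral>y. (norm (f x - f y))\<^sup>2 \<partial>cell_measure \<partial>cell_measure)
    = 2 * R ^ CARD('d) * (\<integral>x. (norm (f x))\<^sup>2 \<partial>cell_measure) - 2 * (norm (\<integral>x. f x \<partial>cell_measure))\<^sup>2"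
proof -
  interpret finite_measure cell_measure by (rule finite_cell_measure)
  note cont = C1_continuous[OF f, of UNIV]
  have [simp]: "integrable cell_measure f" "integrable cell_measure (\<lambda>x. (norm (f x))\<^sup>2)"
    by (auto intro!: integrable_cell continuous_intros cont)
  define m where "m = (\<integral>x. f x \<partial>cell_measure)"
  define q where "q = (\<integral>x. (norm (f x))\<^sup>2 \<partial>cell_measure)"
  have ex: "(norm (a - b))\<^sup>2 = (norm a)\<^sup>2 + (norm b)\<^sup>2 - 2 * (a \<bullet> b)" for a b :: complex
    by (simp add: power2_norm_eq_inner inner_diff_left inner_diff_right inner_commute)
  have [simp]: "integrable cell_measure (\<lambda>x. a \<bullet> f x)" for a
    by (auto intro!: integrable_cell continuous_intros cont)
  have "(\<integral>y. (norm (f x - f y))\<^sup>2 \<partial>cell_measure) = R ^ CARD('d) * (norm (f x))\<^sup>2 + q - 2 * (f x \<bullet> m)" for x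
    unfolding ex by (simp add: q_def m_def measure_cell_measure space_restrict_space)
  then have "(\<integral>x. \<integral>y. (norm (f x - f y))\<^sup>2 \<partial>cell_measure \<partial>cell_measure)
      = (\<integral>x. R ^ CARD('d) * (norm (f x))\<^sup>2 + q - 2 * (f x \<bullet> m) \<partial>cell_measure)" by simp
  also have "\<dots> = R ^ CARD('d) * q + R ^ CARD('d) * q - 2 * (m \<bullet> m)"
    by (simp add: q_def[symmetric] m_def[symmetric] measure_cell_measure space_restrict_space)
  finally show ?thesis by (simp add: q_def[symmetric] m_def[symmetric] power2_norm_eq_inner[of m])
qed

text \<open>\<open>Poincare_double_integral\<close> with diameter
  \<open>sqrt (CARD('d)) * R\<close>, moved from nonnegative to Bochner integrals.\<close>

lemma Poincare_cell:
  "(\<integral>x. \<integral>y. (norm (f x - f y))\<^sup>2 \<partial>cell_measure \<partial>cell_measure)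
    \<le> CARD('d) * 2 ^ CARD('d) * R\<^sup>2 * R ^ CARD('d) * (\<integral>x. (norm (grad f x))\<^sup>2 \<partial>cell_measure)"
    (is "_ \<le> ?C * _")
proof -
  interpret finite_measure cell_measure by (rule finite_cell_measure)
  note cont = C1_continuous[OF f, of UNIV] C1_continuous_grad[OF f, of UNIV]
  have int: "integrable cell_measure (\<lambda>y. (norm (f x - f y))\<^sup>2)" for x
    by (auto intro!: integrable_cell continuous_intros cont)
  define q where "q = (\<integral>x. (norm (grad f x))\<^sup>2 \<partial>cell_measure)"
  have "0 \<le> q" by (simp add: q_def)
  have meas: "f \<in> borel_measurable cell_measure"
    using cont(1) by (intro measurable_restrict_space1) (auto intro: borel_measurable_continuous_onI)
  have "(\<integral>\<^sup>+x. \<integral>\<^sup>+y. ennreal ((norm (f x - f y))\<^sup>2) \<partial>cell_measure \<partial>cell_measure)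
      \<le> ennreal ((sqrt (CARD('d)) * R)\<^sup>2 * 2 ^ CARD('d)) * emeasure lborel (cell R j) *
        (\<integral>\<^sup>+x. ennreal ((norm (grad f x))\<^sup>2) \<partial>cell_measure)"
    using R norm_diff_cell by (intro Poincare_double_integral[OF f convex_cell borel_cell]) (auto simp: emeasure_cell)
  also have "(\<integral>\<^sup>+x. ennreal ((norm (grad f x))\<^sup>2) \<partial>cell_measure) = ennreal q"
    unfolding q_def by (intro nn_integral_eq_integral) (auto intro!: integrable_cell continuous_intros cont)
  also have "(\<integral>\<^sup>+x. \<integral>\<^sup>+y. ennreal ((norm (f x - f y))\<^sup>2) \<partial>cell_measure \<partial>cell_measure)
      = (\<integral>\<^sup>+x. ennreal (\<integral>y. (norm (f x - f y))\<^sup>2 \<partial>cell_measure) \<partial>cell_measure)"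
    by (intro nn_integral_cong nn_integral_eq_integral int) auto
  finally have *: "(\<integral>\<^sup>+x. ennreal (\<integral>y. (norm (f x - f y))\<^sup>2 \<partial>cell_measure) \<partial>cell_measure) \<le> ennreal (?C * q)"
    using R \<open>0 \<le> q\<close> by (simp add: emeasure_cell ennreal_mult'[symmetric] power_mult_distrib ac_simps)
  have "(\<integral>x. \<integral>y. (norm (f x - f y))\<^sup>2 \<partial>cell_measure \<partial>cell_measure)
      = enn2real (\<integral>\<^sup>+x. ennreal (\<integral>y. (norm (f x - f y))\<^sup>2 \<partial>cell_measure) \<partial>cell_measure)"
    using meas by (intro integral_eq_nn_integral) (auto intro!: borel_measurable_lebesgue_integral)
  also have "\<dots> \<le> ?C * q"
    using enn2real_mono[OF *] R \<open>0 \<le> q\<close> by (simp add: enn2real_ennreal)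
  finally show ?thesis by (simp add: q_def)
qed

text \<open>Meant for bad cells, where the potential gives no control: for the functions tested
  later the mean term disappears in the limit. The factor 1/2 that the variance identity would offer
  on the gradient term is given away.\<close>

lemma cell_mean_inequality:
  "(\<integral>x. (norm (f x))\<^sup>2 \<partial>cell_measure)
    \<le> CARD('d) * 2 ^ CARD('d) * R\<^sup>2 * (\<integral>x. (norm (grad f x))\<^sup>2 \<partial>cell_measure)
      + (norm (\<integral>x. f x \<partial>cell_measure))\<^sup>2 / R ^ CARD('d)"
proof -
  define q where "q = (\<integral>x. (norm (f x))\<^sup>2 \<partial>cell_measure)"
  define r where "r = (\<integral>x. (norm (grad f x))\<^sup>2 \<partial>cell_measure)"
  define C where "C = CARD('d) * 2 ^ CARD('d) * R\<^sup>2"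
  have rd: "0 < R ^ CARD('d)" using R by simp
  have "0 \<le> C * r * R ^ CARD('d)" using R by (simp add: C_def r_def)
  moreover have "2 * R ^ CARD('d) * q - 2 * (norm (\<integral>x. f x \<partial>cell_measure))\<^sup>2 \<le> C * r * R ^ CARD('d)"
    using Poincare_cell unfolding double_integral_cell q_def r_def C_def by (simp add: ac_simps)
  ultimately have "q * R ^ CARD('d) \<le> C * r * R ^ CARD('d) + (norm (\<integral>x. f x \<partial>cell_measure))\<^sup>2"
    by (simp add: algebra_simps)
  then have "q \<le> (C * r * R ^ CARD('d) + (norm (\<integral>x. f x \<partial>cell_measure))\<^sup>2) / R ^ CARD('d)"
    using rd by (simp add: pos_le_divide_eq)
  also have "\<dots> = C * r + (norm (\<integral>x. f x \<partial>cell_measure))\<^sup>2 / R ^ CARD('d)"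
    using R by (simp add: add_divide_distrib)
  finally show ?thesis unfolding q_def r_def C_def .
qed

text \<open>Meant for good cells: the square of |f x| is at most twice that of |f y| plus twice that
  of |f x - f y|; this is weighted by W y and integrated over both points. A lower bound on the
  integral of \<open>W\<close> then controls the norm by potential and kinetic energy.\<close>

lemma cell_weighted_inequality:
  assumes W [measurable]: "W \<in> borel_measurable borel" and W01: "\<And>x. 0 \<le> W x" "\<And>x. W x \<le> 1"
  shows "(\<integral>x. W x \<partial>cell_measure) * (\<integral>x. (norm (f x))\<^sup>2 \<partial>cell_measure)
    \<le> R ^ CARD('d) * (2 * (\<integral>x. W x * (norm (f x))\<^sup>2 \<partial>cell_measure)
      + 2 * (CARD('d) * 2 ^ CARD('d) * R\<^sup>2) * (\<integral>x. (norm (grad f x))\<^sup>2 \<partial>cell_measure))"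
proof -
  interpret finite_measure cell_measure by (rule finite_cell_measure)
  note cont = C1_continuous[OF f, of UNIV]
  have [measurable]: "W \<in> borel_measurable cell_measure" by (intro measurable_restrict_space1) auto
  have [measurable]: "f \<in> borel_measurable cell_measure"
    using cont by (intro measurable_restrict_space1) (auto intro: borel_measurable_continuous_onI)
  have intf: "integrable cell_measure (\<lambda>x. (norm (f x))\<^sup>2)" "integrable cell_measure f"
    "\<And>x. integrable cell_measure (\<lambda>y. (norm (f x - f y))\<^sup>2)"
    by (auto intro!: integrable_cell continuous_intros cont)
  have intW: "integrable cell_measure W"
    using W01 by (intro integrable_const_bound[of _ 1]) auto
  have intWf: "integrable cell_measure (\<lambda>x. W x * (norm (f x))\<^sup>2)"
    using W01 by (intro Bochner_Integration.integrable_bound[OF intf(1)]) (auto intro!: mult_left_le_one_le)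
  define q where "q = (\<integral>x. (norm (f x))\<^sup>2 \<partial>cell_measure)"
  define w where "w = (\<integral>x. W x \<partial>cell_measure)"
  define p where "p = (\<integral>x. W x * (norm (f x))\<^sup>2 \<partial>cell_measure)"
  define dd where "dd x = (\<integral>y. (norm (f x - f y))\<^sup>2 \<partial>cell_measure)" for x
  have ptw: "w * (norm (f x))\<^sup>2 \<le> 2 * p + 2 * dd x" for x
  proof -
    have "w * (norm (f x))\<^sup>2 = (\<integral>y. W y * (norm (f x))\<^sup>2 \<partial>cell_measure)"
      using intW by (simp add: w_def)
    also have "\<dots> \<le> (\<integral>y. 2 * (W y * (norm (f y))\<^sup>2) + 2 * (norm (f x - f y))\<^sup>2 \<partial>cell_measure)"
    proof (rule integral_mono)
      fix y
      have "(norm (f x))\<^sup>2 \<le> 2 * (norm (f y))\<^sup>2 + 2 * (norm (f x - f y))\<^sup>2"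
        using norm_add_square_le[of "f y" "f x - f y"] by simp
      then have "W y * (norm (f x))\<^sup>2 \<le> W y * (2 * (norm (f y))\<^sup>2) + W y * (2 * (norm (f x - f y))\<^sup>2)"
        using mult_left_mono[OF _ W01(1)[of y]] by (metis distrib_left)
      also have "W y * (2 * (norm (f x - f y))\<^sup>2) \<le> 2 * (norm (f x - f y))\<^sup>2"
        using W01 by (intro mult_left_le_one_le) auto
      finally show "W y * (norm (f x))\<^sup>2 \<le> 2 * (W y * (norm (f y))\<^sup>2) + 2 * (norm (f x - f y))\<^sup>2" by simp
    qed (use intW intWf intf in auto)
    also have "\<dots> = 2 * p + 2 * dd x" using intWf intf by (simp add: p_def dd_def)
    finally show ?thesis .
  qed
  have ddI: "integrable cell_measure dd"
  proof -
    have "dd x = R ^ CARD('d) * (norm (f x))\<^sup>2 + q - 2 * (\<integral>y. f x \<bullet> f y \<partial>cell_measure)" for x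
    proof -
      have ex: "(norm (a - b))\<^sup>2 = (norm a)\<^sup>2 + (norm b)\<^sup>2 - 2 * (a \<bullet> b)" for a b :: complex
        by (simp add: power2_norm_eq_inner inner_diff_left inner_diff_right inner_commute)
      have "integrable cell_measure (\<lambda>y. f x \<bullet> f y)"
        by (auto intro!: integrable_cell continuous_intros cont)
      then show ?thesis using intf unfolding dd_def ex q_def by (simp add: measure_cell_measure space_restrict_space)
    qed
    moreover have "(\<integral>y. f x \<bullet> f y \<partial>cell_measure) = f x \<bullet> (\<integral>y. f y \<partial>cell_measure)" for x
      using intf(2) by simp
    ultimately have "dd = (\<lambda>x. R ^ CARD('d) * (norm (f x))\<^sup>2 + q - 2 * (f x \<bullet> (\<integral>y. f y \<partial>cell_measure)))"
      by auto
    then show ?thesis using intf by simp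
  qed
  have "w * q = (\<integral>x. w * (norm (f x))\<^sup>2 \<partial>cell_measure)" by (simp add: q_def)
  also have "\<dots> \<le> (\<integral>x. 2 * p + 2 * dd x \<partial>cell_measure)"
    using ptw ddI intf by (intro integral_mono) auto
  also have "\<dots> = 2 * p * R ^ CARD('d) + 2 * (\<integral>x. dd x \<partial>cell_measure)"
    using ddI by (simp add: measure_cell_measure space_restrict_space)
  also have "(\<integral>x. dd x \<partial>cell_measure) \<le> CARD('d) * 2 ^ CARD('d) * R\<^sup>2 * R ^ CARD('d) * (\<integral>x. (norm (grad f x))\<^sup>2 \<partial>cell_measure)"
    unfolding dd_def by (rule Poincare_cell)
  finally show ?thesis unfolding w_def q_def p_def by (simp add: algebra_simps)
qed

end

lemma grad_eq_0_outside:
  assumes "closed K" "\<And>x. x \<notin> K \<Longrightarrow> f x = 0" "x \<notin> K"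
  shows "grad f x = 0"
proof -
  have "(f has_derivative (\<lambda>_. 0)) (at x)"
    using assms by (intro has_derivative_transform_within_open[of "\<lambda>_. 0" "\<lambda>_. 0" x UNIV "- K" f]) auto
  then have "frechet_derivative f (at x) = (\<lambda>_. 0)" by (metis frechet_derivative_at)
  then show ?thesis by (simp add: grad_def vec_eq_iff)
qed

lemma integrable_compact_support:
  fixes g :: "'a::euclidean_space \<Rightarrow> 'b::{banach, second_countable_topology}"
  assumes "compact K" "continuous_on UNIV g" "\<And>x. x \<notin> K \<Longrightarrow> g x = 0"
  shows "integrable lborel g"
proof -
  have "integrable lborel (\<lambda>x. indicator K x *\<^sub>R g x)"
    using assms by (intro borel_integrable_compact) (auto intro: continuous_on_subset)
  moreover have "(\<lambda>x. indicator K x *\<^sub>R g x) = g" using assms(3) by (auto simp: indicator_def)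
  ultimately show ?thesis by simp
qed

text \<open>Good cells contribute through the weight and bad cells through the mean. The sums
  recombine to integrals over the whole space because the cells are disjoint and cover the support
  of \<open>f\<close>.\<close>

theorem cells_inequality:
  fixes f :: "real ^ 'd::finite \<Rightarrow> complex" and W :: "real ^ 'd \<Rightarrow> real" and R \<eta> :: real
  assumes f: "C1 f" and K: "compact K" "\<And>x. x \<notin> K \<Longrightarrow> f x = 0"
    and R: "0 < R" and J: "finite J" "K \<subseteq> (\<Union>j\<in>J. cell R j)" "J' \<subseteq> J"
    and W [measurable]: "W \<in> borel_measurable borel" and W01: "\<And>x. 0 \<le> W x" "\<And>x. W x \<le> 1"
    and \<eta>: "0 < \<eta>" "\<eta> \<le> 1"
    and good: "\<And>j. j \<in> J - J' \<Longrightarrow> \<eta> * R ^ CARD('d) \<le> (LINT x:cell R j|lborel. W x)"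
  shows "\<eta> * (\<integral>x. (norm (f x))\<^sup>2 \<partial>lborel)
    \<le> 2 * (\<integral>x. W x * (norm (f x))\<^sup>2 \<partial>lborel)
      + 2 * (CARD('d) * 2 ^ CARD('d) * R\<^sup>2) * (\<integral>x. (norm (grad f x))\<^sup>2 \<partial>lborel)
      + (\<Sum>j\<in>J'. (norm (LINT x:cell R j|lborel. f x))\<^sup>2 / R ^ CARD('d))"
proof -
  define C where "C = CARD('d) * 2 ^ CARD('d) * R\<^sup>2"
  have C: "0 \<le> C" by (simp add: C_def)
  define I where "I j g = (LINT x:cell R j|lborel. g x)" for j and g :: "real ^ 'd \<Rightarrow> real"
  have restr: "(\<integral>x. g x \<partial>restrict_space lborel (cell R j)) = (LINT x:cell R j|lborel. g x)"
    for j and g :: "real ^ 'd \<Rightarrow> 'b::{banach, second_countable_topology}"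
    by (simp add: integral_restrict_space set_lebesgue_integral_def)
  define q where "q = (\<lambda>x. (norm (f x))\<^sup>2)"
  define r where "r = (\<lambda>x. (norm (grad f x))\<^sup>2)"
  have q0: "x \<notin> K \<Longrightarrow> q x = 0" for x using K by (simp add: q_def)
  have r0: "x \<notin> K \<Longrightarrow> r x = 0" for x
    using grad_eq_0_outside[of K f x] K by (simp add: r_def compact_imp_closed)
  have [measurable]: "f \<in> borel_measurable borel" "grad f \<in> borel_measurable borel"
    using C1_continuous_grad[OF f] C1_continuous[OF f] by (auto intro: borel_measurable_continuous_onI)
  have int: "integrable lborel q" "integrable lborel r"
    using q0 r0 by (auto simp: q_def r_def intro!: integrable_compact_support[OF K(1)] continuous_intros
        C1_continuous[OF f] C1_continuous_grad[OF f])
  have intW: "integrable lborel (\<lambda>x. W x * q x)"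
    using W01 by (intro Bochner_Integration.integrable_bound[OF int(1)]) (auto simp: q_def intro!: mult_left_le_one_le)
  have sumI: "(\<Sum>j\<in>J. I j g) = (\<integral>x. g x \<partial>lborel)"
    if "integrable lborel g" "\<And>x. x \<notin> K \<Longrightarrow> g x = 0" for g
  proof -
    have "(\<Sum>j\<in>J. I j g) = (LINT x:(\<Union>j\<in>J. cell R j)|lborel. g x)"
      unfolding I_def
    proof (rule set_integral_finite_Union[symmetric, OF J(1) disjoint_cells[OF R]])
      show "set_integrable lborel (cell R j) g" for j
        unfolding set_integrable_def by (rule integrable_mult_indicator[OF _ that(1)]) simp
    qed simp
    also have "\<dots> = (\<integral>x. g x \<partial>lborel)"
      unfolding set_lebesgue_integral_def using that(2) J(2)
      by (intro Bochner_Integration.integral_cong) (auto simp: indicator_def)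
    finally show ?thesis .
  qed
  have nonneg: "0 \<le> I j (\<lambda>x. W x * q x)" "0 \<le> I j r" "0 \<le> I j q" for j
    using W01 by (auto simp: I_def q_def r_def set_lebesgue_integral_def intro!: integral_nonneg_AE)
  have "\<eta> * I j q \<le> 2 * I j (\<lambda>x. W x * q x) + 2 * C * I j r
      + (if j \<in> J' then (norm (LINT x:cell R j|lborel. f x))\<^sup>2 / R ^ CARD('d) else 0)" if j: "j \<in> J" for j
  proof (cases "j \<in> J'")
    case True
    \<comment> \<open>The normalisation \<open>\<eta> \<le> 1\<close> lets bad cells share the left
      side \<open>\<eta> * I j q\<close> with good ones.\<close>
    have "\<eta> * I j q \<le> I j q" using \<eta> nonneg by (intro mult_left_le_one_le) auto
    also have "\<dots> \<le> C * I j r + (norm (LINT x:cell R j|lborel. f x))\<^sup>2 / R ^ CARD('d)"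
      using cell_mean_inequality[OF f R, of j] unfolding restr I_def C_def q_def r_def .
    finally have "\<eta> * I j q \<le> C * I j r + (norm (LINT x:cell R j|lborel. f x))\<^sup>2 / R ^ CARD('d)" .
    moreover have "0 \<le> C * I j r" using C nonneg by simp
    ultimately show ?thesis using True nonneg(1)[of j] unfolding mult.assoc by (simp only: if_True)
  next
    case False
    have Rd: "0 < R ^ CARD('d)" using R by simp
    have "\<eta> * R ^ CARD('d) * I j q \<le> (LINT x:cell R j|lborel. W x) * I j q"
      using False j nonneg by (intro mult_right_mono good) auto
    also have "\<dots> \<le> R ^ CARD('d) * (2 * I j (\<lambda>x. W x * q x) + 2 * C * I j r)"
      using cell_weighted_inequality[OF f R W W01, of j] unfolding restr I_def C_def q_def r_def .
    finally have "R ^ CARD('d) * (\<eta> * I j q) \<le> R ^ CARD('d) * (2 * I j (\<lambda>x. W x * q x) + 2 * C * I j r)"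
      by (simp add: ac_simps)
    then show ?thesis using Rd False by simp
  qed
  then have "(\<Sum>j\<in>J. \<eta> * I j q) \<le> (\<Sum>j\<in>J. 2 * I j (\<lambda>x. W x * q x) + 2 * C * I j r
      + (if j \<in> J' then (norm (LINT x:cell R j|lborel. f x))\<^sup>2 / R ^ CARD('d) else 0))"
    by (rule sum_mono)
  also have "\<dots> = 2 * (\<Sum>j\<in>J. I j (\<lambda>x. W x * q x)) + 2 * C * (\<Sum>j\<in>J. I j r)
      + (\<Sum>j\<in>J'. (norm (LINT x:cell R j|lborel. f x))\<^sup>2 / R ^ CARD('d))"
    using J by (simp add: sum.distrib sum_distrib_left sum.If_cases Int_absorb1 Int_commute)
  finally show ?thesis
    using int intW q0 r0 by (simp add: sum_distrib_left[symmetric] sumI) (simp add: C_def q_def r_def)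
qed

section \<open>The form domain\<close>

lemma L2_on_measurable: "L2_on S f \<Longrightarrow> f \<in> borel_measurable (lebesgue_on S)"
  and L2_on_integrable: "L2_on S f \<Longrightarrow> integrable (lebesgue_on S) (\<lambda>x. (norm (f x))\<^sup>2)"
  by (auto simp: L2_on_def)

lemma L2_on_bound:
  fixes f :: "real ^ 'd::finite \<Rightarrow> 'b::{real_normed_vector, second_countable_topology}"
  assumes "f \<in> borel_measurable (lebesgue_on S)" "integrable (lebesgue_on S) g"
    "\<And>x. (norm (f x))\<^sup>2 \<le> g x"
  shows "L2_on S f"
proof -
  note [measurable] = assms(1)
  have "\<bar>(norm (f x))\<^sup>2\<bar> \<le> \<bar>g x\<bar>" for x
    using assms(3)[of x] zero_le_power2[of "norm (f x)"] by linarith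
  then have "integrable (lebesgue_on S) (\<lambda>x. (norm (f x))\<^sup>2)"
    by (intro Bochner_Integration.integrable_bound[OF assms(2)]) auto
  then show ?thesis using assms(1) by (simp add: L2_on_def)
qed

lemma L2_on_add:
  fixes f :: "real ^ 'd::finite \<Rightarrow> 'b::{real_normed_vector, second_countable_topology}"
  assumes "L2_on S f" "L2_on S g"
  shows "L2_on S (\<lambda>x. f x + g x)"
proof (rule L2_on_bound)
  note [measurable] = assms[THEN L2_on_measurable]
  show "(\<lambda>x. f x + g x) \<in> borel_measurable (lebesgue_on S)" by measurable
  show "integrable (lebesgue_on S) (\<lambda>x. 2 * (norm (f x))\<^sup>2 + 2 * (norm (g x))\<^sup>2)"
    using assms[THEN L2_on_integrable] by auto
qed (rule norm_add_square_le)

lemma L2_on_uminus: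
  fixes f :: "real ^ 'd::finite \<Rightarrow> 'b::{real_normed_vector, second_countable_topology}"
  assumes "L2_on S f"
  shows "L2_on S (\<lambda>x. - f x)"
  using assms by (auto simp: L2_on_def)

lemma L2_on_diff:
  fixes f :: "real ^ 'd::finite \<Rightarrow> 'b::{real_normed_vector, second_countable_topology}"
  assumes "L2_on S f" "L2_on S g"
  shows "L2_on S (\<lambda>x. f x - g x)"
  using L2_on_add[OF assms(1) L2_on_uminus[OF assms(2)]] by simp

lemma norm_vector_scalar_mult: "norm (c *s (z :: complex ^ 'd::finite)) = norm c * norm z"
  by (simp add: norm_vec_def L2_set_def norm_mult power_mult_distrib sum_distrib_left[symmetric] real_sqrt_mult)

lemma bounded_linear_vector_scalar_mult: "bounded_linear (\<lambda>z :: complex ^ 'd::finite. c *s z)"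
  by (rule bounded_linear_intro[of _ "norm c"])
     (auto simp: vec_eq_iff algebra_simps norm_vector_scalar_mult)

lemma measurable_vector_scalar_mult [measurable (raw)]:
  fixes f :: "'a \<Rightarrow> complex ^ 'd::finite"
  assumes "f \<in> borel_measurable M"
  shows "(\<lambda>x. c *s f x) \<in> borel_measurable M"
  by (rule borel_measurable_continuous_on[OF linear_continuous_on[OF bounded_linear_vector_scalar_mult] assms])

lemma L2_on_cmult: "L2_on S f \<Longrightarrow> L2_on S (\<lambda>x. (c::complex) * f x)"
  by (auto simp: L2_on_def norm_mult power_mult_distrib)

lemma L2_on_scalar_mult: "L2_on S f \<Longrightarrow> L2_on S (\<lambda>x. (c::complex) *s (f x :: complex ^ 'd::finite))"
  by (auto simp: L2_on_def norm_vector_scalar_mult power_mult_distrib)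

lemma integrable_L2_mult:
  fixes f g :: "real ^ 'd::finite \<Rightarrow> complex"
  assumes "L2_on S f" "L2_on S g"
  shows "integrable (lebesgue_on S) (\<lambda>x. f x * cnj (g x))"
proof (rule Bochner_Integration.integrable_bound)
  note [measurable] = assms[THEN L2_on_measurable]
  have "cnj \<in> borel_measurable borel"
    by (intro borel_measurable_continuous_onI continuous_intros)
  note [measurable] = this
  show "(\<lambda>x. f x * cnj (g x)) \<in> borel_measurable (lebesgue_on S)" by measurable
  show "integrable (lebesgue_on S) (\<lambda>x. (norm (f x))\<^sup>2 + (norm (g x))\<^sup>2)"
    using assms[THEN L2_on_integrable] by auto
  have "norm (f x) * norm (g x) \<le> (norm (f x))\<^sup>2 + (norm (g x))\<^sup>2" for x
  proof -
    have "2 * (norm (f x) * norm (g x)) \<le> (norm (f x))\<^sup>2 + (norm (g x))\<^sup>2"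
      using sum_squares_bound[of "norm (f x)" "norm (g x)"] by simp
    moreover have "0 \<le> norm (f x) * norm (g x)" by simp
    ultimately show ?thesis by linarith
  qed
  then show "AE x in lebesgue_on S. norm (f x * cnj (g x)) \<le> norm ((norm (f x))\<^sup>2 + (norm (g x))\<^sup>2)"
    by (auto simp: norm_mult)
qed

lemma L2_on_nth:
  fixes f :: "real ^ 'd::finite \<Rightarrow> complex ^ 'd"
  assumes "L2_on S f"
  shows "L2_on S (\<lambda>x. f x $ i)"
proof (rule L2_on_bound[OF _ L2_on_integrable[OF assms]])
  note [measurable] = assms[THEN L2_on_measurable]
  show "(\<lambda>x. f x $ i) \<in> borel_measurable (lebesgue_on S)"
    by (rule borel_measurable_continuous_on[OF _ L2_on_measurable[OF assms], of "\<lambda>z. z $ i"])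
       (intro continuous_intros)
  show "(norm (f x $ i))\<^sup>2 \<le> (norm (f x))\<^sup>2" for x
    by (intro power_mono Finite_Cartesian_Product.norm_nth_le) auto
qed

section \<open>Linearity of the test functions\<close>

lemma Ck_add: "Ck k f \<Longrightarrow> Ck k g \<Longrightarrow> Ck k (\<lambda>x. f x + g x)"
proof (induction k arbitrary: f g)
  case (Suc k)
  have "grad (\<lambda>x. f x + g x) x $ i = grad f x $ i + grad g x $ i" for x i
  proof -
    have "((\<lambda>x. f x + g x) has_derivative (\<lambda>h. frechet_derivative f (at x) h + frechet_derivative g (at x) h)) (at x)"
      using Suc.prems by (auto intro!: has_derivative_add simp: frechet_derivative_works)
    then show ?thesis by (simp add: grad_def frechet_derivative_at[symmetric])
  qed
  then show ?case using Suc by simp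
qed (auto intro: continuous_intros)

lemma Ck_cmult: "Ck k f \<Longrightarrow> Ck k (\<lambda>x. c * f x)"
proof (induction k arbitrary: f)
  case (Suc k)
  have "grad (\<lambda>x. c * f x) x $ i = c * grad f x $ i" for x i
  proof -
    have "((\<lambda>x. c * f x) has_derivative (\<lambda>h. c * frechet_derivative f (at x) h)) (at x)"
      using Suc.prems by (auto intro!: derivative_eq_intros simp: frechet_derivative_works)
    then show ?thesis by (simp add: grad_def frechet_derivative_at[symmetric])
  qed
  then show ?case using Suc by simp
qed (auto intro: continuous_intros)

lemma grad_add:
  assumes "Ck (Suc k) f" "Ck (Suc k) g"
  shows "grad (\<lambda>x. f x + g x) x = grad f x + grad g x"
proof -
  have "((\<lambda>x. f x + g x) has_derivative (\<lambda>h. frechet_derivative f (at x) h + frechet_derivative g (at x) h)) (at x)"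
    using assms by (auto intro!: has_derivative_add simp: frechet_derivative_works)
  then show ?thesis by (simp add: grad_def frechet_derivative_at[symmetric] vec_eq_iff)
qed

lemma grad_cmult:
  assumes "Ck (Suc k) f"
  shows "grad (\<lambda>x. c * f x) x = c *s grad f x"
proof -
  have "((\<lambda>x. c * f x) has_derivative (\<lambda>h. c * frechet_derivative f (at x) h)) (at x)"
    using assms by (auto intro!: derivative_eq_intros simp: frechet_derivative_works)
  then show ?thesis by (simp add: grad_def frechet_derivative_at[symmetric] vec_eq_iff)
qed

lemma test_function_add:
  assumes "test_function S f" "test_function S g"
  shows "test_function S (\<lambda>x. f x + g x)"
proof -
  have sub: "closure {x. f x + g x \<noteq> 0} \<subseteq> closure {x. f x \<noteq> 0} \<union> closure {x. g x \<noteq> 0}"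
    unfolding closure_Un[symmetric] by (intro closure_mono) auto
  moreover have "compact (closure {x. f x \<noteq> 0} \<union> closure {x. g x \<noteq> 0})"
    using assms unfolding test_function_def by blast
  ultimately have "compact (closure {x. f x + g x \<noteq> 0})"
    unfolding compact_eq_bounded_closed using bounded_subset by blast
  then show ?thesis using assms sub unfolding test_function_def by (intro conjI allI Ck_add) auto
qed

lemma test_function_cmult:
  assumes "test_function S f"
  shows "test_function S (\<lambda>x. c * f x)"
proof -
  have sub: "closure {x. c * f x \<noteq> 0} \<subseteq> closure {x. f x \<noteq> 0}"
    by (intro closure_mono) auto
  moreover have "compact (closure {x. f x \<noteq> 0})" using assms unfolding test_function_def by blast
  ultimately have "compact (closure {x. c * f x \<noteq> 0})"
    unfolding compact_eq_bounded_closed using bounded_subset by blast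
  then show ?thesis using assms order_trans[OF sub] unfolding test_function_def by (intro conjI allI Ck_cmult) blast+
qed

lemma test_functionD:
  assumes "test_function S f"
  defines "K \<equiv> closure {x. f x \<noteq> 0}"
  shows "C1 f" "compact K" "K \<subseteq> S" "\<And>x. x \<notin> K \<Longrightarrow> f x = 0" "\<And>x. x \<notin> K \<Longrightarrow> grad f x = 0"
    "Ck (Suc 0) f"
proof -
  show Ck: "Ck (Suc 0) f" using assms(1) unfolding test_function_def by blast
  then show "C1 f" by (rule Ck_imp_C1)
  show "compact K" "K \<subseteq> S" using assms(1) unfolding test_function_def K_def by blast+
  show *: "x \<notin> K \<Longrightarrow> f x = 0" for x using closure_subset[of "{x. f x \<noteq> 0}"] by (auto simp: K_def)
  have "closed K" by (simp add: K_def)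
  then show "x \<notin> K \<Longrightarrow> grad f x = 0" for x using * by (rule grad_eq_0_outside)
qed

text \<open>The operator lives on \<open>lebesgue_on S\<close>, the cell estimates on
  \<open>lborel\<close>. The integrals agree for Borel functions that vanish off \<open>S\<close>,
  as test functions and their gradients do.\<close>

lemma integral_lebesgue_on_eq_lborel:
  fixes g :: "real ^ 'd::finite \<Rightarrow> 'b::{banach, second_countable_topology}"
  assumes S: "S \<in> sets borel" and g: "g \<in> borel_measurable borel" and 0: "\<And>x. x \<notin> S \<Longrightarrow> g x = 0"
  shows "(\<integral>x. g x \<partial>lebesgue_on S) = (\<integral>x. g x \<partial>lborel)"
proof -
  have "(\<integral>x. g x \<partial>lebesgue_on S) = (\<integral>x. indicator S x *\<^sub>R g x \<partial>lebesgue)"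
    using S by (intro integral_restrict_space) auto
  also have "(\<lambda>x. indicator S x *\<^sub>R g x) = g" using 0 by (auto simp: indicator_def)
  also have "(\<integral>x. g x \<partial>lebesgue) = (\<integral>x. g x \<partial>lborel)" using g by (intro integral_completion) auto
  finally show ?thesis .
qed

lemma integrable_lebesgue_on_iff_lborel:
  fixes g :: "real ^ 'd::finite \<Rightarrow> 'b::{banach, second_countable_topology}"
  assumes S: "S \<in> sets borel" and g: "g \<in> borel_measurable borel" and 0: "\<And>x. x \<notin> S \<Longrightarrow> g x = 0"
  shows "integrable (lebesgue_on S) g \<longleftrightarrow> integrable lborel g"
proof -
  have "integrable (lebesgue_on S) g \<longleftrightarrow> integrable lebesgue (\<lambda>x. indicator S x *\<^sub>R g x)"
    using S by (intro integrable_restrict_space) auto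
  also have "(\<lambda>x. indicator S x *\<^sub>R g x) = g" using 0 by (auto simp: indicator_def)
  also have "integrable lebesgue g \<longleftrightarrow> integrable lborel g" using g by (intro integrable_completion) auto
  finally show ?thesis .
qed

lemma borel_measurable_lebesgue_on:
  "g \<in> borel_measurable borel \<Longrightarrow> g \<in> borel_measurable (lebesgue_on S)"
  by (intro measurable_restrict_space1 measurable_completion) auto

lemma L2_on_continuous:
  fixes g :: "real ^ 'd::finite \<Rightarrow> 'b::{banach, second_countable_topology}"
  assumes "S \<in> sets borel" "continuous_on UNIV g" "compact K" "K \<subseteq> S" "\<And>x. x \<notin> K \<Longrightarrow> g x = 0"
  shows "L2_on S g"
proof -
  have [measurable]: "g \<in> borel_measurable borel"
    using assms(2) by (rule borel_measurable_continuous_onI)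
  have "integrable lborel (\<lambda>x. (norm (g x))\<^sup>2)"
    using assms by (intro integrable_compact_support[of K] continuous_intros) auto
  then have "integrable (lebesgue_on S) (\<lambda>x. (norm (g x))\<^sup>2)"
    using assms by (subst integrable_lebesgue_on_iff_lborel) auto
  then show ?thesis by (simp add: L2_on_def borel_measurable_lebesgue_on)
qed

lemma test_function_L2:
  assumes "S \<in> sets borel" "test_function S f"
  shows "L2_on S f" "L2_on S (grad f)"
proof -
  note f = test_functionD[OF assms(2)]
  show "L2_on S f" by (rule L2_on_continuous[OF assms(1) C1_continuous[OF f(1)] f(2-4)])
  show "L2_on S (grad f)" by (rule L2_on_continuous[OF assms(1) C1_continuous_grad[OF f(1)] f(2,3,5)])
qed

lemma L2_limit_add:
  fixes a b :: "nat \<Rightarrow> real ^ 'd::finite \<Rightarrow> 'b::{real_normed_vector, second_countable_topology}"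
  assumes L2: "\<And>n. L2_on S (a n)" "\<And>n. L2_on S (b n)"
    and lim: "(\<lambda>n. \<integral>x. (norm (a n x))\<^sup>2 \<partial>lebesgue_on S) \<longlonglongrightarrow> 0" "(\<lambda>n. \<integral>x. (norm (b n x))\<^sup>2 \<partial>lebesgue_on S) \<longlonglongrightarrow> 0"
  shows "(\<lambda>n. \<integral>x. (norm (a n x + b n x))\<^sup>2 \<partial>lebesgue_on S) \<longlonglongrightarrow> 0"
proof (rule tendsto_sandwich[OF _ _ tendsto_const])
  have "(\<lambda>n. 2 * (\<integral>x. (norm (a n x))\<^sup>2 \<partial>lebesgue_on S) + 2 * (\<integral>x. (norm (b n x))\<^sup>2 \<partial>lebesgue_on S)) \<longlonglongrightarrow> 2 * 0 + 2 * 0"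
    by (intro tendsto_intros lim)
  then show "(\<lambda>n. 2 * (\<integral>x. (norm (a n x))\<^sup>2 \<partial>lebesgue_on S) + 2 * (\<integral>x. (norm (b n x))\<^sup>2 \<partial>lebesgue_on S)) \<longlonglongrightarrow> 0" by simp
  have "(\<integral>x. (norm (a n x + b n x))\<^sup>2 \<partial>lebesgue_on S) \<le> (\<integral>x. 2 * (norm (a n x))\<^sup>2 + 2 * (norm (b n x))\<^sup>2 \<partial>lebesgue_on S)" for n
    using L2[THEN L2_on_integrable] L2_on_add[OF L2, THEN L2_on_integrable]
    by (intro integral_mono norm_add_square_le) auto
  then show "\<forall>\<^sub>F n in sequentially. (\<integral>x. (norm (a n x + b n x))\<^sup>2 \<partial>lebesgue_on S)
      \<le> 2 * (\<integral>x. (norm (a n x))\<^sup>2 \<partial>lebesgue_on S) + 2 * (\<integral>x. (norm (b n x))\<^sup>2 \<partial>lebesgue_on S)"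
    using L2[THEN L2_on_integrable] by simp
qed auto

lemma H10_add:
  assumes S: "S \<in> sets borel" and "H10 S u G" "H10 S w H"
  shows "H10 S (\<lambda>x. u x + w x) (\<lambda>x. G x + H x)"
proof -
  obtain \<phi> where \<phi>: "\<And>n. test_function S (\<phi> n)"
    "(\<lambda>n. \<integral>x. (norm (\<phi> n x - u x))\<^sup>2 \<partial>lebesgue_on S) \<longlonglongrightarrow> 0"
    "(\<lambda>n. \<integral>x. (norm (grad (\<phi> n) x - G x))\<^sup>2 \<partial>lebesgue_on S) \<longlonglongrightarrow> 0" using assms(2) by (auto simp: H10_def)
  obtain \<psi> where \<psi>: "\<And>n. test_function S (\<psi> n)"
    "(\<lambda>n. \<integral>x. (norm (\<psi> n x - w x))\<^sup>2 \<partial>lebesgue_on S) \<longlonglongrightarrow> 0"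
    "(\<lambda>n. \<integral>x. (norm (grad (\<psi> n) x - H x))\<^sup>2 \<partial>lebesgue_on S) \<longlonglongrightarrow> 0" using assms(3) by (auto simp: H10_def)
  have L2: "L2_on S u" "L2_on S G" "L2_on S w" "L2_on S H" using assms by (auto simp: H10_def)
  have "grad (\<lambda>x. \<phi> n x + \<psi> n x) x = grad (\<phi> n) x + grad (\<psi> n) x" for n x
    using grad_add \<phi>(1) \<psi>(1) test_functionD(6) by blast
  moreover have "(\<lambda>n. \<integral>x. (norm ((\<phi> n x - u x) + (\<psi> n x - w x)))\<^sup>2 \<partial>lebesgue_on S) \<longlonglongrightarrow> 0"
    by (intro L2_limit_add L2_on_diff L2 test_function_L2 S \<phi> \<psi>)
  moreover have "(\<lambda>n. \<integral>x. (norm ((grad (\<phi> n) x - G x) + (grad (\<psi> n) x - H x)))\<^sup>2 \<partial>lebesgue_on S) \<longlonglongrightarrow> 0"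
    by (intro L2_limit_add L2_on_diff L2 test_function_L2 S \<phi> \<psi>)
  ultimately show ?thesis using L2 \<phi>(1) \<psi>(1) unfolding H10_def
    by (intro conjI L2_on_add exI[of _ "\<lambda>n x. \<phi> n x + \<psi> n x"]) (auto intro: test_function_add simp: algebra_simps)
qed

lemma H10_scale:
  assumes "H10 S u G"
  shows "H10 S (\<lambda>x. c * u x) (\<lambda>x. c *s G x)"
proof -
  obtain \<phi> where \<phi>: "\<And>n. test_function S (\<phi> n)"
    "(\<lambda>n. \<integral>x. (norm (\<phi> n x - u x))\<^sup>2 \<partial>lebesgue_on S) \<longlonglongrightarrow> 0"
    "(\<lambda>n. \<integral>x. (norm (grad (\<phi> n) x - G x))\<^sup>2 \<partial>lebesgue_on S) \<longlonglongrightarrow> 0" using assms by (auto simp: H10_def)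
  have L2: "L2_on S u" "L2_on S G" using assms by (auto simp: H10_def)
  have "norm (c * \<phi> n x - c * u x) = norm c * norm (\<phi> n x - u x)" for n x
    by (simp add: right_diff_distrib[symmetric] norm_mult)
  moreover have "norm (grad (\<lambda>x. c * \<phi> n x) x - c *s G x) = norm c * norm (grad (\<phi> n) x - G x)" for n x
  proof -
    have "grad (\<lambda>x. c * \<phi> n x) x = c *s grad (\<phi> n) x"
      using grad_cmult \<phi>(1) test_functionD(6) by blast
    then have "grad (\<lambda>x. c * \<phi> n x) x - c *s G x = c *s (grad (\<phi> n) x - G x)"
      by (simp add: vec_eq_iff algebra_simps)
    then show ?thesis unfolding norm_vector_scalar_mult[symmetric] by simp
  qed
  moreover have "(\<lambda>n. (norm c)\<^sup>2 * (\<integral>x. (norm (\<phi> n x - u x))\<^sup>2 \<partial>lebesgue_on S)) \<longlonglongrightarrow> 0"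
    "(\<lambda>n. (norm c)\<^sup>2 * (\<integral>x. (norm (grad (\<phi> n) x - G x))\<^sup>2 \<partial>lebesgue_on S)) \<longlonglongrightarrow> 0"
    by (intro tendsto_mult_right_zero \<phi>)+
  ultimately show ?thesis using L2 \<phi>(1) unfolding H10_def
    by (intro conjI L2_on_cmult L2_on_scalar_mult exI[of _ "\<lambda>n x. c * \<phi> n x"])
       (auto intro: test_function_cmult simp: power_mult_distrib)
qed

text \<open>Cauchy-Schwarz against an indicator, from the elementary bound of a product by half the
  sum of squares with a free parameter t: integrability takes t = 1, the inequality optimises
  t.\<close>

lemma Cauchy_Schwarz_finite_measure:
  fixes h :: "'a \<Rightarrow> 'b::{banach, second_countable_topology}"
  assumes A: "A \<in> sets M" "emeasure M A \<le> ennreal b" "0 < b"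
    and h: "h \<in> borel_measurable M" "integrable M (\<lambda>x. (norm (h x))\<^sup>2)"
  shows "integrable M (\<lambda>x. indicator A x *\<^sub>R h x)"
    "(norm (\<integral>x. indicator A x *\<^sub>R h x \<partial>M))\<^sup>2 \<le> b * (\<integral>x. (norm (h x))\<^sup>2 \<partial>M)"
proof -
  note [measurable] = A(1) h(1)
  have finA: "emeasure M A < \<infinity>" using A(2) by (simp add: order_le_less_trans ennreal_less_top)
  then have intA: "integrable M (indicator A :: 'a \<Rightarrow> real)" using A by (simp add: integrable_real_indicator)
  have mA: "measure M A \<le> b" using A by (simp add: measure_def enn2real_leI)
  have ptw: "norm (indicator A x *\<^sub>R h x) * t \<le> (norm (h x))\<^sup>2 / 2 + t\<^sup>2 / 2 * indicator A x" for x t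
    using sum_squares_bound[of "norm (h x)" t] by (auto simp: indicator_def field_simps)
  show int: "integrable M (\<lambda>x. indicator A x *\<^sub>R h x)"
  proof (rule Bochner_Integration.integrable_bound)
    show "integrable M (\<lambda>x. (norm (h x))\<^sup>2 / 2 + 1 / 2 * indicator A x)" using h intA by auto
    show "AE x in M. norm (indicator A x *\<^sub>R h x) \<le> norm ((norm (h x))\<^sup>2 / 2 + 1 / 2 * indicator A x)"
      using ptw[of _ 1] by (auto intro!: AE_I2)
  qed measurable
  define q where "q = (\<integral>x. (norm (h x))\<^sup>2 \<partial>M)"
  define m where "m = (\<integral>x. norm (indicator A x *\<^sub>R h x) \<partial>M)"
  have "0 \<le> m" "0 \<le> q" by (auto simp: m_def q_def)
  have "m * t \<le> q / 2 + t\<^sup>2 / 2 * b" for t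
  proof -
    have "m * t = (\<integral>x. norm (indicator A x *\<^sub>R h x) * t \<partial>M)" by (simp add: m_def)
    also have "\<dots> \<le> (\<integral>x. (norm (h x))\<^sup>2 / 2 + t\<^sup>2 / 2 * indicator A x \<partial>M)"
      using int h intA by (intro integral_mono ptw integrable_mult_left integrable_norm) auto
    also have "\<dots> = q / 2 + t\<^sup>2 / 2 * measure M A" using h intA A by (simp add: q_def)
    also have "\<dots> \<le> q / 2 + t\<^sup>2 / 2 * b" using mA by (intro add_mono mult_left_mono) auto
    finally show ?thesis .
  qed
  \<comment> \<open>\<open>t = m / b\<close> minimises the difference between the right and the left
    side.\<close>
  from this[of "m / b"] have "m\<^sup>2 \<le> b * q" using A(3) by (simp add: power2_eq_square field_simps)
  moreover have "(norm (\<integral>x. indicator A x *\<^sub>R h x \<partial>M))\<^sup>2 \<le> m\<^sup>2"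
    unfolding m_def by (intro power_mono integral_norm_bound) auto
  ultimately show "(norm (\<integral>x. indicator A x *\<^sub>R h x \<partial>M))\<^sup>2 \<le> b * (\<integral>x. (norm (h x))\<^sup>2 \<partial>M)"
    unfolding q_def[symmetric] by linarith
qed

lemma emeasure_lebesgue_on_cell_le:
  assumes "S \<in> sets borel" "0 \<le> R"
  shows "emeasure (lebesgue_on S) (cell R j \<inter> S) \<le> ennreal (R ^ CARD('d))"
    and "cell R (j :: 'd::finite \<Rightarrow> int) \<inter> S \<in> sets (lebesgue_on S)"
proof -
  have "emeasure (lebesgue_on S) (cell R j \<inter> S) = emeasure lebesgue (cell R j \<inter> S)"
    using assms by (intro emeasure_restrict_space) auto
  also have "\<dots> \<le> emeasure lebesgue (cell R j)" using assms by (intro emeasure_mono) auto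
  also have "\<dots> = ennreal (R ^ CARD('d))" using assms by (simp add: emeasure_cell)
  finally show "emeasure (lebesgue_on S) (cell R j \<inter> S) \<le> ennreal (R ^ CARD('d))" .
  show "cell R j \<inter> S \<in> sets (lebesgue_on S)"
    using assms by (subst sets_restrict_space_iff) auto
qed

text \<open>A cell may stick out of \<open>S\<close>; the intersection makes it a measurable set of
  \<open>lebesgue_on S\<close>.\<close>

abbreviation cell_integral :: "(real ^ 'd::finite) set \<Rightarrow> real \<Rightarrow> ('d \<Rightarrow> int) \<Rightarrow> (real ^ 'd \<Rightarrow> complex) \<Rightarrow> complex" where
  "cell_integral S R j u \<equiv> (\<integral>x. indicator (cell R j \<inter> S) x *\<^sub>R u x \<partial>lebesgue_on S)"

text \<open>Approximation by test functions. The 2 in \<open>cells_inequality\<close> becomes 8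
  because comparing \<open>u\<close> with an approximant loses a factor 2 in the norm on the left
  and another 2 in the energies on the right.\<close>

lemma H10_cells_inequality:
  fixes W :: "real ^ 'd::finite \<Rightarrow> real" and R \<eta> :: real
  assumes H: "H10 S u G" and S: "S \<in> sets borel"
    and R: "0 < R" and J: "finite J" "S \<subseteq> (\<Union>j\<in>J. cell R j)" "J' \<subseteq> J"
    and W [measurable]: "W \<in> borel_measurable borel" and W01: "\<And>x. 0 \<le> W x" "\<And>x. W x \<le> 1"
    and \<eta>: "0 < \<eta>" "\<eta> \<le> 1"
    and good: "\<And>j. j \<in> J - J' \<Longrightarrow> \<eta> * R ^ CARD('d) \<le> (LINT x:cell R j|lborel. W x)"
    and mean0: "\<And>j. j \<in> J' \<Longrightarrow> cell_integral S R j u = 0"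
  shows "\<eta> * (\<integral>x. (norm (u x))\<^sup>2 \<partial>lebesgue_on S)
    \<le> 8 * (\<integral>x. W x * (norm (u x))\<^sup>2 \<partial>lebesgue_on S)
      + 8 * (CARD('d) * 2 ^ CARD('d) * R\<^sup>2) * (\<integral>x. (norm (G x))\<^sup>2 \<partial>lebesgue_on S)"
proof -
  define N where "N = lebesgue_on S"
  define C where "C = CARD('d) * 2 ^ CARD('d) * R\<^sup>2"
  have C: "0 \<le> C" by (simp add: C_def)
  obtain \<phi> where \<phi>: "\<And>n. test_function S (\<phi> n)"
    "(\<lambda>n. \<integral>x. (norm (\<phi> n x - u x))\<^sup>2 \<partial>N) \<longlonglongrightarrow> 0"
    "(\<lambda>n. \<integral>x. (norm (grad (\<phi> n) x - G x))\<^sup>2 \<partial>N) \<longlonglongrightarrow> 0" using H by (auto simp: H10_def N_def)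
  have L2: "L2_on S u" "L2_on S G" using H by (auto simp: H10_def)
  define e where "e n = (\<integral>x. (norm (\<phi> n x - u x))\<^sup>2 \<partial>N)" for n
  define e' where "e' n = (\<integral>x. (norm (grad (\<phi> n) x - G x))\<^sup>2 \<partial>N)" for n
  have WN [measurable]: "W \<in> borel_measurable N" unfolding N_def by (rule borel_measurable_lebesgue_on[OF W])
  have intW: "integrable N (\<lambda>x. W x * (norm (g x))\<^sup>2)" if "L2_on S g" for g :: "real ^ 'd \<Rightarrow> complex"
  proof (rule Bochner_Integration.integrable_bound[OF L2_on_integrable[OF that, folded N_def]])
    have [measurable]: "g \<in> borel_measurable N" using L2_on_measurable[OF that] by (simp add: N_def)
    show "(\<lambda>x. W x * (norm (g x))\<^sup>2) \<in> borel_measurable N" by measurable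
  qed (use W01 in \<open>auto intro!: mult_left_le_one_le\<close>)
  define X where "X = (\<integral>x. (norm (u x))\<^sup>2 \<partial>N)"
  define Y where "Y = (\<integral>x. W x * (norm (u x))\<^sup>2 \<partial>N)"
  define Z where "Z = (\<integral>x. (norm (G x))\<^sup>2 \<partial>N)"
  have main: "\<eta> * X \<le> 8 * Y + 8 * C * Z + (2 * \<eta> * e n + 8 * e n + 8 * C * e' n + 2 * (real (card J') * e n))" for n
  proof -
    note tf = test_functionD[OF \<phi>(1)[of n]]
    note L2\<phi> = test_function_L2[OF S \<phi>(1)[of n]]
    define K where "K = closure {x. \<phi> n x \<noteq> 0}"
    note tf = tf[folded K_def]
    have [measurable]: "\<phi> n \<in> borel_measurable borel" "grad (\<phi> n) \<in> borel_measurable borel"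
      using C1_continuous[OF tf(1)] C1_continuous_grad[OF tf(1)] by (auto intro: borel_measurable_continuous_onI)
    have out: "x \<notin> S \<Longrightarrow> \<phi> n x = 0" "x \<notin> S \<Longrightarrow> grad (\<phi> n) x = 0" for x using tf by auto
    have d1: "L2_on S (\<lambda>x. \<phi> n x - u x)" "L2_on S (\<lambda>x. u x - \<phi> n x)" "L2_on S (\<lambda>x. grad (\<phi> n) x - G x)"
      by (intro L2_on_diff L2 L2\<phi>)+
    have 1: "X \<le> 2 * (\<integral>x. (norm (\<phi> n x))\<^sup>2 \<partial>lborel) + 2 * e n"
    proof -
      have "X \<le> (\<integral>x. 2 * (norm (\<phi> n x))\<^sup>2 + 2 * (norm (\<phi> n x - u x))\<^sup>2 \<partial>N)"
        unfolding X_def N_def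
      proof (rule integral_mono)
        show "(norm (u x))\<^sup>2 \<le> 2 * (norm (\<phi> n x))\<^sup>2 + 2 * (norm (\<phi> n x - u x))\<^sup>2" for x
          using norm_add_square_le[of "\<phi> n x" "u x - \<phi> n x"] by (simp add: norm_minus_commute)
      qed (use L2 L2\<phi> d1 in \<open>simp_all add: L2_on_integrable\<close>)
      also have "\<dots> = 2 * (\<integral>x. (norm (\<phi> n x))\<^sup>2 \<partial>N) + 2 * e n"
        using L2\<phi> d1 by (simp add: L2_on_integrable e_def N_def)
      also have "(\<integral>x. (norm (\<phi> n x))\<^sup>2 \<partial>N) = (\<integral>x. (norm (\<phi> n x))\<^sup>2 \<partial>lborel)"
        unfolding N_def by (rule integral_lebesgue_on_eq_lborel[OF S]) (auto simp: out)
      finally show ?thesis .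
    qed
    have 2: "(\<integral>x. W x * (norm (\<phi> n x))\<^sup>2 \<partial>lborel) \<le> 2 * Y + 2 * e n"
    proof -
      have "(\<integral>x. W x * (norm (\<phi> n x))\<^sup>2 \<partial>lborel) = (\<integral>x. W x * (norm (\<phi> n x))\<^sup>2 \<partial>N)"
        unfolding N_def by (rule integral_lebesgue_on_eq_lborel[OF S, symmetric]) (auto simp: out)
      also have "\<dots> \<le> (\<integral>x. 2 * (W x * (norm (u x))\<^sup>2) + 2 * (norm (\<phi> n x - u x))\<^sup>2 \<partial>N)"
      proof (rule integral_mono)
        fix x
        have "W x * (norm (\<phi> n x))\<^sup>2 \<le> W x * (2 * (norm (u x))\<^sup>2 + 2 * (norm (\<phi> n x - u x))\<^sup>2)"
          using norm_add_square_le[of "u x" "\<phi> n x - u x"] W01 by (intro mult_left_mono) auto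
        also have "\<dots> = 2 * (W x * (norm (u x))\<^sup>2) + W x * (2 * (norm (\<phi> n x - u x))\<^sup>2)"
          by (simp add: algebra_simps)
        also have "W x * (2 * (norm (\<phi> n x - u x))\<^sup>2) \<le> 2 * (norm (\<phi> n x - u x))\<^sup>2"
          using W01 by (intro mult_left_le_one_le) auto
        finally show "W x * (norm (\<phi> n x))\<^sup>2 \<le> 2 * (W x * (norm (u x))\<^sup>2) + 2 * (norm (\<phi> n x - u x))\<^sup>2" by simp
      qed (use L2 L2\<phi> d1 intW in \<open>simp_all add: L2_on_integrable N_def\<close>)
      also have "\<dots> = 2 * Y + 2 * e n"
        using d1(1)[THEN L2_on_integrable] intW[OF L2(1)] by (simp add: Y_def e_def N_def)
      finally show ?thesis .
    qed
    have 3: "(\<integral>x. (norm (grad (\<phi> n) x))\<^sup>2 \<partial>lborel) \<le> 2 * Z + 2 * e' n"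
    proof -
      have "(\<integral>x. (norm (grad (\<phi> n) x))\<^sup>2 \<partial>lborel) = (\<integral>x. (norm (grad (\<phi> n) x))\<^sup>2 \<partial>N)"
        unfolding N_def by (rule integral_lebesgue_on_eq_lborel[OF S, symmetric]) (auto simp: out)
      also have "\<dots> \<le> (\<integral>x. 2 * (norm (G x))\<^sup>2 + 2 * (norm (grad (\<phi> n) x - G x))\<^sup>2 \<partial>N)"
        unfolding N_def
      proof (rule integral_mono)
        show "(norm (grad (\<phi> n) x))\<^sup>2 \<le> 2 * (norm (G x))\<^sup>2 + 2 * (norm (grad (\<phi> n) x - G x))\<^sup>2" for x
          using norm_add_square_le[of "G x" "grad (\<phi> n) x - G x"] by simp
      qed (use L2 L2\<phi> d1 in \<open>simp_all add: L2_on_integrable\<close>)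
      also have "\<dots> = 2 * Z + 2 * e' n"
        using L2 d1(3) by (simp add: L2_on_integrable Z_def e'_def N_def)
      finally show ?thesis .
    qed
    \<comment> \<open>Since \<open>u\<close> has mean zero on the cell, the mean of
      \<open>\<phi> n\<close> is that of the error \<open>\<phi> n - u\<close>, so Cauchy-Schwarz
      bounds the mean term by \<open>e n\<close>.\<close>
    have 4: "(norm (LINT x:cell R j|lborel. \<phi> n x))\<^sup>2 / R ^ CARD('d) \<le> e n" if j: "j \<in> J'" for j
    proof -
      have rd: "0 < R ^ CARD('d)" using R by simp
      have meas: "cell R j \<inter> S \<in> sets N" "emeasure N (cell R j \<inter> S) \<le> ennreal (R ^ CARD('d))"
        using emeasure_lebesgue_on_cell_le[OF S, of R j] R by (auto simp: N_def)
      note CS = Cauchy_Schwarz_finite_measure[OF meas rd]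
      have "(LINT x:cell R j|lborel. \<phi> n x) = cell_integral S R j (\<phi> n)"
      proof -
        have "(LINT x:cell R j|lborel. \<phi> n x) = (\<integral>x. indicator (cell R j) x *\<^sub>R \<phi> n x \<partial>lebesgue_on S)"
          unfolding set_lebesgue_integral_def
          by (rule integral_lebesgue_on_eq_lborel[OF S, symmetric]) (auto simp: out)
        also have "\<dots> = cell_integral S R j (\<phi> n)"
          using out(1) by (intro Bochner_Integration.integral_cong) (auto simp: indicator_def)
        finally show ?thesis .
      qed
      also have "\<dots> = cell_integral S R j (\<lambda>x. \<phi> n x - u x)"
        using CS(1)[of "\<phi> n"] CS(1)[of u] mean0[OF j] L2(1) L2\<phi>(1)
        by (simp add: L2_on_measurable L2_on_integrable N_def scaleR_diff_right)
      finally have "(norm (LINT x:cell R j|lborel. \<phi> n x))\<^sup>2 \<le> R ^ CARD('d) * e n"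
        using CS(2)[of "\<lambda>x. \<phi> n x - u x"] d1(1) by (simp add: L2_on_measurable L2_on_integrable N_def e_def)
      then show ?thesis using rd by (simp add: divide_le_eq mult.commute)
    qed
    have "\<eta> * (\<integral>x. (norm (\<phi> n x))\<^sup>2 \<partial>lborel)
        \<le> 2 * (\<integral>x. W x * (norm (\<phi> n x))\<^sup>2 \<partial>lborel) + 2 * C * (\<integral>x. (norm (grad (\<phi> n) x))\<^sup>2 \<partial>lborel)
        + (\<Sum>j\<in>J'. (norm (LINT x:cell R j|lborel. \<phi> n x))\<^sup>2 / R ^ CARD('d))"
      unfolding C_def
      using tf J by (intro cells_inequality[of _ K] R J W W01 \<eta> good) auto
    also have "\<dots> \<le> 2 * (2 * Y + 2 * e n) + 2 * C * (2 * Z + 2 * e' n) + (\<Sum>j\<in>J'. e n)"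
      using 2 3 4 C by (intro add_mono mult_left_mono sum_mono) auto
    finally have 5: "\<eta> * (\<integral>x. (norm (\<phi> n x))\<^sup>2 \<partial>lborel)
        \<le> 4 * Y + 4 * e n + 4 * (C * Z) + 4 * (C * e' n) + real (card J') * e n"
      by (simp add: algebra_simps)
    have "\<eta> * X \<le> \<eta> * (2 * (\<integral>x. (norm (\<phi> n x))\<^sup>2 \<partial>lborel) + 2 * e n)"
      using 1 \<eta> by (intro mult_left_mono) auto
    then show ?thesis using 5 by (simp add: algebra_simps)
  qed
  have "(\<lambda>n. 8 * Y + 8 * C * Z + (2 * \<eta> * e n + 8 * e n + 8 * C * e' n + 2 * (real (card J') * e n)))
      \<longlonglongrightarrow> 8 * Y + 8 * C * Z + (2 * \<eta> * 0 + 8 * 0 + 8 * C * 0 + 2 * (real (card J') * 0))"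
    using \<phi>(2,3) unfolding e_def[symmetric] e'_def[symmetric] by (intro tendsto_intros)
  then have "\<eta> * X \<le> 8 * Y + 8 * C * Z + (2 * \<eta> * 0 + 8 * 0 + 8 * C * 0 + 2 * (real (card J') * 0))"
    by (rule LIMSEQ_le_const) (use main in auto)
  then show ?thesis by (simp add: X_def Y_def Z_def C_def N_def)
qed

section \<open>Sesquilinear forms and eigenpairs\<close>

definition inner_L2 :: "(real ^ 'd::finite) set \<Rightarrow> (real ^ 'd \<Rightarrow> complex) \<Rightarrow> (real ^ 'd \<Rightarrow> complex) \<Rightarrow> complex" where
  "inner_L2 S u w = (\<integral>x. u x * cnj (w x) \<partial>lebesgue_on S)"

text \<open>Weak gradients are arguments because \<open>form_dom\<close> carries them along; linear
  combinations then act on functions and gradients together.\<close>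

definition dirichlet_form ::
  "(real ^ 'd::finite) set \<Rightarrow> (real ^ 'd \<Rightarrow> real) \<Rightarrow> (real ^ 'd \<Rightarrow> complex) \<Rightarrow> (real ^ 'd \<Rightarrow> complex ^ 'd) \<Rightarrow>
    (real ^ 'd \<Rightarrow> complex) \<Rightarrow> (real ^ 'd \<Rightarrow> complex ^ 'd) \<Rightarrow> complex" where
  "dirichlet_form S V u G w H =
    (1 / 2) * (\<integral>x. (\<Sum>i\<in>UNIV. G x $ i * cnj (H x $ i)) \<partial>lebesgue_on S)
      + (\<integral>x. complex_of_real (V x) * u x * cnj (w x) \<partial>lebesgue_on S)"

definition eigenpair ::
  "(real ^ 'd::finite) set \<Rightarrow> (real ^ 'd \<Rightarrow> real) \<Rightarrow> real \<Rightarrow> (real ^ 'd \<Rightarrow> complex) \<Rightarrow> (real ^ 'd \<Rightarrow> complex ^ 'd) \<Rightarrow> bool" where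
  "eigenpair S V \<mu> u G \<longleftrightarrow> form_dom S V u G \<and>
    (\<forall>w H. form_dom S V w H \<longrightarrow> dirichlet_form S V u G w H = complex_of_real \<mu> * inner_L2 S u w)"

lemma eigenspace_eigenpair:
  assumes "u \<in> eigenspace S V \<mu>"
  shows "\<exists>G. eigenpair S V \<mu> u G"
  using assms by (auto simp: eigenspace_def dirichlet_op_def eigenpair_def dirichlet_form_def inner_L2_def mult.assoc)

lemma cnj_inner_L2: "cnj (inner_L2 S u w) = inner_L2 S w u"
proof -
  have "(\<lambda>x. w x * cnj (u x)) = (\<lambda>x. cnj (u x * cnj (w x)))" by (simp add: mult.commute)
  then show ?thesis unfolding inner_L2_def by (simp only: Bochner_Integration.integral_cnj)
qed

lemma cnj_dirichlet_form: "cnj (dirichlet_form S V u G w H) = dirichlet_form S V w H u G"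
proof -
  have 1: "(\<lambda>x. \<Sum>i\<in>UNIV. H x $ i * cnj (G x $ i)) = (\<lambda>x. cnj (\<Sum>i\<in>UNIV. G x $ i * cnj (H x $ i)))"
    by (simp add: mult.commute)
  have 2: "(\<lambda>x. complex_of_real (V x) * w x * cnj (u x)) = (\<lambda>x. cnj (complex_of_real (V x) * u x * cnj (w x)))"
    by (simp add: ac_simps)
  show ?thesis
    unfolding dirichlet_form_def 1 2 Bochner_Integration.integral_cnj by simp
qed

lemma inner_L2_self: "inner_L2 S u u = complex_of_real (\<integral>x. (norm (u x))\<^sup>2 \<partial>lebesgue_on S)"
  unfolding inner_L2_def integral_complex_of_real[symmetric] by (simp add: complex_norm_square[symmetric] flip: of_real_power)

lemma sum_mult_cnj_self: "(\<Sum>i\<in>UNIV. z $ i * cnj (z $ i)) = complex_of_real ((norm (z :: complex ^ 'd::finite))\<^sup>2)"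
  by (simp add: norm_vec_def L2_set_def sum_nonneg complex_norm_square[symmetric] flip: of_real_power)

lemma dirichlet_form_self:
  "dirichlet_form S V u G u G = complex_of_real
    ((\<integral>x. (norm (G x))\<^sup>2 \<partial>lebesgue_on S) / 2 + (\<integral>x. V x * (norm (u x))\<^sup>2 \<partial>lebesgue_on S))"
proof -
  have "complex_of_real (V x) * u x * cnj (u x) = complex_of_real (V x * (norm (u x))\<^sup>2)" for x
    by (simp add: mult.assoc complex_norm_square[symmetric] flip: of_real_power)
  then show ?thesis
    unfolding dirichlet_form_def sum_mult_cnj_self by (simp only: integral_complex_of_real) simp
qed

context
  fixes S :: "(real ^ 'd::finite) set" and V :: "real ^ 'd \<Rightarrow> real"
  assumes S: "S \<in> sets borel" and V [measurable]: "V \<in> borel_measurable borel" and V0: "\<And>x. 0 \<le> V x"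
begin

text \<open>The square root turns the potential term into a product of two \<open>L2_on\<close>
  functions, so that sums in the form domain and integrability of mixed terms follow from the rules
  for \<open>L2_on\<close>.\<close>

lemma form_domD:
  assumes "form_dom S V u G"
  shows "L2_on S u" "L2_on S G" "L2_on S (\<lambda>x. complex_of_real (sqrt (V x)) * u x)"
proof -
  show L2: "L2_on S u" "L2_on S G" using assms by (auto simp: form_dom_def H10_def)
  note [measurable] = L2_on_measurable[OF L2(1)] borel_measurable_lebesgue_on[OF V, of S]
  have "(norm (complex_of_real (sqrt (V x)) * u x))\<^sup>2 = V x * (norm (u x))\<^sup>2" for x
    using V0 by (simp add: norm_mult power_mult_distrib)
  then show "L2_on S (\<lambda>x. complex_of_real (sqrt (V x)) * u x)"
    using assms by (simp add: L2_on_def form_dom_def) measurable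
qed

lemma form_dom_add:
  assumes "form_dom S V u G" "form_dom S V w H"
  shows "form_dom S V (\<lambda>x. u x + w x) (\<lambda>x. G x + H x)"
proof -
  have "L2_on S (\<lambda>x. complex_of_real (sqrt (V x)) * u x + complex_of_real (sqrt (V x)) * w x)"
    by (intro L2_on_add form_domD(3)[OF assms(1)] form_domD(3)[OF assms(2)])
  moreover have "(norm (complex_of_real (sqrt (V x)) * u x + complex_of_real (sqrt (V x)) * w x))\<^sup>2
      = V x * (norm (u x + w x))\<^sup>2" for x
    using V0 by (simp add: distrib_left[symmetric] norm_mult power_mult_distrib del: distrib_left_numeral)
  ultimately show ?thesis
    using assms H10_add[OF S] by (simp add: form_dom_def L2_on_def)
qed

lemma form_dom_scale:
  assumes "form_dom S V u G"
  shows "form_dom S V (\<lambda>x. c * u x) (\<lambda>x. c *s G x)"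
proof -
  have "V x * (norm (c * u x))\<^sup>2 = (norm c)\<^sup>2 * (V x * (norm (u x))\<^sup>2)" for x
    by (simp add: norm_mult power_mult_distrib ac_simps)
  then show ?thesis using assms unfolding form_dom_def by (simp only: H10_scale) simp
qed

lemma form_dom_sum:
  assumes "finite A" "A \<noteq> {}" "\<And>k. k \<in> A \<Longrightarrow> form_dom S V (u k) (G k)"
  shows "form_dom S V (\<lambda>x. \<Sum>k\<in>A. u k x) (\<lambda>x. \<Sum>k\<in>A. G k x)"
  using assms by (induction rule: finite_ne_induct) (auto intro: form_dom_add)

lemma inner_L2_add_left: "L2_on S u \<Longrightarrow> L2_on S u' \<Longrightarrow> L2_on S w \<Longrightarrow> inner_L2 S (\<lambda>x. u x + u' x) w = inner_L2 S u w + inner_L2 S u' w"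
  unfolding inner_L2_def by (simp add: distrib_right integrable_L2_mult)

lemma inner_L2_scale_left: "inner_L2 S (\<lambda>x. c * u x) w = c * inner_L2 S u w"
  unfolding inner_L2_def by (simp add: mult.assoc)

lemma integrable_form:
  assumes "form_dom S V u G" "form_dom S V w H"
  shows "integrable (lebesgue_on S) (\<lambda>x. \<Sum>i\<in>UNIV. G x $ i * cnj (H x $ i))"
    "integrable (lebesgue_on S) (\<lambda>x. complex_of_real (V x) * u x * cnj (w x))"
proof -
  show "integrable (lebesgue_on S) (\<lambda>x. \<Sum>i\<in>UNIV. G x $ i * cnj (H x $ i))"
    by (intro Bochner_Integration.integrable_sum integrable_L2_mult L2_on_nth form_domD(2)[OF assms(1)] form_domD(2)[OF assms(2)])
  have "(complex_of_real (sqrt (V x)) * u x) * cnj (complex_of_real (sqrt (V x)) * w x)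
      = complex_of_real (V x) * u x * cnj (w x)" for x
  proof -
    have "complex_of_real (V x) = complex_of_real (sqrt (V x)) * complex_of_real (sqrt (V x))"
      using V0[of x] by (simp flip: of_real_mult)
    then show ?thesis by (simp only: complex_cnj_mult complex_cnj_complex_of_real ac_simps)
  qed
  then show "integrable (lebesgue_on S) (\<lambda>x. complex_of_real (V x) * u x * cnj (w x))"
    using integrable_L2_mult[OF form_domD(3)[OF assms(1)] form_domD(3)[OF assms(2)]] by (simp only:)
qed

lemma dirichlet_form_add_left:
  assumes "form_dom S V u G" "form_dom S V u' G'" "form_dom S V w H"
  shows "dirichlet_form S V (\<lambda>x. u x + u' x) (\<lambda>x. G x + G' x) w H
    = dirichlet_form S V u G w H + dirichlet_form S V u' G' w H"
proof -
  have "(\<Sum>i\<in>UNIV. (G x + G' x) $ i * cnj (H x $ i))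
      = (\<Sum>i\<in>UNIV. G x $ i * cnj (H x $ i)) + (\<Sum>i\<in>UNIV. G' x $ i * cnj (H x $ i))" for x
    by (simp add: distrib_right sum.distrib)
  moreover have "complex_of_real (V x) * (u x + u' x) * cnj (w x)
      = complex_of_real (V x) * u x * cnj (w x) + complex_of_real (V x) * u' x * cnj (w x)" for x
    by (simp add: algebra_simps)
  ultimately show ?thesis
    unfolding dirichlet_form_def
    using integrable_form[OF assms(1,3)] integrable_form[OF assms(2,3)] by (simp add: distrib_left)
qed

lemma dirichlet_form_scale_left:
  "dirichlet_form S V (\<lambda>x. c * u x) (\<lambda>x. c *s G x) w H = c * dirichlet_form S V u G w H"
proof -
  have "(\<Sum>i\<in>UNIV. (c *s G x) $ i * cnj (H x $ i)) = c * (\<Sum>i\<in>UNIV. G x $ i * cnj (H x $ i))" for x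
    by (simp add: sum_distrib_left mult.assoc)
  moreover have "complex_of_real (V x) * (c * u x) * cnj (w x) = c * (complex_of_real (V x) * u x * cnj (w x))" for x
    by (simp only: ac_simps)
  ultimately show ?thesis unfolding dirichlet_form_def by (simp only: integral_mult_right_zero) (simp add: distrib_left)
qed

lemma inner_L2_sum_left:
  assumes "finite A" "A \<noteq> {}" "\<And>k. k \<in> A \<Longrightarrow> form_dom S V (u k) (G k)" "form_dom S V w H"
  shows "inner_L2 S (\<lambda>x. \<Sum>k\<in>A. u k x) w = (\<Sum>k\<in>A. inner_L2 S (u k) w)"
  using assms
proof (induction rule: finite_ne_induct)
  case (insert k A)
  have "form_dom S V (u k) (G k)" "form_dom S V (\<lambda>x. \<Sum>k\<in>A. u k x) (\<lambda>x. \<Sum>k\<in>A. G k x)"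
    using insert by (auto intro: form_dom_sum)
  from this[THEN form_domD(1)] form_domD(1)[OF insert.prems(2)] show ?case
    using insert by (simp add: inner_L2_add_left)
qed auto

lemma dirichlet_form_sum_left:
  assumes "finite A" "A \<noteq> {}" "\<And>k. k \<in> A \<Longrightarrow> form_dom S V (u k) (G k)" "form_dom S V w H"
  shows "dirichlet_form S V (\<lambda>x. \<Sum>k\<in>A. u k x) (\<lambda>x. \<Sum>k\<in>A. G k x) w H = (\<Sum>k\<in>A. dirichlet_form S V (u k) (G k) w H)"
  using assms
proof (induction rule: finite_ne_induct)
  case (insert k A)
  have "form_dom S V (u k) (G k)" "form_dom S V (\<lambda>x. \<Sum>k\<in>A. u k x) (\<lambda>x. \<Sum>k\<in>A. G k x)"
    using insert by (auto intro: form_dom_sum)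
  then show ?case using insert by (simp add: dirichlet_form_add_left)
qed auto

lemma eigenpair_linear_combination:
  assumes "finite A" "A \<noteq> {}" "\<And>k. k \<in> A \<Longrightarrow> eigenpair S V \<mu> (u k) (G k)"
  shows "eigenpair S V \<mu> (\<lambda>x. \<Sum>k\<in>A. c k * u k x) (\<lambda>x. \<Sum>k\<in>A. c k *s G k x)"
proof -
  have fd: "form_dom S V (\<lambda>x. c k * u k x) (\<lambda>x. c k *s G k x)" if "k \<in> A" for k
    using assms(3)[OF that] by (intro form_dom_scale) (auto simp: eigenpair_def)
  have "dirichlet_form S V (\<lambda>x. \<Sum>k\<in>A. c k * u k x) (\<lambda>x. \<Sum>k\<in>A. c k *s G k x) w H
      = complex_of_real \<mu> * inner_L2 S (\<lambda>x. \<Sum>k\<in>A. c k * u k x) w" if w: "form_dom S V w H" for w H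
    using assms(3) w
    by (simp add: dirichlet_form_sum_left[OF assms(1,2) fd w] inner_L2_sum_left[OF assms(1,2) fd w]
        dirichlet_form_scale_left inner_L2_scale_left sum_distrib_left eigenpair_def ac_simps)
  then show ?thesis using form_dom_sum[OF assms(1,2) fd] by (simp add: eigenpair_def)
qed

text \<open>Hermitian symmetry of the form: testing each eigenfunction with the other gives \<mu>
  and \<nu> times the same inner product.\<close>

lemma eigenpair_orthogonal:
  assumes "eigenpair S V \<mu> u G" "eigenpair S V \<nu> w H" "\<mu> \<noteq> \<nu>"
  shows "inner_L2 S u w = 0"
proof -
  have "dirichlet_form S V u G w H = complex_of_real \<mu> * inner_L2 S u w"
    "dirichlet_form S V w H u G = complex_of_real \<nu> * inner_L2 S w u" using assms by (auto simp: eigenpair_def)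
  then have "complex_of_real \<mu> * inner_L2 S u w = cnj (complex_of_real \<nu> * inner_L2 S w u)"
    by (metis cnj_dirichlet_form)
  also have "\<dots> = complex_of_real \<nu> * inner_L2 S u w" by (simp add: cnj_inner_L2)
  finally show ?thesis using assms(3) by simp
qed

text \<open>Pythagoras across distinct eigenvalues. Each eigenvalue equation is tested with the
  whole sum \<open>U\<close>, so that only inner products with \<open>U\<close> occur, and
  \<open>inner_U\<close> reduces these to the diagonal.\<close>

lemma energy_sum_eigenpairs:
  assumes "finite F" "F \<noteq> {}" "\<And>\<mu>. \<mu> \<in> F \<Longrightarrow> eigenpair S V \<mu> (u \<mu>) (G \<mu>)"
  defines "U \<equiv> (\<lambda>x. \<Sum>\<mu>\<in>F. u \<mu> x)" and "GU \<equiv> (\<lambda>x. \<Sum>\<mu>\<in>F. G \<mu> x)"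
  shows "form_dom S V U GU"
    "(\<integral>x. (norm (U x))\<^sup>2 \<partial>lebesgue_on S) = (\<Sum>\<mu>\<in>F. \<integral>x. (norm (u \<mu> x))\<^sup>2 \<partial>lebesgue_on S)"
    "(\<integral>x. (norm (GU x))\<^sup>2 \<partial>lebesgue_on S) / 2 + (\<integral>x. V x * (norm (U x))\<^sup>2 \<partial>lebesgue_on S)
      = (\<Sum>\<mu>\<in>F. \<mu> * (\<integral>x. (norm (u \<mu> x))\<^sup>2 \<partial>lebesgue_on S))"
proof -
  have fd: "form_dom S V (u \<mu>) (G \<mu>)" if "\<mu> \<in> F" for \<mu> using assms(3)[OF that] by (simp add: eigenpair_def)
  show U: "form_dom S V U GU" unfolding U_def GU_def by (rule form_dom_sum[OF assms(1,2) fd])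
  have inner_U: "inner_L2 S (u \<mu>) U = inner_L2 S (u \<mu>) (u \<mu>)" if \<mu>: "\<mu> \<in> F" for \<mu>
  proof -
    have "inner_L2 S U (u \<mu>) = (\<Sum>\<nu>\<in>F. inner_L2 S (u \<nu>) (u \<mu>))"
      unfolding U_def by (rule inner_L2_sum_left[OF assms(1,2) fd fd[OF \<mu>]])
    also have "\<dots> = (\<Sum>\<nu>\<in>F. if \<nu> = \<mu> then inner_L2 S (u \<mu>) (u \<mu>) else 0)"
      using eigenpair_orthogonal[OF assms(3) assms(3)[OF \<mu>]] by (intro sum.cong) auto
    also have "\<dots> = inner_L2 S (u \<mu>) (u \<mu>)" using \<mu> assms(1) by simp
    finally show ?thesis by (metis cnj_inner_L2)
  qed
  have "inner_L2 S U U = (\<Sum>\<mu>\<in>F. inner_L2 S (u \<mu>) U)"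
    by (subst U_def) (rule inner_L2_sum_left[OF assms(1,2) fd U])
  also have "\<dots> = (\<Sum>\<mu>\<in>F. inner_L2 S (u \<mu>) (u \<mu>))" using inner_U by simp
  finally have "complex_of_real (\<integral>x. (norm (U x))\<^sup>2 \<partial>lebesgue_on S)
      = complex_of_real (\<Sum>\<mu>\<in>F. \<integral>x. (norm (u \<mu> x))\<^sup>2 \<partial>lebesgue_on S)" by (simp add: inner_L2_self)
  then show "(\<integral>x. (norm (U x))\<^sup>2 \<partial>lebesgue_on S) = (\<Sum>\<mu>\<in>F. \<integral>x. (norm (u \<mu> x))\<^sup>2 \<partial>lebesgue_on S)"
    by (simp only: of_real_eq_iff)
  have "dirichlet_form S V U GU U GU = (\<Sum>\<mu>\<in>F. dirichlet_form S V (u \<mu>) (G \<mu>) U GU)"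
    using dirichlet_form_sum_left[OF assms(1,2) fd U] by (simp add: U_def GU_def)
  also have "\<dots> = (\<Sum>\<mu>\<in>F. complex_of_real \<mu> * inner_L2 S (u \<mu>) (u \<mu>))"
    using assms(3) U inner_U by (intro sum.cong) (auto simp: eigenpair_def)
  finally have "complex_of_real ((\<integral>x. (norm (GU x))\<^sup>2 \<partial>lebesgue_on S) / 2 + (\<integral>x. V x * (norm (U x))\<^sup>2 \<partial>lebesgue_on S))
      = complex_of_real (\<Sum>\<mu>\<in>F. \<mu> * (\<integral>x. (norm (u \<mu> x))\<^sup>2 \<partial>lebesgue_on S))"
    unfolding dirichlet_form_self by (simp add: inner_L2_self)
  then show "(\<integral>x. (norm (GU x))\<^sup>2 \<partial>lebesgue_on S) / 2 + (\<integral>x. V x * (norm (U x))\<^sup>2 \<partial>lebesgue_on S)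
      = (\<Sum>\<mu>\<in>F. \<mu> * (\<integral>x. (norm (u \<mu> x))\<^sup>2 \<partial>lebesgue_on S))"
    by (simp only: of_real_eq_iff)
qed

end

section \<open>Counting eigenvalues\<close>

text \<open>Gaussian elimination by induction on the equations: an unknown with nonzero coefficient
  in the new equation is expressed by the others and substituted into the remaining
  equations.\<close>

lemma homogeneous_system_nontrivial_solution:
  fixes a :: "'i \<Rightarrow> 'j \<Rightarrow> 'k::field"
  assumes "finite I" "finite J" "card I < card J"
  shows "\<exists>c. (\<exists>j\<in>J. c j \<noteq> 0) \<and> (\<forall>i\<in>I. (\<Sum>j\<in>J. a i j * c j) = 0)"
  using assms
proof (induction I arbitrary: J a rule: finite_induct)
  case empty
  then obtain j where "j \<in> J" by (metis card.empty card_gt_0_iff ex_in_conv)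
  then show ?case by (intro exI[of _ "\<lambda>_. 1"]) auto
next
  case (insert i I)
  show ?case
  proof (cases "\<forall>j\<in>J. a i j = 0")
    case True
    have "card I < card J" using insert by simp
    from insert.IH[OF insert.prems(1) this, of a] obtain c where
      "(\<exists>j\<in>J. c j \<noteq> 0) \<and> (\<forall>i\<in>I. (\<Sum>j\<in>J. a i j * c j) = 0)" by blast
    then show ?thesis using True by (intro exI[of _ c]) auto
  next
    case False
    then obtain k where k: "k \<in> J" "a i k \<noteq> 0" by blast
    define J' where "J' = J - {k}"
    have J': "finite J'" "J = insert k J'" "k \<notin> J'" "card I < card J'"
      using insert k by (auto simp: J'_def)
    from insert.IH[OF J'(1,4), of "\<lambda>i' j. a i' j - a i' k * a i j / a i k"]
    obtain c where c: "\<exists>j\<in>J'. c j \<noteq> 0"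
      "\<And>i'. i' \<in> I \<Longrightarrow> (\<Sum>j\<in>J'. (a i' j - a i' k * a i j / a i k) * c j) = 0" by blast
    define s where "s = (\<Sum>j\<in>J'. a i j * c j)"
    \<comment> \<open>The value at \<open>k\<close> is forced by equation \<open>i\<close>.\<close>
    define c' where "c' = (\<lambda>j. if j = k then - s / a i k else c j)"
    have sum: "(\<Sum>j\<in>J. a i' j * c' j) = a i' k * (- s / a i k) + (\<Sum>j\<in>J'. a i' j * c j)" for i'
    proof -
      have "(\<Sum>j\<in>J'. a i' j * c' j) = (\<Sum>j\<in>J'. a i' j * c j)"
        using J'(3) by (intro sum.cong) (auto simp: c'_def)
      then show ?thesis unfolding J'(2) using J'(1,3) by (simp add: c'_def)
    qed
    have "(\<Sum>j\<in>J. a i' j * c' j) = 0" if "i' \<in> I" for i'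
      using c(2)[OF that] unfolding sum s_def
      by (simp add: algebra_simps sum_subtractf sum_distrib_left sum_divide_distrib)
    moreover have "(\<Sum>j\<in>J. a i j * c' j) = 0" unfolding sum using k(2) by (simp add: s_def)
    moreover have "\<exists>j\<in>J. c' j \<noteq> 0" using c(1) J' by (auto simp: c'_def)
    ultimately show ?thesis by blast
  qed
qed

text \<open>Names the condition under the supremum in \<open>eigen_mult\<close>.\<close>

definition independent_eigenfunctions ::
  "(real ^ 'd::finite) set \<Rightarrow> (real ^ 'd \<Rightarrow> real) \<Rightarrow> real \<Rightarrow> nat \<Rightarrow> (nat \<Rightarrow> real ^ 'd \<Rightarrow> complex) \<Rightarrow> bool" where
  "independent_eigenfunctions S V \<mu> n u \<longleftrightarrow> (\<forall>i<n. u i \<in> eigenspace S V \<mu>) \<and>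
     (\<forall>c :: nat \<Rightarrow> complex. (AE x in lebesgue_on S. (\<Sum>i<n. c i * u i x) = 0) \<longrightarrow> (\<forall>i<n. c i = 0))"

lemma eigen_mult_eq: "eigen_mult S V \<mu> = Sup (enat ` {n. \<exists>u. independent_eigenfunctions S V \<mu> n u})"
  unfolding eigen_mult_def independent_eigenfunctions_def by (rule arg_cong[of _ _ Sup]) auto

section \<open>Bounding the eigenvalue count by the number of bad cells\<close>

context
  fixes S :: "(real ^ 'd::finite) set" and V W :: "real ^ 'd \<Rightarrow> real" and R \<eta> E :: real
    and J J' :: "('d \<Rightarrow> int) set"
  assumes S: "S \<in> sets borel" and V [measurable]: "V \<in> borel_measurable borel" and V0: "\<And>x. 0 \<le> V x"
    and W [measurable]: "W \<in> borel_measurable borel" and W01: "\<And>x. 0 \<le> W x" "\<And>x. W x \<le> 1"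
    and WV: "\<And>x. W x \<le> V x"
    and R: "1 \<le> R" and J: "finite J" "S \<subseteq> (\<Union>j\<in>J. cell R j)" "J' \<subseteq> J"
    and \<eta>: "0 < \<eta>" "\<eta> \<le> 1"
    and good: "\<And>j. j \<in> J - J' \<Longrightarrow> \<eta> * R ^ CARD('d) \<le> (LINT x:cell R j|lborel. W x)"
    and E: "16 * (CARD('d) * 2 ^ CARD('d) * R\<^sup>2) * E < \<eta>"
begin

text \<open>With more eigenfunctions than bad cells, some nontrivial combination \<open>w\<close>
  integrates to zero over each bad cell. Its squared norm \<open>X\<close> satisfies
  \<open>\<eta> * X \<le> 16 * C * E * X\<close>, and the hypothesis on \<open>E\<close> forces
  \<open>X = 0\<close>. Orthogonality between eigenvalues and independence within each eigenspace
  then annihilate all coefficients.\<close>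

lemma independent_eigenfunctions_sum_le_pos:
  assumes F: "finite F" "F \<noteq> {}" "F \<subseteq> {..E}"
    and n: "\<And>\<mu>. \<mu> \<in> F \<Longrightarrow> 0 < n \<mu>"
    and u: "\<And>\<mu>. \<mu> \<in> F \<Longrightarrow> independent_eigenfunctions S V \<mu> (n \<mu>) (u \<mu>)"
  shows "(\<Sum>\<mu>\<in>F. n \<mu>) \<le> card J'"
proof (rule ccontr)
  assume larger: "\<not> (\<Sum>\<mu>\<in>F. n \<mu>) \<le> card J'"
  \<comment> \<open>One unknown for each eigenfunction, one equation for each bad cell.\<close>
  define P where "P = (SIGMA \<mu>:F. {..<n \<mu>})"
  have P: "finite P" "card J' < card P"
    using F(1) larger by (auto simp: P_def)
  define a where "a j p = cell_integral S R j (u (fst p) (snd p))" for j p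
  have finJ': "finite J'" using J finite_subset by blast
  obtain c :: "real \<times> nat \<Rightarrow> complex" where c: "\<exists>p\<in>P. c p \<noteq> 0" "\<And>j. j \<in> J' \<Longrightarrow> (\<Sum>p\<in>P. a j p * c p) = 0"
    using homogeneous_system_nontrivial_solution[OF finJ' P, of a] by blast
  have "\<forall>\<mu>\<in>F. \<forall>k<n \<mu>. \<exists>G. eigenpair S V \<mu> (u \<mu> k) G"
    using u unfolding independent_eigenfunctions_def by (intro ballI allI impI eigenspace_eigenpair) blast
  then obtain G where G: "\<And>\<mu> k. \<mu> \<in> F \<Longrightarrow> k < n \<mu> \<Longrightarrow> eigenpair S V \<mu> (u \<mu> k) (G \<mu> k)" by metis
  define U where "U \<mu> x = (\<Sum>k<n \<mu>. c (\<mu>, k) * u \<mu> k x)" for \<mu> x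
  define GU where "GU \<mu> x = (\<Sum>k<n \<mu>. c (\<mu>, k) *s G \<mu> k x)" for \<mu> x
  have EU: "eigenpair S V \<mu> (U \<mu>) (GU \<mu>)" if "\<mu> \<in> F" for \<mu>
    unfolding U_def GU_def
    using n[OF that] G[OF that] by (intro eigenpair_linear_combination[OF S V V0]) auto
  define w where "w x = (\<Sum>\<mu>\<in>F. U \<mu> x)" for x
  define Gw where "Gw x = (\<Sum>\<mu>\<in>F. GU \<mu> x)" for x
  define N where "N \<mu> = (\<integral>x. (norm (U \<mu> x))\<^sup>2 \<partial>lebesgue_on S)" for \<mu>
  define X where "X = (\<integral>x. (norm (w x))\<^sup>2 \<partial>lebesgue_on S)"
  note energy = energy_sum_eigenpairs[OF S V V0 F(1,2), of U GU, folded w_def[abs_def] Gw_def[abs_def], OF EU]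
  have fd: "form_dom S V w Gw" using energy(1) by (simp add: w_def[abs_def] Gw_def[abs_def])
  have XN: "X = (\<Sum>\<mu>\<in>F. N \<mu>)"
    using energy(2) by (simp add: X_def N_def[abs_def] w_def[abs_def])
  define Q where "Q = (\<integral>x. (norm (Gw x))\<^sup>2 \<partial>lebesgue_on S) / 2 + (\<integral>x. V x * (norm (w x))\<^sup>2 \<partial>lebesgue_on S)"
  have QN: "Q = (\<Sum>\<mu>\<in>F. \<mu> * N \<mu>)"
    using energy(3) by (simp add: Q_def N_def[abs_def] w_def[abs_def] Gw_def[abs_def])
  have N0: "0 \<le> N \<mu>" for \<mu> by (simp add: N_def)
  have mean0: "cell_integral S R j w = 0" if j: "j \<in> J'" for j
  proof -
    have rd: "0 < R ^ CARD('d)" using R by simp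
    have meas: "cell R j \<inter> S \<in> sets (lebesgue_on S)" "emeasure (lebesgue_on S) (cell R j \<inter> S) \<le> ennreal (R ^ CARD('d))"
      using emeasure_lebesgue_on_cell_le[OF S, of R j] R by auto
    have int: "integrable (lebesgue_on S) (\<lambda>x. indicator (cell R j \<inter> S) x *\<^sub>R u \<mu> k x)" if "\<mu> \<in> F" "k < n \<mu>" for \<mu> k
    proof -
      have "L2_on S (u \<mu> k)" using G[OF that] form_domD(1)[OF S V V0] by (auto simp: eigenpair_def)
      then show ?thesis
        by (intro Cauchy_Schwarz_finite_measure(1)[OF meas rd] L2_on_measurable L2_on_integrable)
    qed
    have int': "integrable (lebesgue_on S) (\<lambda>x. c (\<mu>, k) * (indicator (cell R j \<inter> S) x *\<^sub>R u \<mu> k x))"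
      if "\<mu> \<in> F" "k < n \<mu>" for \<mu> k
      using int[OF that] by (rule integrable_mult_right)
    have "cell_integral S R j w = (\<integral>x. (\<Sum>\<mu>\<in>F. \<Sum>k<n \<mu>. c (\<mu>, k) * (indicator (cell R j \<inter> S) x *\<^sub>R u \<mu> k x)) \<partial>lebesgue_on S)"
      by (simp add: w_def U_def scaleR_sum_right)
    also have "\<dots> = (\<Sum>\<mu>\<in>F. \<integral>x. (\<Sum>k<n \<mu>. c (\<mu>, k) * (indicator (cell R j \<inter> S) x *\<^sub>R u \<mu> k x)) \<partial>lebesgue_on S)"
      by (intro Bochner_Integration.integral_sum Bochner_Integration.integrable_sum int') auto
    also have "\<dots> = (\<Sum>\<mu>\<in>F. \<Sum>k<n \<mu>. \<integral>x. c (\<mu>, k) * (indicator (cell R j \<inter> S) x *\<^sub>R u \<mu> k x) \<partial>lebesgue_on S)"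
      by (intro sum.cong refl Bochner_Integration.integral_sum int') auto
    also have "\<dots> = (\<Sum>\<mu>\<in>F. \<Sum>k<n \<mu>. c (\<mu>, k) * cell_integral S R j (u \<mu> k))"
      by (simp only: integral_mult_right_zero)
    also have "\<dots> = (\<Sum>p\<in>P. a j p * c p)"
      unfolding P_def using F(1) by (subst sum.Sigma) (auto simp: a_def case_prod_beta mult.commute)
    finally show ?thesis using c(2)[OF j] by simp
  qed
  define C where "C = CARD('d) * 2 ^ CARD('d) * R\<^sup>2"
  have "1 \<le> real CARD('d)" "(1::real) \<le> 2 ^ CARD('d)" by (simp_all add: Suc_le_eq)
  then have "1 \<le> real CARD('d) * 2 ^ CARD('d)" using mult_mono[of 1 "real CARD('d)" 1 "2 ^ CARD('d)"] by simp
  then have C: "1 \<le> C" unfolding C_def using mult_mono[of 1 "real CARD('d) * 2 ^ CARD('d)" 1 "R\<^sup>2"] R by simp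
  have H: "H10 S w Gw" using fd by (simp add: form_dom_def)
  have L2w: "L2_on S w" using form_domD(1)[OF S V V0 fd] .
  have intV: "integrable (lebesgue_on S) (\<lambda>x. V x * (norm (w x))\<^sup>2)" using fd by (simp add: form_dom_def)
  have "integrable (lebesgue_on S) (\<lambda>x. W x * (norm (w x))\<^sup>2)"
  proof (rule Bochner_Integration.integrable_bound[OF intV])
    note [measurable] = L2_on_measurable[OF L2w] borel_measurable_lebesgue_on[OF W, of S]
    show "(\<lambda>x. W x * (norm (w x))\<^sup>2) \<in> borel_measurable (lebesgue_on S)" by measurable
  qed (use W01 WV V0 in \<open>auto intro!: mult_right_mono\<close>)
  then have WVle: "(\<integral>x. W x * (norm (w x))\<^sup>2 \<partial>lebesgue_on S) \<le> (\<integral>x. V x * (norm (w x))\<^sup>2 \<partial>lebesgue_on S)"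
    using intV WV by (intro integral_mono mult_right_mono) auto
  have V0': "0 \<le> (\<integral>x. V x * (norm (w x))\<^sup>2 \<partial>lebesgue_on S)"
    using V0 by (intro integral_nonneg_AE) auto
  have "\<eta> * X \<le> 8 * (\<integral>x. W x * (norm (w x))\<^sup>2 \<partial>lebesgue_on S) + 8 * C * (\<integral>x. (norm (Gw x))\<^sup>2 \<partial>lebesgue_on S)"
    unfolding X_def C_def using R by (intro H10_cells_inequality[OF H S _ J W W01 \<eta> good mean0]) auto
  also have "\<dots> \<le> 8 * (\<integral>x. V x * (norm (w x))\<^sup>2 \<partial>lebesgue_on S) + 8 * C * (\<integral>x. (norm (Gw x))\<^sup>2 \<partial>lebesgue_on S)"
    using WVle by simp
  \<comment> \<open>The kinetic part of \<open>Q\<close> carries the factor 1/2, which turns 8 into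
    16. The potential part needs \<open>8 \<le> 16 * C\<close>, which holds by
    \<open>1 \<le> C\<close> and so rests on \<open>1 \<le> R\<close>.\<close>
  also have "\<dots> \<le> (16 * C) * Q"
  proof -
    have "8 * (\<integral>x. V x * (norm (w x))\<^sup>2 \<partial>lebesgue_on S) \<le> (16 * C) * (\<integral>x. V x * (norm (w x))\<^sup>2 \<partial>lebesgue_on S)"
      using C V0' by (intro mult_right_mono) auto
    then show ?thesis by (simp add: Q_def algebra_simps)
  qed
  also have "\<dots> \<le> (16 * C) * (E * X)"
  proof -
    have "Q \<le> E * X"
      unfolding QN XN sum_distrib_left using F(3) N0 by (intro sum_mono mult_right_mono) auto
    then show ?thesis using C by (intro mult_left_mono) auto
  qed
  finally have "(\<eta> - 16 * C * E) * X \<le> 0" by (simp add: algebra_simps)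
  moreover have "0 < \<eta> - 16 * C * E" using E by (simp add: C_def)
  ultimately have "X \<le> 0" by (simp add: mult_le_0_iff)
  then have "(\<Sum>\<mu>\<in>F. N \<mu>) = 0" using XN N0 by (metis antisym sum_nonneg)
  then have Nz: "N \<mu> = 0" if "\<mu> \<in> F" for \<mu> using that F(1) N0 by (simp add: sum_nonneg_eq_0_iff)
  have "c (\<mu>, k) = 0" if \<mu>: "\<mu> \<in> F" and k: "k < n \<mu>" for \<mu> k
  proof -
    have "L2_on S (U \<mu>)" using EU[OF \<mu>] form_domD(1)[OF S V V0] by (auto simp: eigenpair_def)
    then have "AE x in lebesgue_on S. (norm (U \<mu> x))\<^sup>2 = 0"
      using Nz[OF \<mu>] unfolding N_def by (subst (asm) integral_nonneg_eq_0_iff_AE) (auto simp: L2_on_integrable)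
    then have "AE x in lebesgue_on S. (\<Sum>k<n \<mu>. c (\<mu>, k) * u \<mu> k x) = 0" by (simp add: U_def)
    then show ?thesis
      using k conjunct2[OF u[OF \<mu>, unfolded independent_eigenfunctions_def], THEN spec, of "\<lambda>k. c (\<mu>, k)"] by simp
  qed
  then show False using c(1) by (auto simp: P_def)
qed

lemma independent_eigenfunctions_sum_le:
  assumes F: "finite F" "F \<subseteq> {..E}"
    and u: "\<And>\<mu>. \<mu> \<in> F \<Longrightarrow> \<exists>u. independent_eigenfunctions S V \<mu> (n \<mu>) u"
  shows "(\<Sum>\<mu>\<in>F. n \<mu>) \<le> card J'"
proof -
  \<comment> \<open>Energies with \<open>n \<mu> = 0\<close> add nothing to the sum and are set
    aside, because \<open>eigenpair_linear_combination\<close> asks for a nonempty index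
    set.\<close>
  define F' where "F' = {\<mu>\<in>F. 0 < n \<mu>}"
  have "(\<Sum>\<mu>\<in>F. n \<mu>) = (\<Sum>\<mu>\<in>F'. n \<mu>)"
    using F(1) by (intro sum.mono_neutral_right) (auto simp: F'_def)
  moreover obtain u where "\<And>\<mu>. \<mu> \<in> F \<Longrightarrow> independent_eigenfunctions S V \<mu> (n \<mu>) (u \<mu>)"
    using u by metis
  then have "(\<Sum>\<mu>\<in>F'. n \<mu>) \<le> card J'" if "F' \<noteq> {}"
    using F that by (intro independent_eigenfunctions_sum_le_pos) (auto simp: F'_def)
  ultimately show ?thesis by (cases "F' = {}") auto
qed

theorem eigen_count_le: "eigen_count S V E \<le> enat (card J')"
proof -
  \<comment> \<open>The admissible sizes are bounded by \<open>card J'\<close> and include 0, so the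
    supremum is a maximum: each multiplicity is finite and attained by an independent
    family.\<close>
  have "\<exists>n. eigen_mult S V \<mu> = enat n \<and> (\<exists>u. independent_eigenfunctions S V \<mu> n u)" if "\<mu> \<le> E" for \<mu>
  proof -
    define A where "A = {n. \<exists>u. independent_eigenfunctions S V \<mu> n u}"
    have "n \<le> card J'" if "n \<in> A" for n
      using independent_eigenfunctions_sum_le[of "{\<mu>}" "\<lambda>_. n"] that \<open>\<mu> \<le> E\<close> by (auto simp: A_def)
    then have "finite A" by (meson finite_nat_set_iff_bounded_le)
    moreover have "0 \<in> A" by (simp add: A_def independent_eigenfunctions_def)
    ultimately have "Sup (enat ` A) \<in> enat ` A"
      by (auto simp: Sup_enat_def intro!: Max_in)
    then show ?thesis by (auto simp: eigen_mult_eq A_def)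
  qed
  then obtain n where n: "\<And>\<mu>. \<mu> \<le> E \<Longrightarrow> eigen_mult S V \<mu> = enat (n \<mu>)"
    "\<And>\<mu>. \<mu> \<le> E \<Longrightarrow> \<exists>u. independent_eigenfunctions S V \<mu> (n \<mu>) u" by metis
  have "(\<Sum>\<mu>\<in>F. eigen_mult S V \<mu>) \<le> enat (card J')" if F: "finite F" "F \<subseteq> {..E}" for F
  proof -
    have "(\<Sum>\<mu>\<in>F. eigen_mult S V \<mu>) = (\<Sum>\<mu>\<in>F. enat (n \<mu>))" using F(2) n by (intro sum.cong) auto
    also have "\<dots> = enat (\<Sum>\<mu>\<in>F. n \<mu>)"
      using F(1) by (induction rule: finite_induct) (auto simp: zero_enat_def)
    also have "\<dots> \<le> enat (card J')" using independent_eigenfunctions_sum_le[OF F, of n] n(2) F(2) by auto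
    finally show ?thesis .
  qed
  then show ?thesis unfolding eigen_count_def by (intro SUP_least) auto
qed

end

text \<open>\<open>nth_eigenvalue\<close> is an infimum, so a value at most \<open>E\<close> only
  yields counts at energies slightly above \<open>E\<close>; the gap between \<open>E\<close> and
  \<open>E'\<close> absorbs this.\<close>

lemma ids_le:
  fixes V :: "real ^ 'd::finite \<Rightarrow> real"
  assumes l: "1 \<le> l" and "eigen_count (cube l) V E' \<le> enat K" and "E < E'"
  shows "ids l V E \<le> ennreal (real K / real l ^ CARD('d))"
proof -
  have "i \<le> K" if "nth_eigenvalue (cube l) V i \<le> ereal E" for i
  proof -
    have "nth_eigenvalue (cube l) V i < ereal E'" using that assms(3) by (simp add: order_le_less_trans)
    then obtain \<mu> where \<mu>: "\<mu> < E'" "enat i \<le> eigen_count (cube l) V \<mu>"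
      unfolding nth_eigenvalue_def by (auto simp: Inf_less_iff)
    note \<mu>(2)
    also have "eigen_count (cube l) V \<mu> \<le> eigen_count (cube l) V E'"
      unfolding eigen_count_def using \<mu>(1) by (intro SUP_subset_mono) (auto intro: order_trans)
    also note assms(2)
    finally show ?thesis by simp
  qed
  then have "{i::nat. 1 \<le> i \<and> nth_eigenvalue (cube l) V i \<le> ereal E} \<subseteq> {1..K}" by auto
  then have "emeasure (count_space UNIV) {i::nat. 1 \<le> i \<and> nth_eigenvalue (cube l) V i \<le> ereal E}
      \<le> emeasure (count_space UNIV) {1..K}" by (intro emeasure_mono) auto
  also have "\<dots> = ennreal (real K)" by (simp add: emeasure_count_space ennreal_of_nat_eq_real_of_nat)
  finally show ?thesis
    using l unfolding ids_def by (subst divide_ennreal[symmetric]) (auto intro!: divide_right_mono_ennreal)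
qed

section \<open>Probability of bad cells\<close>

lemma space_generated_sigma [simp]: "space (generated_sigma M v D) = space M"
  unfolding generated_sigma_def by (rule space_measure_of) auto

lemma measurable_generated_sigma:
  assumes "x \<in> D"
  shows "(\<lambda>\<omega>. v \<omega> x) \<in> borel_measurable (generated_sigma M v D)"
proof (rule measurableI)
  fix B :: "real set" assume "B \<in> sets borel"
  then have "(\<lambda>\<omega>. v \<omega> x) -` B \<inter> space M \<in> {(\<lambda>\<omega>. v \<omega> x) -` B \<inter> space M | x B. x \<in> D \<and> B \<in> sets borel}"
    using assms by blast
  then show "(\<lambda>\<omega>. v \<omega> x) -` B \<inter> space (generated_sigma M v D) \<in> sets (generated_sigma M v D)"
    unfolding space_generated_sigma unfolding generated_sigma_def by (intro in_measure_of) auto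
qed auto

definition lattice_point :: "real \<Rightarrow> ('d::finite \<Rightarrow> int) \<Rightarrow> real ^ 'd" where
  "lattice_point R j = (\<chi> k. R * of_int (j k))"

lemma lattice_point_add: "lattice_point R (\<lambda>k. i k + j k) = lattice_point R i + lattice_point R j"
  by (simp add: lattice_point_def vec_eq_iff distrib_left)

lemma cell_translate: "x + lattice_point R j \<in> cell R j \<longleftrightarrow> x \<in> cell R (\<lambda>_. 0)"
  by (auto simp: cell_def lattice_point_def algebra_simps)

lemma set_integral_cell_translate:
  fixes g :: "real ^ 'd::finite \<Rightarrow> real"
  assumes [measurable]: "g \<in> borel_measurable borel"
  shows "(LINT x:cell R j|lborel. g x) = (LINT x:cell R (\<lambda>_. 0)|lborel. g (x + lattice_point R j))"
proof -
  have "(LINT x:cell R j|lborel. g x) = (\<integral>x. indicator (cell R j) x *\<^sub>R g x \<partial>distr lborel borel ((+) (lattice_point R j)))"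
    by (simp add: lborel_distr_plus set_lebesgue_integral_def)
  also have "\<dots> = (\<integral>x. indicator (cell R j) (lattice_point R j + x) *\<^sub>R g (lattice_point R j + x) \<partial>lborel)"
    by (intro integral_distr) auto
  also have "\<dots> = (LINT x:cell R (\<lambda>_. 0)|lborel. g (x + lattice_point R j))"
    unfolding set_lebesgue_integral_def
    by (intro Bochner_Integration.integral_cong) (auto simp: indicator_def cell_translate add.commute[of "lattice_point R j"])
  finally show ?thesis .
qed

definition subcells :: "nat \<Rightarrow> ('d::finite \<Rightarrow> int) set" where
  "subcells N = (\<Pi>\<^sub>E k\<in>UNIV. {0..<int N})"

lemma finite_subcells [simp]: "finite (subcells N)"
  by (simp add: subcells_def finite_PiE)

lemma card_subcells: "card (subcells N :: ('d::finite \<Rightarrow> int) set) = N ^ CARD('d)"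
  by (simp add: subcells_def card_PiE)

lemma cell_eq_Union_subcells:
  assumes "0 < L"
  shows "cell (real N * L) (\<lambda>_. 0) = (\<Union>j\<in>subcells N. cell L j)"
proof (intro equalityI subsetI)
  fix x :: "real ^ 'd" assume x: "x \<in> cell (real N * L) (\<lambda>_. 0)"
  have "0 \<le> \<lfloor>x $ k / L\<rfloor> \<and> \<lfloor>x $ k / L\<rfloor> < int N" for k
    using x assms by (auto simp: cell_def floor_less_iff pos_divide_less_eq)
  then have "(\<lambda>k. \<lfloor>x $ k / L\<rfloor>) \<in> subcells N" by (simp add: subcells_def PiE_iff)
  then show "x \<in> (\<Union>j\<in>subcells N. cell L j)" using mem_cell_iff[OF assms] by blast
next
  fix x :: "real ^ 'd" assume "x \<in> (\<Union>j\<in>subcells N. cell L j)"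
  then obtain j where j: "\<forall>k. 0 \<le> j k \<and> j k < int N" "x \<in> cell L j" by (auto simp: subcells_def PiE_iff)
  have "0 \<le> x $ k \<and> x $ k < real N * L" for k
  proof -
    have "0 \<le> L * real_of_int (j k)" using j(1) assms by simp
    moreover have "real_of_int (j k + 1) \<le> real_of_int (int N)" using spec[OF j(1), of k] unfolding of_int_le_iff by simp
    then have "L * (real_of_int (j k) + 1) \<le> L * real N" using assms by (intro mult_left_mono) auto
    moreover have "L * real_of_int (j k) \<le> x $ k" "x $ k < L * (real_of_int (j k) + 1)" using j(2) by (auto simp: cell_def)
    ultimately show ?thesis by (simp add: mult.commute)
  qed
  then show "x \<in> cell (real N * L) (\<lambda>_. 0)" by (simp add: cell_def)
qed

text \<open>Distinct indices differ by at least 1 in some coordinate. The shift \<open>x\<close> is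
  arbitrary, so every translate of the lattice is a set of separated points to which mixing
  applies.\<close>

lemma dist_lattice_point_ge:
  assumes "0 < L" "i \<noteq> j"
  shows "L \<le> dist (x + lattice_point L i) (x + lattice_point L j)"
proof -
  obtain k where k: "i k \<noteq> j k" using assms by blast
  then have "1 \<le> \<bar>i k - j k\<bar>" by simp
  then have "1 \<le> \<bar>real_of_int (i k) - real_of_int (j k)\<bar>" by (metis of_int_1_le_iff of_int_abs of_int_diff)
  then have "L \<le> L * \<bar>real_of_int (i k) - real_of_int (j k)\<bar>" using assms by simp
  also have "\<dots> = \<bar>(lattice_point L i - lattice_point L j) $ k\<bar>"
    using assms by (simp add: lattice_point_def right_diff_distrib[symmetric] abs_mult)
  also have "\<dots> \<le> norm (lattice_point L i - lattice_point L j)" by (rule component_le_norm_cart)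
  finally show ?thesis by (simp add: dist_norm)
qed

section \<open>Exponential moments of the truncated field\<close>

context random_potential
begin

text \<open>The cap at 1 keeps the field below \<open>v\<close>, gives a weight with values in [0,1]
  as the cell inequalities demand, and preserves the event that the field vanishes at a
  point.\<close>

definition truncated :: "'w \<Rightarrow> real ^ 'd \<Rightarrow> real" where
  "truncated \<omega> x = min (v \<omega> x) 1"

definition bad_cell :: "real \<Rightarrow> real \<Rightarrow> ('d \<Rightarrow> int) \<Rightarrow> 'w set" where
  "bad_cell \<eta> R j = {\<omega>\<in>space M. (LINT x:cell R j|lborel. truncated \<omega> x) < \<eta> * R ^ CARD('d)}"

lemma measurable_truncated_pair [measurable]:
  "(\<lambda>(\<omega>, x). truncated \<omega> x) \<in> borel_measurable (M \<Otimes>\<^sub>M borel)"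
  using measurable_potential unfolding truncated_def by (simp add: case_prod_beta')

lemma measurable_truncated_pair_lborel [measurable]:
  "(\<lambda>(\<omega>, x). truncated \<omega> x) \<in> borel_measurable (M \<Otimes>\<^sub>M lborel)"
  using measurable_truncated_pair by (simp cong: measurable_cong_sets sets_pair_measure_cong)

lemma measurable_potential_path: "\<omega> \<in> space M \<Longrightarrow> v \<omega> \<in> borel_measurable borel"
  using measurable_Pair2[OF measurable_potential] by simp

lemma measurable_truncated_path: "\<omega> \<in> space M \<Longrightarrow> truncated \<omega> \<in> borel_measurable borel"
  using measurable_Pair2[OF measurable_truncated_pair] by simp

lemma measurable_truncated_point [measurable]: "(\<lambda>\<omega>. truncated \<omega> x) \<in> borel_measurable M"
  using measurable_Pair1[OF measurable_truncated_pair, of x] by simp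

lemma truncated_nonneg: "\<omega> \<in> space M \<Longrightarrow> 0 \<le> truncated \<omega> x"
  and truncated_le_1: "truncated \<omega> x \<le> 1"
  and truncated_le: "truncated \<omega> x \<le> v \<omega> x"
  using nonneg by (auto simp: truncated_def)

lemma sets_bad_cell [measurable]: "bad_cell \<eta> R j \<in> sets M"
  unfolding bad_cell_def set_lebesgue_integral_def by measurable

lemma exp_truncated_bounds:
  assumes "\<omega> \<in> space M"
  shows "0 < exp (- truncated \<omega> x)" "exp (- truncated \<omega> x) \<le> 1"
  using truncated_nonneg[OF assms] by auto

lemma integrable_exp_truncated: "integrable M (\<lambda>\<omega>. \<Prod>x\<in>X. exp (- truncated \<omega> x))"
proof (rule integrable_const_bound[of _ 1])
  have "norm (\<Prod>x\<in>X. exp (- truncated \<omega> x)) \<le> 1" if "\<omega> \<in> space M" for \<omega>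
    using exp_truncated_bounds(2)[OF that] by (auto simp: abs_prod intro!: prod_le_1)
  then show "AE \<omega> in M. norm (\<Prod>x\<in>X. exp (- truncated \<omega> x)) \<le> 1" by (rule AE_I2)
qed measurable

text \<open>Laplace transform at 1 of the truncated field at the origin; by stationarity every other
  point gives the same value.\<close>

definition laplace :: real where
  "laplace = expectation (\<lambda>\<omega>. exp (- truncated \<omega> 0))"

text \<open>Otherwise a nonnegative random variable would have expectation zero, and the potential
  would vanish almost surely at the origin, against \<open>nontrivial\<close>.\<close>

lemma laplace_less_1: "laplace < 1"
proof (rule ccontr)
  assume "\<not> laplace < 1"
  have int: "integrable M (\<lambda>\<omega>. exp (- truncated \<omega> 0))"
    using integrable_exp_truncated[of "{0}"] by simp
  have "expectation (\<lambda>\<omega>. 1 - exp (- truncated \<omega> 0)) = 1 - laplace"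
    using int by (simp add: laplace_def prob_space)
  moreover have nn: "AE \<omega> in M. 0 \<le> 1 - exp (- truncated \<omega> 0)"
    using truncated_nonneg by (intro AE_I2) auto
  then have "0 \<le> expectation (\<lambda>\<omega>. 1 - exp (- truncated \<omega> 0))" by (rule integral_nonneg_AE)
  ultimately have "expectation (\<lambda>\<omega>. 1 - exp (- truncated \<omega> 0)) = 0"
    using \<open>\<not> laplace < 1\<close> by simp
  then have "AE \<omega> in M. 1 - exp (- truncated \<omega> 0) = 0"
    using int nn by (subst (asm) integral_nonneg_eq_0_iff_AE) auto
  then have "AE \<omega> in M. v \<omega> 0 = 0"
    by eventually_elim (auto simp: truncated_def min_def split: if_splits)
  moreover have "{\<omega>\<in>space M. v \<omega> 0 = 0} \<in> sets M"
  proof -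
    have [measurable]: "(\<lambda>\<omega>. v \<omega> 0) \<in> borel_measurable M"
      using measurable_Pair1[OF measurable_potential, of 0] by simp
    show ?thesis by measurable
  qed
  ultimately have "prob {\<omega>\<in>space M. v \<omega> 0 = 0} = 1" by (simp add: prob_Collect_eq_1)
  then show False using nontrivial by simp
qed

lemma laplace_pos: "0 < laplace"
proof -
  have "exp (- 1) \<le> exp (- truncated \<omega> 0)" for \<omega> using truncated_le_1[of \<omega> 0] by simp
  moreover have "integrable M (\<lambda>\<omega>. exp (- truncated \<omega> 0))"
    using integrable_exp_truncated[of "{0}"] by simp
  ultimately have "expectation (\<lambda>\<omega>. exp (- 1)) \<le> laplace"
    unfolding laplace_def by (intro integral_mono) auto
  then have "exp (- 1) \<le> laplace" by (simp add: prob_space)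
  then show ?thesis by (rule less_le_trans[OF exp_gt_zero])
qed

lemma expectation_exp_truncated: "expectation (\<lambda>\<omega>. exp (- truncated \<omega> x)) = laplace"
proof -
  obtain T where T: "ergodic_group M T" "\<And>\<omega> x q. \<omega> \<in> space M \<Longrightarrow> v \<omega> (x + q) = v (T q \<omega>) x"
    using stationary by blast
  have [measurable]: "T x \<in> measurable M M" and distr: "distr M M (T x) = M"
    using T(1) by (auto simp: ergodic_group_def)
  have "expectation (\<lambda>\<omega>. exp (- truncated \<omega> x)) = expectation (\<lambda>\<omega>. exp (- truncated (T x \<omega>) 0))"
    using T(2)[of _ 0 x] by (intro Bochner_Integration.integral_cong) (auto simp: truncated_def)
  also have "\<dots> = (\<integral>\<omega>. exp (- truncated \<omega> 0) \<partial>distr M M (T x))"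
    by (intro integral_distr[symmetric]) measurable
  finally show ?thesis by (simp add: distr laplace_def)
qed

text \<open>Points are added one at a time: mixing is applied with \<open>g\<close> the single new
  factor and \<open>f\<close> the product over the old points. As \<open>g\<close> is at most 1, the
  error is at most \<delta> times the expectation of \<open>f\<close>, so each point costs a factor
  \<open>laplace + \<delta>\<close>.\<close>

lemma expectation_prod_exp_truncated_le:
  assumes dec: "decorrelated M v \<phi>" and \<phi>: "\<And>r. L \<le> r \<Longrightarrow> \<bar>\<phi> r\<bar> \<le> \<delta>" and L: "0 < L"
    and X: "finite X" "\<And>x y. x \<in> X \<Longrightarrow> y \<in> X \<Longrightarrow> x \<noteq> y \<Longrightarrow> L \<le> dist x y"
  shows "expectation (\<lambda>\<omega>. \<Prod>x\<in>X. exp (- truncated \<omega> x)) \<le> (laplace + \<delta>) ^ card X"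
  using X
proof (induction X rule: finite_induct)
  case empty
  then show ?case by (simp add: prob_space)
next
  case (insert y X)
  define f where "f \<omega> = (\<Prod>x\<in>X. exp (- truncated \<omega> x))" for \<omega>
  define g where "g \<omega> = exp (- truncated \<omega> y)" for \<omega>
  have \<delta>: "0 \<le> \<delta>" using \<phi>[of L] abs_ge_zero order_trans by blast
  have IH: "expectation f \<le> (laplace + \<delta>) ^ card X"
    unfolding f_def using insert by auto
  have intf: "integrable M f" unfolding f_def by (rule integrable_exp_truncated)
  have f0: "0 \<le> f \<omega>" and g0: "0 \<le> g \<omega>" for \<omega> by (auto simp: f_def g_def prod_nonneg)
  have fg: "expectation (\<lambda>\<omega>. f \<omega> * g \<omega>) \<le> expectation f * (laplace + \<delta>)"
  \<comment> \<open>\<open>setdist\<close> with an empty set is 0, so the distance bound needs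
    \<open>X\<close> nonempty; the first point is treated by stationarity alone.\<close>
  proof (cases "X = {}")
    case True
    then show ?thesis using \<delta> by (simp add: f_def[abs_def] g_def expectation_exp_truncated prob_space)
  next
    case False
    \<comment> \<open>\<open>real_of_ereal\<close> sends infinite values to 0, so \<open>s\<close>
      is first pinned between 0 and 1.\<close>
    define s where "s = esssup M (\<lambda>\<omega>. ereal \<bar>g \<omega>\<bar>)"
    have meas_g: "g \<in> borel_measurable M" unfolding g_def by measurable
    have s1: "s \<le> 1" unfolding s_def
      using meas_g exp_truncated_bounds(2) by (intro esssup_I) (auto simp: g_def intro!: AE_I2)
    have "esssup M (\<lambda>_. 0 :: ereal) \<le> s" unfolding s_def by (intro esssup_mono) (auto intro!: AE_I2)
    moreover have "esssup M (\<lambda>_. 0 :: ereal) = 0"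
      by (intro esssup_const) (simp add: emeasure_space_1)
    ultimately have s0: "0 \<le> s" by simp
    have sr: "0 \<le> real_of_ereal s" "real_of_ereal s \<le> 1" "s < \<infinity>"
      using s0 s1 by (cases s; auto)+
    have dist: "L \<le> setdist {y} X"
      using False insert by (intro le_setdistI) auto
    have "bounded {y}" "bounded X" "{y} \<inter> X = {}" using insert by (auto intro: finite_imp_bounded)
    moreover have "g \<in> borel_measurable (generated_sigma M v {y})"
      unfolding g_def truncated_def using measurable_generated_sigma[of y "{y}" v M] by measurable
    moreover have "f \<in> borel_measurable (generated_sigma M v X)"
      unfolding f_def truncated_def
    proof (rule borel_measurable_prod)
      fix x assume "x \<in> X"
      from measurable_generated_sigma[OF this, of v M]
      show "(\<lambda>\<omega>. exp (- min (v \<omega> x) 1)) \<in> borel_measurable (generated_sigma M v X)" by measurable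
    qed
    ultimately have "\<bar>(\<integral>\<omega>. \<bar>f \<omega> * g \<omega>\<bar> \<partial>M) - (\<integral>\<omega>. \<bar>f \<omega>\<bar> \<partial>M) * (\<integral>\<omega>. \<bar>g \<omega>\<bar> \<partial>M)\<bar>
          \<le> real_of_ereal s * (\<integral>\<omega>. \<bar>f \<omega>\<bar> \<partial>M) * \<phi> (setdist {y} X)"
      using dec intf sr(3) unfolding decorrelated_def s_def by blast
    then have "expectation (\<lambda>\<omega>. f \<omega> * g \<omega>) \<le> expectation f * laplace
        + real_of_ereal s * (expectation f * \<phi> (setdist {y} X))"
      using f0 g0 by (simp add: abs_le_iff g_def[abs_def] expectation_exp_truncated mult.assoc)
    also have "real_of_ereal s * (expectation f * \<phi> (setdist {y} X)) \<le> expectation f * \<delta>"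
    proof -
      have Ef: "0 \<le> expectation f" using f0 by (intro integral_nonneg_AE) auto
      have "real_of_ereal s * (expectation f * \<phi> (setdist {y} X)) \<le> real_of_ereal s * (expectation f * \<delta>)"
        using \<phi>[OF dist] sr Ef by (intro mult_left_mono) (auto simp: abs_le_iff)
      also have "\<dots> \<le> expectation f * \<delta>" using sr Ef \<delta> by (intro mult_left_le_one_le) auto
      finally show ?thesis .
    qed
    finally show ?thesis by (simp add: distrib_left)
  qed
  have "expectation (\<lambda>\<omega>. \<Prod>x\<in>insert y X. exp (- truncated \<omega> x)) = expectation (\<lambda>\<omega>. f \<omega> * g \<omega>)"
    using insert by (simp add: f_def g_def mult.commute)
  also note fg
  also have "expectation f * (laplace + \<delta>) \<le> (laplace + \<delta>) ^ card X * (laplace + \<delta>)"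
    using IH laplace_pos \<delta> by (intro mult_right_mono) auto
  finally show ?case using insert by (simp add: mult.commute)
qed

text \<open>Evaluating the field only at the points of shifted lattices, and averaging over the shift,
  makes the mixing hypothesis applicable: integrals over cells need not be measurable with respect
  to the sigma-algebra generated by the values of the field in the cell.\<close>
lemma prob_bad_cell_le:
  assumes dec: "decorrelated M v \<phi>" and \<phi>: "\<And>r. L \<le> r \<Longrightarrow> \<bar>\<phi> r\<bar> \<le> \<delta>" and L: "0 < L"
  shows "prob (bad_cell \<eta> (real N * L) (\<lambda>_. 0)) \<le> (exp \<eta> * (laplace + \<delta>)) ^ (N ^ CARD('d))"
proof -
  define n where "n = N ^ CARD('d)"
  define Q :: "(real ^ 'd) set" where "Q = cell L (\<lambda>_. 0)"
  have [measurable]: "Q \<in> sets borel" by (simp add: Q_def)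
  have emQ: "emeasure lborel Q = ennreal (L ^ CARD('d))" using L by (simp add: Q_def emeasure_cell)
  \<comment> \<open>Sum of the field over the \<open>N ^ CARD('d)\<close> points of one shifted
    lattice; integrated over all shifts in \<open>Q\<close> it gives the integral of the field over
    the large cell.\<close>
  define S where "S \<omega> x = (\<Sum>j\<in>subcells N. truncated \<omega> (x + lattice_point L j))" for \<omega> x
  define B where "B = bad_cell \<eta> (real N * L) (\<lambda>_. 0)"
  have [measurable]: "B \<in> sets M" by (simp add: B_def)
  have S_meas [measurable]: "(\<lambda>(\<omega>, x). S \<omega> x) \<in> borel_measurable (M \<Otimes>\<^sub>M lborel)"
  proof -
    have "(\<lambda>(\<omega>, x). truncated \<omega> (x + p)) \<in> borel_measurable (M \<Otimes>\<^sub>M lborel)" for p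
      using measurable_compose[of "\<lambda>(\<omega>, x). (\<omega>, x + p)" "M \<Otimes>\<^sub>M lborel" "M \<Otimes>\<^sub>M lborel", OF _ measurable_truncated_pair_lborel]
      by (simp add: case_prod_beta')
    then show ?thesis unfolding S_def case_prod_beta' by measurable
  qed
  \<comment> \<open>With this \<open>a\<close>, a bad cell means that the average of
    \<open>S \<omega>\<close> over \<open>Q\<close> is below \<open>a\<close>.\<close>
  define a where "a = \<eta> * real n"
  have pointwise: "ennreal (exp (- a) * L ^ CARD('d)) \<le> (\<integral>\<^sup>+x\<in>Q. ennreal (exp (- S \<omega> x)) \<partial>lborel)" if \<omega>: "\<omega> \<in> B" for \<omega>
  proof -
    have \<omega>M: "\<omega> \<in> space M" using \<omega> by (simp add: B_def bad_cell_def)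
    note [measurable] = measurable_truncated_path[OF \<omega>M]
    have bnd: "0 \<le> truncated \<omega> x" "truncated \<omega> x \<le> 1" for x
      using truncated_nonneg[OF \<omega>M] truncated_le_1 by auto
    have Sm [measurable]: "S \<omega> \<in> borel_measurable borel" unfolding S_def by measurable
    have int1: "set_integrable lborel D g" if "g \<in> borel_measurable borel" "\<And>x. \<bar>g x\<bar> \<le> b" "D \<in> sets borel" "emeasure lborel D < \<infinity>"
      for g :: "real ^ 'd \<Rightarrow> real" and b and D :: "(real ^ 'd) set"
    proof -
      have "set_integrable lborel D (\<lambda>_. b)"
        using that unfolding set_integrable_def by (intro integrable_scaleR_left integrable_real_indicator) auto
      then show ?thesis
        by (rule set_integrable_bound) (use that in \<open>auto simp: set_borel_measurable_def intro!: AE_I2 order_trans[OF _ abs_ge_self]\<close>)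
    qed
    have emc: "emeasure lborel (cell L j) < \<infinity>" for j :: "'d \<Rightarrow> int" using L by (simp add: emeasure_cell)
    have intj: "set_integrable lborel Q (\<lambda>x. truncated \<omega> (x + lattice_point L j))" for j
      using bnd emQ by (intro int1[of _ 1]) auto
    have "(LINT x:cell (real N * L) (\<lambda>_. 0)|lborel. truncated \<omega> x) = (\<Sum>j\<in>subcells N. LINT x:cell L j|lborel. truncated \<omega> x)"
      unfolding cell_eq_Union_subcells[OF L]
      using bnd emc by (intro set_integral_finite_Union disjoint_cells[OF L] int1[of _ 1]) auto
    also have "\<dots> = (\<Sum>j\<in>subcells N. LINT x:Q|lborel. truncated \<omega> (x + lattice_point L j))"
      unfolding Q_def by (intro sum.cong refl set_integral_cell_translate) measurable
    also have "\<dots> = (LINT x:Q|lborel. S \<omega> x)"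
      using intj unfolding S_def set_integrable_def set_lebesgue_integral_def scaleR_sum_right
      by (intro Bochner_Integration.integral_sum[symmetric]) auto
    finally have "(LINT x:Q|lborel. S \<omega> x) < \<eta> * (real N * L) ^ CARD('d)"
      using \<omega> by (simp add: B_def bad_cell_def)
    then have le: "(LINT x:Q|lborel. S \<omega> x) \<le> a * L ^ CARD('d)"
      by (simp add: a_def n_def power_mult_distrib)
    have S0: "0 \<le> S \<omega> x" "S \<omega> x \<le> real n" for x
      unfolding S_def n_def using bnd sum_mono[of "subcells N" "\<lambda>j. truncated \<omega> (x + lattice_point L j)" "\<lambda>_. 1"]
      by (auto simp: sum_nonneg card_subcells)
    have intS: "set_integrable lborel Q (S \<omega>)"
      using S0 emQ by (intro int1[of _ "real n"]) auto
    have intE: "set_integrable lborel Q (\<lambda>x. exp (- S \<omega> x))"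
      using S0 emQ by (intro int1[of _ 1]) auto
    have intc: "set_integrable lborel Q (\<lambda>x. exp (- a) * (1 + a))"
      using emQ by (intro int1[of _ "\<bar>exp (- a) * (1 + a)\<bar>"]) auto
    \<comment> \<open>Jensen's inequality through the tangent line at \<open>a\<close>: exp (- s) is
      at least exp (- a) (1 + a - s), to be integrated over \<open>Q\<close> with s =
      \<open>S \<omega> x\<close>.\<close>
    have "exp (- a) * L ^ CARD('d) \<le> exp (- a) * ((1 + a) * L ^ CARD('d) - (LINT x:Q|lborel. S \<omega> x))"
      using le by (intro mult_left_mono) (auto simp: algebra_simps)
    also have "\<dots> = (LINT x:Q|lborel. exp (- a) * (1 + a) - exp (- a) * S \<omega> x)"
    proof -
      have "measure lborel Q = L ^ CARD('d)" using emQ L by (simp add: measure_def)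
      then have const: "(LINT x:Q|lborel. exp (- a) * (1 + a)) = exp (- a) * (1 + a) * L ^ CARD('d)"
        using emQ by (simp add: set_lebesgue_integral_def mult.commute)
      have "(LINT x:Q|lborel. exp (- a) * (1 + a) - exp (- a) * S \<omega> x)
          = (LINT x:Q|lborel. exp (- a) * (1 + a)) - (LINT x:Q|lborel. exp (- a) * S \<omega> x)"
        using intS intc by (intro set_integral_diff) auto
      also have "(LINT x:Q|lborel. exp (- a) * S \<omega> x) = exp (- a) * (LINT x:Q|lborel. S \<omega> x)"
        by (rule set_integral_mult_right)
      finally show ?thesis unfolding const by (simp only: right_diff_distrib mult.assoc)
    qed
    also have "\<dots> \<le> (LINT x:Q|lborel. exp (- S \<omega> x))"
    proof (rule set_integral_mono)
      fix x
      have "exp (- a) * (1 + (a - S \<omega> x)) \<le> exp (- a) * exp (a - S \<omega> x)"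
        by (intro mult_left_mono exp_ge_add_one_self) auto
      also have "\<dots> = exp (- S \<omega> x)" by (simp flip: exp_add)
      finally show "exp (- a) * (1 + a) - exp (- a) * S \<omega> x \<le> exp (- S \<omega> x)" by (simp add: algebra_simps)
    qed (use intS intE intc in auto)
    finally have "ennreal (exp (- a) * L ^ CARD('d)) \<le> ennreal (LINT x:Q|lborel. exp (- S \<omega> x))"
      by (rule ennreal_leI)
    also have "\<dots> = (\<integral>\<^sup>+x. ennreal (indicator Q x *\<^sub>R exp (- S \<omega> x)) \<partial>lborel)"
      using intE unfolding set_lebesgue_integral_def set_integrable_def
      by (intro nn_integral_eq_integral[symmetric]) (auto simp: indicator_def)
    also have "\<dots> = (\<integral>\<^sup>+x\<in>Q. ennreal (exp (- S \<omega> x)) \<partial>lborel)"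
      by (intro nn_integral_cong) (auto simp: indicator_def)
    finally show ?thesis .
  qed
  interpret P: pair_sigma_finite lborel M by unfold_locales
  \<comment> \<open>Exponential Markov inequality: \<open>pointwise\<close> is integrated over the
    bad event, and Fubini moves the expectation inside, where the shift is fixed and only finitely
    many points of the field enter.\<close>
  have "ennreal (exp (- a) * L ^ CARD('d)) * emeasure M B
      = (\<integral>\<^sup>+\<omega>. ennreal (exp (- a) * L ^ CARD('d)) * indicator B \<omega> \<partial>M)" by (simp add: nn_integral_cmult_indicator)
  also have "\<dots> \<le> (\<integral>\<^sup>+\<omega>. (\<integral>\<^sup>+x\<in>Q. ennreal (exp (- S \<omega> x)) \<partial>lborel) \<partial>M)"
    using pointwise by (intro nn_integral_mono) (auto simp: indicator_def)
  also have "\<dots> = (\<integral>\<^sup>+x. (\<integral>\<^sup>+\<omega>. ennreal (exp (- S \<omega> x)) * indicator Q x \<partial>M) \<partial>lborel)"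
  proof (rule P.Fubini')
    have "(\<lambda>p. S (snd p) (fst p)) \<in> borel_measurable (lborel \<Otimes>\<^sub>M M)"
      using measurable_compose[OF measurable_pair_swap'[of lborel M] S_meas] by (simp add: case_prod_beta')
    then show "(\<lambda>(x, \<omega>). ennreal (exp (- S \<omega> x)) * indicator Q x) \<in> borel_measurable (lborel \<Otimes>\<^sub>M M)"
      by (simp add: case_prod_beta') measurable
  qed
  also have "\<dots> \<le> (\<integral>\<^sup>+x. ennreal ((laplace + \<delta>) ^ n) * indicator Q x \<partial>lborel)"
  proof (intro nn_integral_mono)
    fix x :: "real ^ 'd"
    define X where "X = (\<lambda>j. x + lattice_point L j) ` subcells N"
    have inj: "inj_on (\<lambda>j. x + lattice_point L j) (subcells N)"
      using dist_lattice_point_ge[OF L, of _ _ x] L by (intro inj_onI) (metis dist_self not_le)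
    have separated: "L \<le> dist y z" if yz: "y \<in> X" "z \<in> X" "y \<noteq> z" for y z
    proof -
      obtain i j where "y = x + lattice_point L i" "z = x + lattice_point L j" using yz by (auto simp: X_def)
      moreover from this have "i \<noteq> j" using yz(3) by blast
      ultimately show ?thesis using dist_lattice_point_ge[OF L] by blast
    qed
    have "card X = n" unfolding X_def n_def using inj by (simp add: card_image card_subcells)
    have "exp (- S \<omega> x) = (\<Prod>y\<in>X. exp (- truncated \<omega> y))" for \<omega>
      unfolding S_def X_def using inj by (simp add: prod.reindex exp_sum flip: sum_negf)
    then have "(\<integral>\<^sup>+\<omega>. ennreal (exp (- S \<omega> x)) \<partial>M) = ennreal (expectation (\<lambda>\<omega>. \<Prod>y\<in>X. exp (- truncated \<omega> y)))"
      using integrable_exp_truncated[of X] by (simp add: nn_integral_eq_integral prod_nonneg)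
    also have "\<dots> \<le> ennreal ((laplace + \<delta>) ^ card X)"
      by (intro ennreal_leI expectation_prod_exp_truncated_le[OF dec \<phi> L] separated) (auto simp: X_def)
    finally have "(\<integral>\<^sup>+\<omega>. ennreal (exp (- S \<omega> x)) \<partial>M) \<le> ennreal ((laplace + \<delta>) ^ n)" by (simp add: \<open>card X = n\<close>)
    then show "(\<integral>\<^sup>+\<omega>. ennreal (exp (- S \<omega> x)) * indicator Q x \<partial>M) \<le> ennreal ((laplace + \<delta>) ^ n) * indicator Q x"
      by (auto simp: indicator_def)
  qed
  also have "\<dots> = ennreal ((laplace + \<delta>) ^ n * L ^ CARD('d))"
    using L by (simp add: nn_integral_cmult_indicator emQ ennreal_mult'' )
  finally have "ennreal (exp (- a) * L ^ CARD('d) * prob B) \<le> ennreal ((laplace + \<delta>) ^ n * L ^ CARD('d))"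
    using L by (simp add: emeasure_eq_measure ennreal_mult')
  moreover have "0 \<le> \<delta>" using \<phi>[of L] abs_ge_zero order_trans by blast
  then have "0 \<le> (laplace + \<delta>) ^ n * L ^ CARD('d)" using laplace_pos L by simp
  ultimately have "exp (- a) * L ^ CARD('d) * prob B \<le> (laplace + \<delta>) ^ n * L ^ CARD('d)"
    by (simp add: ennreal_le_iff)
  then have "exp (- a) * prob B \<le> (laplace + \<delta>) ^ n" using L by (simp add: mult.assoc mult.left_commute mult.commute[of _ "L ^ _"])
  then have "exp a * (exp (- a) * prob B) \<le> exp a * (laplace + \<delta>) ^ n" by (intro mult_left_mono) auto
  also have "exp a * (exp (- a) * prob B) = prob B" by (simp add: exp_minus)
  also have "exp a = exp \<eta> ^ n" by (simp add: a_def exp_of_nat2_mult)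
  finally show ?thesis by (simp add: B_def n_def power_mult_distrib)
qed

end

section \<open>The integrated density of states\<close>

text \<open>The index box has radius \<open>l\<close> for every \<open>R \<ge> 1\<close>, usually
  far more cells than meet the cube. This costs nothing that matters: the size of the index box
  stays comparable to the volume of the cube, with a ratio independent of \<open>R\<close>.\<close>

lemma cube_subset_cells:
  fixes R :: real
  assumes "1 \<le> R" "1 \<le> l"
  shows "cube l \<subseteq> (\<Union>j\<in>lattice_box (\<lambda>_. 0) l. cell R j)"
proof
  fix x :: "real ^ 'd" assume x: "x \<in> cube l"
  have "\<bar>\<lfloor>x $ k / R\<rfloor>\<bar> \<le> int l" for k
  proof -
    have "\<bar>x $ k\<bar> < real l / 2" 
    proof -
      have "- (real l / 2) < x $ k \<and> x $ k < real l / 2" using x unfolding cube_def by blast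
      then show ?thesis by linarith
    qed
    moreover have "\<bar>x $ k / R\<bar> \<le> \<bar>x $ k\<bar>"
      using assms by (simp add: abs_divide divide_le_eq mult_left_mono[of 1 R "\<bar>x $ k\<bar>", simplified])
    ultimately have "- (real l / 2) < x $ k / R" "x $ k / R < real l / 2" by linarith+
    then show ?thesis using assms(2) by linarith
  qed
  then have "(\<lambda>k. \<lfloor>x $ k / R\<rfloor>) \<in> lattice_box (\<lambda>_. 0) l" by (simp add: lattice_box_def)
  then show "x \<in> (\<Union>j\<in>lattice_box (\<lambda>_. 0) l. cell R j)"
    using mem_cell_iff[of R x] assms(1) by (auto intro!: bexI)
qed

lemma borel_cube: "cube l \<in> sets borel"
  unfolding cube_def by measurable

context random_potential
begin

definition bad_count :: "real \<Rightarrow> real \<Rightarrow> nat \<Rightarrow> 'w \<Rightarrow> nat" where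
  "bad_count \<eta> R m \<omega> = card {j\<in>lattice_box (\<lambda>_. 0) m. \<omega> \<in> bad_cell \<eta> R j}"

text \<open>By stationarity, cell \<open>j\<close> is bad for \<open>\<omega>\<close> iff cell 0 is
  bad for the translate of \<open>\<omega>\<close> by \<open>lattice_point R j\<close>. Restricting
  the group to these translations gives a lattice action whose visits are the bad cells.\<close>

lemma prob_bad_count_le:
  assumes t: "0 < t"
  shows "{\<omega>\<in>space M. \<exists>m. t * real ((2 * m + 1) ^ CARD('d)) < real (bad_count \<eta> R m \<omega>)} \<in> sets M"
    and "prob {\<omega>\<in>space M. \<exists>m. t * real ((2 * m + 1) ^ CARD('d)) < real (bad_count \<eta> R m \<omega>)}
      \<le> 2 ^ CARD('d) * prob (bad_cell \<eta> R (\<lambda>_. 0)) / t"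
proof -
  obtain T where T: "ergodic_group M T" "\<And>\<omega> x q. \<omega> \<in> space M \<Longrightarrow> v \<omega> (x + q) = v (T q \<omega>) x"
    using stationary by blast
  define \<tau> where "\<tau> j = T (lattice_point R j)" for j
  interpret lattice_action M \<tau>
    using T(1) by unfold_locales (auto simp: ergodic_group_def \<tau>_def lattice_point_add)
  have "\<tau> j \<omega> \<in> bad_cell \<eta> R (\<lambda>_. 0) \<longleftrightarrow> \<omega> \<in> bad_cell \<eta> R j" if \<omega>: "\<omega> \<in> space M" for \<omega> j
  proof -
    have "\<tau> j \<omega> \<in> space M" using \<omega> by (rule measurable_space[OF measurable_action])
    moreover have "(LINT x:cell R j|lborel. truncated \<omega> x) = (LINT x:cell R (\<lambda>_. 0)|lborel. truncated (\<tau> j \<omega>) x)"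
      unfolding set_integral_cell_translate[OF measurable_truncated_path[OF \<omega>]]
      by (simp add: truncated_def T(2)[OF \<omega>] \<tau>_def)
    ultimately show ?thesis using \<omega> by (simp add: bad_cell_def)
  qed
  then have eq: "bad_count \<eta> R m \<omega> = visits (bad_cell \<eta> R (\<lambda>_. 0)) m \<omega>" if "\<omega> \<in> space M" for m \<omega>
    using that by (simp add: bad_count_def visits_def)
  have eq_set: "{\<omega>\<in>space M. \<exists>m. t * real ((2 * m + 1) ^ CARD('d)) < real (bad_count \<eta> R m \<omega>)}
      = {\<omega>\<in>space M. \<exists>m. t * real ((2 * m + 1) ^ CARD('d)) < real (visits (bad_cell \<eta> R (\<lambda>_. 0)) m \<omega>)}"
    using eq by auto
  show "{\<omega>\<in>space M. \<exists>m. t * real ((2 * m + 1) ^ CARD('d)) < real (bad_count \<eta> R m \<omega>)} \<in> sets M"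
    unfolding eq_set by measurable
  show "prob {\<omega>\<in>space M. \<exists>m. t * real ((2 * m + 1) ^ CARD('d)) < real (bad_count \<eta> R m \<omega>)}
      \<le> 2 ^ CARD('d) * prob (bad_cell \<eta> R (\<lambda>_. 0)) / t"
    unfolding eq_set by (rule maximal_inequality[OF sets_bad_cell t])
qed

text \<open>\<open>E'\<close> provides the strict gap that \<open>ids_le\<close> asks for. The
  factor \<open>3 ^ CARD('d)\<close> is \<open>2 * l + 1 \<le> 3 * l\<close>, comparing the size of
  the index box with the volume of the cube.\<close>

lemma ids_le_bad_count:
  fixes R \<eta> E E' t :: real
  assumes \<omega>: "\<omega> \<in> space M" and R: "1 \<le> R" and \<eta>: "0 < \<eta>" "\<eta> \<le> 1"
    and E': "16 * (CARD('d) * 2 ^ CARD('d) * R\<^sup>2) * E' < \<eta>" "E < E'" and l: "1 \<le> l"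
    and t: "real (bad_count \<eta> R l \<omega>) \<le> t * real ((2 * l + 1) ^ CARD('d))" "0 \<le> t"
  shows "ids l (v \<omega>) E \<le> ennreal (3 ^ CARD('d) * t)"
proof -
  define J' where "J' = {j\<in>lattice_box (\<lambda>_. 0) l. \<omega> \<in> bad_cell \<eta> R j}"
  have "eigen_count (cube l) (v \<omega>) E' \<le> enat (card J')"
  proof (rule eigen_count_le[OF borel_cube measurable_potential_path[OF \<omega>] _ measurable_truncated_path[OF \<omega>] _ _ _ R
        finite_lattice_box cube_subset_cells[OF R l] _ \<eta> _ E'(1)])
    show "\<eta> * R ^ CARD('d) \<le> (LINT x:cell R j|lborel. truncated \<omega> x)" if "j \<in> lattice_box (\<lambda>_. 0) l - J'" for j
      using that \<omega> by (auto simp: J'_def bad_cell_def)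
  qed (use nonneg[OF \<omega>] truncated_nonneg[OF \<omega>] truncated_le_1 truncated_le in \<open>auto simp: J'_def\<close>)
  then have "ids l (v \<omega>) E \<le> ennreal (real (card J') / real l ^ CARD('d))"
    by (rule ids_le[OF l _ E'(2)])
  also have "real (card J') / real l ^ CARD('d) \<le> 3 ^ CARD('d) * t"
  proof -
    have "real (card J') \<le> t * real ((2 * l + 1) ^ CARD('d))" using t by (simp add: bad_count_def J'_def)
    also have "\<dots> \<le> t * real ((3 * l) ^ CARD('d))"
      using l t by (intro mult_left_mono of_nat_mono power_mono) auto
    also have "\<dots> = 3 ^ CARD('d) * t * real l ^ CARD('d)" by (simp add: power_mult_distrib)
    finally show ?thesis using l by (simp add: divide_le_eq)
  qed
  finally show ?thesis by (simp add: ennreal_leI)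
qed

end

text \<open>As \<open>s < real d\<close>, the growing term of the exponent is eventually below half
  of the decaying one; what remains is dominated by a geometric series.\<close>

lemma summable_exp_powr_minus_power:
  fixes a \<eta> s :: real and d :: nat
  assumes "0 < \<eta>" "0 \<le> a" "0 < s" "s < real d"
  shows "summable (\<lambda>n. exp (a * (real n + 2) powr s - \<eta> * real (Suc n ^ d)))"
proof (rule summable_comparison_test_ev)
  show "summable (\<lambda>n. exp (- \<eta> / 2) ^ n)" using assms by (intro summable_geometric) auto
  have "((\<lambda>n. a * 2 powr s * real (Suc n) powr (s - real d)) \<longlongrightarrow> a * 2 powr s * 0) sequentially"
    using assms
    by (intro tendsto_mult tendsto_const tendsto_neg_powr filterlim_compose[OF filterlim_real_sequentially filterlim_Suc]) auto
  then have "\<forall>\<^sub>F n in sequentially. a * 2 powr s * real (Suc n) powr (s - real d) < \<eta> / 2"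
    using assms by (intro order_tendstoD(2)) auto
  then show "\<forall>\<^sub>F n in sequentially. norm (exp (a * (real n + 2) powr s - \<eta> * real (Suc n ^ d))) \<le> exp (- \<eta> / 2) ^ n"
  proof eventually_elim
    case (elim n)
    have d: "1 \<le> d" using assms by linarith
    have "a * (real n + 2) powr s \<le> a * (2 * real (Suc n)) powr s"
      using assms by (intro mult_left_mono powr_mono2) auto
    also have "\<dots> = a * 2 powr s * real (Suc n) powr (s - real d) * real (Suc n ^ d)"
      by (simp add: powr_mult powr_diff powr_realpow flip: of_nat_Suc)
    also have "\<dots> \<le> \<eta> / 2 * real (Suc n ^ d)" using elim by (intro mult_right_mono) auto
    finally have "a * (real n + 2) powr s - \<eta> * real (Suc n ^ d) \<le> - (\<eta> / 2 * real (Suc n ^ d))" by simp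
    also have "\<dots> \<le> - (\<eta> / 2 * real n)"
    proof -
      have "n \<le> Suc n ^ d" using d power_increasing[of 1 d "Suc n"] by simp
      then show ?thesis using assms by (simp del: of_nat_power power_Suc)
    qed
    finally show ?case by (simp add: exp_of_nat_mult[symmetric] mult.commute)
  qed
qed

section \<open>Energy windows and the Borel-Cantelli lemma\<close>

context random_potential
begin

text \<open>Borel-Cantelli handles countably many events while \<open>E\<close> is continuous, so
  energies are cut into windows from b / (n + 2)^2 to b / (n + 1)^2, with cells of side (n + 1) L on
  window n. The upper end governs the spectral estimate, the lower end the density
  threshold.\<close>

lemma ids_bound_AE:
  assumes "0 < \<alpha>" "0 < \<gamma>" "\<gamma> < real CARD('d) / 2"
  shows "AE \<omega> in M. \<exists>\<E>>0. \<forall>E. 0 < E \<and> E < \<E> \<longrightarrow>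
    (\<forall>l\<ge>1. ids l (v \<omega>) E \<le> ennreal (exp (- \<alpha> / E powr \<gamma>)))"
proof -
  obtain \<phi> where \<phi>: "(\<phi> \<longlongrightarrow> 0) at_top" "decorrelated M v \<phi>" using mixing by blast
  \<comment> \<open>Half the gap: \<open>laplace + \<delta>\<close> then lies midway between
    \<open>laplace\<close> and 1, hence above 1/2, from which \<open>\<eta> \<le> 1\<close> is
    derived.\<close>
  define \<delta> where "\<delta> = (1 - laplace) / 2"
  have \<delta>: "0 < \<delta>" using laplace_less_1 by (simp add: \<delta>_def)
  have "\<forall>\<^sub>F r in at_top. \<bar>\<phi> r\<bar> < \<delta>"
    using tendstoD[OF \<phi>(1) \<delta>] by (simp add: dist_real_def)
  then obtain L0 where L0: "\<And>r. L0 \<le> r \<Longrightarrow> \<bar>\<phi> r\<bar> < \<delta>" by (auto simp: eventually_at_top_linorder)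
  define L where "L = max L0 1"
  have L: "1 \<le> L" "\<And>r. L \<le> r \<Longrightarrow> \<bar>\<phi> r\<bar> \<le> \<delta>" using L0 by (auto simp: L_def less_imp_le)
  define \<rho> where "\<rho> = laplace + \<delta>"
  have \<rho>: "1 / 2 < \<rho>" "\<rho> < 1" using laplace_pos laplace_less_1 by (auto simp: \<rho>_def \<delta>_def field_simps)
  \<comment> \<open>Half of the decay rate pays for the factor \<open>exp \<eta>\<close> in
    \<open>prob_bad_cell_le\<close>; the other half survives as \<open>exp (- \<eta>)\<close> per
    subcell.\<close>
  define \<eta> where "\<eta> = - ln \<rho> / 2"
  have \<eta>0: "0 < \<eta>" using \<rho> by (simp add: \<eta>_def)
  have "- ln \<rho> = ln (1 / \<rho>)" using \<rho> by (simp add: ln_div)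
  also have "\<dots> \<le> 1 / \<rho> - 1" using \<rho> by (intro ln_le_minus_one) auto
  also have "\<dots> \<le> 1" using \<rho> by (simp add: field_simps)
  finally have \<eta>1: "\<eta> \<le> 1" by (simp add: \<eta>_def)
  have "\<rho> = exp (- (2 * \<eta>))" using \<rho> by (simp add: \<eta>_def)
  then have \<rho>\<eta>: "exp \<eta> * (laplace + \<delta>) = exp (- \<eta>)"
    unfolding \<rho>_def[symmetric] by (simp flip: exp_add)
  define K where "K = real CARD('d) * 2 ^ CARD('d) * L\<^sup>2"
  have K: "0 < K" using L by (simp add: K_def)
  \<comment> \<open>Makes \<open>16 * K * b\<close> equal to \<open>\<eta> / 2\<close>, strictly
    below the threshold \<eta> of the spectral estimate.\<close>
  define b where "b = \<eta> / (32 * K)"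
  have b: "0 < b" using \<eta>0 K by (simp add: b_def)
  \<comment> \<open>The target bound at the lower end of window \<open>n\<close>, divided by the
    factor lost in \<open>ids_le_bad_count\<close>.\<close>
  define t where "t n = exp (- \<alpha> / (b / (real n + 2)\<^sup>2) powr \<gamma>) / 3 ^ CARD('d)" for n
  have t: "0 < t n" for n by (simp add: t_def)
  define R where "R n = real (Suc n) * L" for n
  have R: "1 \<le> R n" for n using mult_mono[of 1 "real (Suc n)" 1 L] L(1) by (simp add: R_def)
  define A where "A n = {\<omega>\<in>space M. \<exists>m. t n * real ((2 * m + 1) ^ CARD('d)) < real (bad_count \<eta> (R n) m \<omega>)}" for n
  have A [measurable]: "A n \<in> sets M" for n unfolding A_def by (rule prob_bad_count_le(1)[OF t])
  have probA: "prob (A n) \<le> 6 ^ CARD('d) * exp (\<alpha> * b powr (- \<gamma>) * (real n + 2) powr (2 * \<gamma>) - \<eta> * real (Suc n ^ CARD('d)))" for n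
  proof -
    have "prob (bad_cell \<eta> (R n) (\<lambda>_. 0)) \<le> exp (- \<eta>) ^ (Suc n ^ CARD('d))"
      unfolding R_def \<rho>\<eta>[symmetric] using L by (intro prob_bad_cell_le[OF \<phi>(2)]) auto
    also have "\<dots> = exp (- \<eta> * real (Suc n ^ CARD('d)))"
      by (rule exp_of_nat2_mult[symmetric])
    finally have bad: "prob (bad_cell \<eta> (R n) (\<lambda>_. 0)) \<le> exp (- \<eta> * real (Suc n ^ CARD('d)))" .
    \<comment> \<open>The square in the window doubles the exponent to \<open>2 * \<gamma>\<close>,
      which the hypothesis on \<gamma> keeps below the dimension.\<close>
    have "((real n + 2)\<^sup>2) powr \<gamma> = (real n + 2) powr (2 * \<gamma>)"
      by (simp add: powr_powr flip: powr_numeral)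
    then have pw: "\<alpha> / (b / (real n + 2)\<^sup>2) powr \<gamma> = \<alpha> * b powr (- \<gamma>) * (real n + 2) powr (2 * \<gamma>)"
      using b by (simp add: powr_divide powr_minus field_simps)
    have "prob (A n) \<le> 2 ^ CARD('d) * prob (bad_cell \<eta> (R n) (\<lambda>_. 0)) / t n"
      unfolding A_def by (rule prob_bad_count_le(2)[OF t])
    also have "\<dots> \<le> 2 ^ CARD('d) * exp (- \<eta> * real (Suc n ^ CARD('d))) / t n"
      using bad t[of n] by (intro divide_right_mono mult_left_mono) auto
    also have "\<dots> = (2 * 3) ^ CARD('d) * (exp (- \<eta> * real (Suc n ^ CARD('d))) * exp (\<alpha> / (b / (real n + 2)\<^sup>2) powr \<gamma>))"
      unfolding t_def power_mult_distrib by (simp add: exp_minus field_simps)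
    also have "exp (- \<eta> * real (Suc n ^ CARD('d))) * exp (\<alpha> / (b / (real n + 2)\<^sup>2) powr \<gamma>)
        = exp (\<alpha> * b powr (- \<gamma>) * (real n + 2) powr (2 * \<gamma>) - \<eta> * real (Suc n ^ CARD('d)))"
      unfolding pw by (simp flip: exp_add del: of_nat_power power_Suc)
    finally show ?thesis by simp
  qed
  have "summable (\<lambda>n. prob (A n))"
  proof (rule summable_comparison_test)
    show "summable (\<lambda>n. 6 ^ CARD('d) * exp (\<alpha> * b powr (- \<gamma>) * (real n + 2) powr (2 * \<gamma>) - \<eta> * real (Suc n ^ CARD('d))))"
      using assms \<eta>0 by (intro summable_mult summable_exp_powr_minus_power) auto
    show "\<exists>N. \<forall>n\<ge>N. norm (prob (A n)) \<le> 6 ^ CARD('d) * exp (\<alpha> * b powr (- \<gamma>) * (real n + 2) powr (2 * \<gamma>) - \<eta> * real (Suc n ^ CARD('d)))"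
      using probA by auto
  qed
  then have "AE \<omega> in M. \<forall>\<^sub>F n in sequentially. \<omega> \<in> space M - A n"
    by (intro borel_cantelli_AE1) (auto simp: emeasure_eq_measure)
  then show ?thesis
  proof eventually_elim
    case (elim \<omega>)
    then obtain n0 where n0: "\<And>n. n0 \<le> n \<Longrightarrow> \<omega> \<in> space M - A n" by (auto simp: eventually_sequentially)
    have \<omega>: "\<omega> \<in> space M" using n0 by blast
    show ?case
    proof (intro exI[of _ "b / (real n0 + 1)\<^sup>2"] conjI allI impI)
      show "0 < b / (real n0 + 1)\<^sup>2" using b by simp
      fix E :: real and l :: nat assume E: "0 < E \<and> E < b / (real n0 + 1)\<^sup>2" and l: "1 \<le> l"
      \<comment> \<open>For the least \<open>k\<close> with this property, \<open>k - 1\<close> is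
        the window that contains \<open>E\<close>. Since \<open>E\<close> lies below
        \<open>b / (real n0 + 1)\<^sup>2\<close>, this \<open>k\<close> exceeds \<open>n0\<close>,
        so the window is one where the exceptional event no longer occurs.\<close>
      define P where "P k \<longleftrightarrow> b / (real k + 1)\<^sup>2 \<le> E" for k
      have "\<exists>k. P k"
      proof -
        obtain k where k: "b / E < real k" using reals_Archimedean2 by blast
        have "b < E * real k" using k E by (simp add: field_simps)
        also have "\<dots> \<le> E * (real k + 1)\<^sup>2"
          using E by (intro mult_left_mono) (auto simp: power2_eq_square algebra_simps)
        finally show ?thesis by (auto simp: P_def divide_le_eq intro!: exI[of _ k])
      qed
      then obtain k where k: "P k" "\<And>i. i < k \<Longrightarrow> \<not> P i" by (metis exists_least_iff)
      have "n0 < k"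
      proof (rule ccontr)
        assume "\<not> n0 < k"
        then have "b / (real n0 + 1)\<^sup>2 \<le> b / (real k + 1)\<^sup>2"
          using b by (intro divide_left_mono power_mono) auto
        then show False using E k(1) by (simp add: P_def)
      qed
      then obtain n where n: "k = Suc n" "n0 \<le> n" by (cases k) auto
      have E_less: "E < b / (real n + 1)\<^sup>2" using k(2)[of n] n by (simp add: P_def)
      have E_ge: "b / (real n + 2)\<^sup>2 \<le> E" using k(1) n by (simp add: P_def add.commute)
      have "\<not> t n * real ((2 * l + 1) ^ CARD('d)) < real (bad_count \<eta> (R n) l \<omega>)"
        using n0[OF n(2)] unfolding A_def by blast
      then have le: "real (bad_count \<eta> (R n) l \<omega>) \<le> t n * real ((2 * l + 1) ^ CARD('d))" by linarith
      have "16 * (CARD('d) * 2 ^ CARD('d) * (R n)\<^sup>2) * (b / (real n + 1)\<^sup>2) = \<eta> / 2"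
      proof -
        have "real CARD('d) * 2 ^ CARD('d) * (R n)\<^sup>2 = K * (real n + 1)\<^sup>2"
          by (simp add: K_def R_def power_mult_distrib add.commute)
        moreover have "(real n + 1)\<^sup>2 \<noteq> 0" by simp
        ultimately show ?thesis using K by (simp add: b_def)
      qed
      also have "\<eta> / 2 < \<eta>" using \<eta>0 by simp
      finally have E_small: "16 * (CARD('d) * 2 ^ CARD('d) * (R n)\<^sup>2) * (b / (real n + 1)\<^sup>2) < \<eta>" .
      then have "ids l (v \<omega>) E \<le> ennreal (3 ^ CARD('d) * t n)"
        using t[of n] by (intro ids_le_bad_count[OF \<omega> R \<eta>0 \<eta>1 E_small E_less l le]) auto
      also have "3 ^ CARD('d) * t n = exp (- \<alpha> / (b / (real n + 2)\<^sup>2) powr \<gamma>)" by (simp add: t_def)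
      also have "ennreal \<dots> \<le> ennreal (exp (- \<alpha> / E powr \<gamma>))"
      proof -
        have "0 < b / (real n + 2)\<^sup>2" using b by simp
        moreover have "(b / (real n + 2)\<^sup>2) powr \<gamma> \<le> E powr \<gamma>"
          using E_ge b assms by (intro powr_mono2) auto
        ultimately have "\<alpha> / E powr \<gamma> \<le> \<alpha> / (b / (real n + 2)\<^sup>2) powr \<gamma>"
          using assms E by (intro divide_left_mono mult_pos_pos) auto
        then show ?thesis by (intro ennreal_leI) simp
      qed
      finally show "ids l (v \<omega>) E \<le> ennreal (exp (- \<alpha> / E powr \<gamma>))" .
    qed
  qed
qed

end

theorem theorem5p1:
  fixes M :: "'w measure" and v :: "'w \<Rightarrow> real ^ 'd::finite \<Rightarrow> real" and \<alpha> \<gamma> :: real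
  assumes "random_potential M v"
    and "0 < \<alpha>" and "0 < \<gamma>" and "\<gamma> < real CARD('d) / 2"
  shows "\<exists>\<Omega>'\<in>sets M. measure M \<Omega>' = 1 \<and>
    (\<forall>\<omega>\<in>\<Omega>'. \<exists>\<E>>0::real. \<forall>E::real. 0 < E \<and> E < \<E> \<longrightarrow>
       (\<forall>l\<ge>1. ids l (v \<omega>) E \<le> ennreal (exp (- \<alpha> / E powr \<gamma>))))"
proof -
  interpret random_potential M v by fact
  obtain N where N: "N \<in> null_sets M" "\<And>\<omega>. \<omega> \<in> space M - N \<Longrightarrow> \<exists>\<E>>0. \<forall>E. 0 < E \<and> E < \<E> \<longrightarrow>
      (\<forall>l\<ge>1. ids l (v \<omega>) E \<le> ennreal (exp (- \<alpha> / E powr \<gamma>)))"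
    using ids_bound_AE[OF assms(2-4)] by (auto elim!: AE_E3)
  have "measure M (space M - N) = 1"
    using N(1) prob_compl[of N] by (simp add: null_sets_def measure_def)
  then show ?thesis using N by (intro bexI[of _ "space M - N"]) auto
qed

end
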